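(* Let $(a,b)=(5.7,0.2)$ and let $R_{a,b}:\mathbb{R}^3\to\mathbb{R}^3$, $R_{a,b}(x,y,z)=(-(y+z),\;x+by,\;b+z(x-a))$ be the Rössler vector field. Let $\Theta=\{(x,y,z): x=0,\ y<0,\ -(y+z)>0\}$, let $P$ be the Poincaré map on $\Theta$ of the equation $x'=R_{a,b}(x)$, and let $N_0,N_1,N_2\subset\Theta$ be the h-sets described in the context (for which $N_0\stackrel{P}{\Longrightarrow}N_1$, $N_0\stackrel{P}{\Longrightarrow}N_2$, $N_1\stackrel{P}{\Longrightarrow}N_1$, $N_1\stackrel{P}{\Longrightarrow}N_2$, $N_2\stackrel{P}{\Longrightarrow}N_0$). Let $$A=[\alpha_{ij}]_{i,j=0,1,2}=\begin{bmatrix}0&1&1\\0&1&1\\1&0&0\end{bmatrix},\qquad \Sigma_A^+=\{c=(c_i)_{i\in\mathbb{N}}\in\{0,1,2\}^{\mathbb{N}}:\ \alpha_{c_ic_{i+1}}>0\ \text{for all } i\},\quad \mathbb{N}=\{0,1,2,\dots\}.$$ Then there exists $\delta>0$ such that for every continuous $\epsilon:\mathbb{R}\times\mathbb{R}^3\to\mathbb{R}^3$ with $|\epsilon|<\delta$, for every $t_0\in\mathbb{R}$ and every sequence $c=(c_i)\in\Sigma_A^+$ there exist a solution $x_c:[t_0,\infty)\to\mathbb{R}^3$ of $$x'=R_{a,b}(x)+\epsilon(t,x)$$ and a sequence $t_0<t_1<t_2<\dots<t_n<t_{n+1}<\dots$ such that, for $t\in[t_0,\infty)$, $$x_c(t)\in\Theta\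 \text{ if and only if }\ t=t_i\text{ for some } i,$$ and $$x_c(t_i)\in|N_{c_i}|\quad\text{for all } i.$$
   Context: **Norm of the perturbation.** $|\epsilon|$ denotes the supremum of the norm of $\epsilon(t,x)$ over all $(t,x)\in\mathbb{R}\times\mathbb{R}^3$. **Poincaré map.** $\Theta$ is the part of the plane $\{x=0\}$ with $y<0$ and $\dot x>0$ for the unperturbed Rössler equation, identified with an open subset of $\mathbb{R}^2$. For $x_0\in\Theta$ let $x(\cdot)$ be the solution of $x'=R_{a,b}(x)$ with $x(0)=x_0$ and $\sigma(x_0)=\inf\{t>0:x(t)\in\Theta\}$; then $P(x_0)=x(\sigma(x_0))$, where defined. For the perturbed equation and an initial time $T$, the Poincaré map is $f^{T}(x_0)=x(\sigma(x_0,T))$, where $x$ is the solution of $x'=R_{a,b}(x)+\epsilon(t,x)$, $x(T)=x_0\in\Theta$, and $\sigma(x_0,T)=\inf\{t>T:x(t)\in\Theta\}$. It is taken as a standing fact in the paper that for $|\epsilon|$ sufficiently small these maps are well defined (and continuous) on the sets $N_0,N_1,N_2$, and $\sigma(x_0,T)-T$ is bounded from below and above by constants independent of $\epsilon$, $T$ and $x_0\in N_0\cup N_1\cup N_2$. **h-sets.** An h-set $N$ in $\mathbb{R}^d$ (here $d=2$) consists of: a compact set $|N|\subset\mathbb{R}^d$; numbers $u(N),s(N)\in\{0,1,2,\dots\}$ with $u(N)+s(N)=d$; and a homeomorphism $c_N:\mathbb{R}^d\to\mathbb{R}^d=\mathbb{R}^{u(N)}\times\mathbb{R}^{s(N)}$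 with $c_N(|N|)=\overline{B_{u(N)}}(0,1)\times\overline{B_{s(N)}}(0,1)$, where $B_m(0,1)$ is the open unit ball in $\mathbb{R}^m$. Put $N_c=\overline{B_{u(N)}}(0,1)\times\overline{B_{s(N)}}(0,1)$, $N_c^-=\partial\overline{B_{u(N)}}(0,1)\times\overline{B_{s(N)}}(0,1)$, $N_c^+=\overline{B_{u(N)}}(0,1)\times\partial\overline{B_{s(N)}}(0,1)$. One writes $N$ for $|N|$. **Covering relations.** Let $N,M$ be h-sets with $u(N)=u(M)=u$, $s(N)=s(M)=s$, let $f:|N|\to\mathbb{R}^{d}$ be continuous (in particular defined on all of $|N|$), and let $f_c=c_M\circ f\circ c_N^{-1}:N_c\to\mathbb{R}^u\times\mathbb{R}^s$. One writes $N\stackrel{f}{\Longrightarrow}M$ if there is a continuous homotopy $h:[0,1]\times N_c\to\mathbb{R}^u\times\mathbb{R}^s$ with $h_0=f_c$, $h([0,1],N_c^-)\cap M_c=\emptyset$, $h([0,1],N_c)\cap M_c^+=\emptyset$, and such that: if $u>0$, there is a linear map $L:\mathbb{R}^u\to\mathbb{R}^u$ with $h_1(p,q)=(Lp,0)$ and $L(\partial B_u(0,1))\subset\mathbb{R}^u\setminus\overline{B_u}(0,1)$; if $u=0$, $h_1(x)=0$ for all $x\in N_c$. **The h-sets $N_0,N_1,N_2$.** It is a known (computer-assisted) result, taken as given, that for $(a,b)=(5.7,0.2)$ there are h-sets $N_0,N_1,N_2\subset\Theta$, contained in the domain of $P$, with $N_0\stackrel{P}{\Longrightarrow}N_1,N_2$;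 $N_1\stackrel{P}{\Longrightarrow}N_1,N_2$; $N_2\stackrel{P}{\Longrightarrow}N_0$. Fix such h-sets. *)

theory Defs
  imports "HOL-Analysis.Analysis"
begin

section \<open>Ordinary differential equations and the Roessler system\<close>

text \<open>At an end point of the interval \<open>I\<close> the derivative is one-sided.\<close>

definition ode_solution ::
    "(real \<Rightarrow> real^3 \<Rightarrow> real^3) \<Rightarrow> (real \<Rightarrow> real^3) \<Rightarrow> real set \<Rightarrow> bool" where
  "ode_solution F x I \<longleftrightarrow>
     (\<forall>t\<in>I. (x has_vector_derivative F t (x t)) (at t within I))"

definition rossler :: "real \<Rightarrow> real \<Rightarrow> real^3 \<Rightarrow> real^3" where
  "rossler a b v = vector [- (v$2 + v$3), v$1 + b * v$2, b + v$3 * (v$1 - a)]"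

definition Theta :: "(real^3) set" where
  "Theta = {v. v$1 = 0 \<and> v$2 < 0 \<and> - (v$2 + v$3) > 0}"

text \<open>The plane \<open>x = 0\<close> is identified with the \<open>(y, z)\<close>-plane.\<close>

definition from_plane :: "real^2 \<Rightarrow> real^3" where
  "from_plane w = vector [0, w$1, w$2]"

definition to_plane :: "real^3 \<Rightarrow> real^2" where
  "to_plane v = vector [v$2, v$3]"

definition return_times :: "(real \<Rightarrow> real^3) \<Rightarrow> real \<Rightarrow> real set" where
  "return_times x T = {t. 0 < t \<and> t \<le> T \<and> x t \<in> Theta}"

text \<open>
  Solutions may blow up in finite time, so the orbit is only required to exist on some
  \<open>{0..T}\<close> that contains a return time; the infimum of the return times does not
  depend on the choice of \<open>T\<close>, and \<open>x\<close> is determined on \<open>{0..T}\<close> since the vector field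
  is locally Lipschitz. The Poincare map is a partial map from \<open>Theta\<close> to itself, hence
  the requirement that the orbit is in \<open>Theta\<close> at the first return time.
\<close>

definition first_return :: "real \<Rightarrow> real \<Rightarrow> real^3 \<Rightarrow> real^3 \<Rightarrow> bool" where
  "first_return a b x0 p \<longleftrightarrow>
     (\<exists>x T. ode_solution (\<lambda>t. rossler a b) x {0..T} \<and> x 0 = x0 \<and>
        return_times x T \<noteq> {} \<and>
        x (Inf (return_times x T)) \<in> Theta \<and> p = x (Inf (return_times x T)))"

definition poincare_domain :: "real \<Rightarrow> real \<Rightarrow> (real^3) set" where
  "poincare_domain a b = {x0 \<in> Theta. \<exists>p. first_return a b x0 p}"

definition poincare :: "real \<Rightarrow> real \<Rightarrow> real^3 \<Rightarrow> real^3" where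
  "poincare a b x0 = (THE p. first_return a b x0 p)"

definition plane_poincare :: "real \<Rightarrow> real \<Rightarrow> real^2 \<Rightarrow> real^2" where
  "plane_poincare a b w = to_plane (poincare a b (from_plane w))"

text \<open>The supremum is taken in the extended reals, so it is infinite for unbounded \<open>e\<close>.\<close>

definition sup_norm :: "(real \<times> (real^3) \<Rightarrow> real^3) \<Rightarrow> ereal" where
  "sup_norm e = (SUP p. ereal (norm (e p)))"


section \<open>h-sets and covering relations in the plane\<close>

text \<open>
  For \<open>u \<in> {0, 1, 2}\<close> the space \<open>R^u\<close> is identified with the subspace of \<open>R^2\<close> on which all
  coordinates after the first \<open>u\<close> vanish, and \<open>R^(2-u)\<close> with the subspace on which the first
  \<open>u\<close> coordinates vanish. A point \<open>(p, q)\<close> of \<open>R^u \<times> R^(2-u)\<close> is then the vector \<open>v = p + q\<close>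
  with \<open>p = upart u v\<close> and \<open>q = spart u v\<close>, and norms are preserved.
\<close>

definition upart :: "nat \<Rightarrow> real^2 \<Rightarrow> real^2" where
  "upart u v = vector [if 1 \<le> u then v$1 else 0, if 2 \<le> u then v$2 else 0]"

definition spart :: "nat \<Rightarrow> real^2 \<Rightarrow> real^2" where
  "spart u v = v - upart u v"

record hset =
  supp :: "(real^2) set"
  udim :: nat
  sdim :: nat
  cmap :: "real^2 \<Rightarrow> real^2"

text \<open>
  In a factor of dimension \<open>0\<close> the closed unit ball is \<open>{0}\<close> and its boundary is empty, in
  accordance with the conditions \<open>norm 0 \<le> 1\<close> and \<open>norm 0 = 1\<close> below.
\<close>

definition Nc :: "hset \<Rightarrow> (real^2) set" where
  "Nc N = {v. norm (upart (udim N) v) \<le> 1 \<and> norm (spart (udim N) v) \<le> 1}"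

definition Nc_minus :: "hset \<Rightarrow> (real^2) set" where
  "Nc_minus N = {v. norm (upart (udim N) v) = 1 \<and> norm (spart (udim N) v) \<le> 1}"

definition Nc_plus :: "hset \<Rightarrow> (real^2) set" where
  "Nc_plus N = {v. norm (upart (udim N) v) \<le> 1 \<and> norm (spart (udim N) v) = 1}"

definition is_hset :: "hset \<Rightarrow> bool" where
  "is_hset N \<longleftrightarrow>
     compact (supp N) \<and> udim N + sdim N = 2 \<and>
     homeomorphism UNIV UNIV (cmap N) (inv (cmap N)) \<and>
     cmap N ` supp N = Nc N"

text \<open>
  A linear map from \<open>R^u\<close> to \<open>R^u\<close> is given as a linear map on \<open>R^2\<close> preserving the subspace
  \<open>range (upart u)\<close>; only its values on that subspace are used.
\<close>

definition covers :: "hset \<Rightarrow> (real^2 \<Rightarrow> real^2) \<Rightarrow> hset \<Rightarrow> bool" where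
  "covers N f M \<longleftrightarrow>
     is_hset N \<and> is_hset M \<and> udim N = udim M \<and> sdim N = sdim M \<and>
     continuous_on (supp N) f \<and>
     (\<exists>h :: real \<times> (real^2) \<Rightarrow> real^2.
        continuous_on ({0..1} \<times> Nc N) h \<and>
        (\<forall>v\<in>Nc N. h (0, v) = (cmap M \<circ> f \<circ> inv (cmap N)) v) \<and>
        h ` ({0..1} \<times> Nc_minus N) \<inter> Nc M = {} \<and>
        h ` ({0..1} \<times> Nc N) \<inter> Nc_plus M = {} \<and>
        (udim N > 0 \<longrightarrow>
          (\<exists>L :: real^2 \<Rightarrow> real^2.
             linear L \<and> L ` range (upart (udim N)) \<subseteq> range (upart (udim N)) \<and>
             (\<forall>v\<in>Nc N. h (1, v) = L (upart (udim N) v)) \<and>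
             (\<forall>p\<in>range (upart (udim N)). norm p = 1 \<longrightarrow> norm (L p) > 1))) \<and>
        (udim N = 0 \<longrightarrow> (\<forall>v\<in>Nc N. h (1, v) = 0)))"


section \<open>Symbolic dynamics\<close>

definition alpha :: "nat \<Rightarrow> nat \<Rightarrow> nat" where
  "alpha i j = [[0, 1, 1], [0, 1, 1], [1, 0, 0]] ! i ! j"

definition Sigma_A_plus :: "(nat \<Rightarrow> nat) set" where
  "Sigma_A_plus = {c. (\<forall>i. c i \<in> {0, 1, 2}) \<and> (\<forall>i. alpha (c i) (c (i + 1)) > 0)}"

end

theory Submission
  imports Defs "HOL-Complex_Analysis.Great_Picard"
begin

text \<open>
  Shrinking the h-sets slightly keeps all covering relations and moves their points into the
  interior of the domain of the Poincare map, where its continuity forces orbits to stay away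
  from the closure of the section between two returns. Hence the crossing of the section is
  transversal and persists for every curve that solves the equation up to a small error: such
  curves return, and their return maps are close to the unperturbed one, uniformly in the
  initial time.

  A continuous perturbation does not determine a flow, so it is replaced by Euler polygons that
  are restarted at each return. Their return maps depend continuously on time and position, and
  the covering relations give polygons with any prescribed finite itinerary; a diagonal
  subsequence converges to a solution with the prescribed infinite itinerary.

  The existence of finite itineraries is a degree argument in the plane: with the starting
  point on the unstable disc, the homotopies of the covering relations compose to a homotopy
  from the last unstable coordinate to an expanding linear map. Since only points whose whole
  orbit stays in the h-sets matter, the target is the unit ball modulo its boundary, that is, a
  sphere, and the conclusion follows from the identity of a sphere not being null-homotopic.
\<close>

section \<open>Pseudo-orbits and Gronwall estimates\<close>

text \<open>The bound on the perturbation has to be fixed before the perturbation is known, so the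
  order of choices matters. Compactness of the covering homotopies leaves a margin below radius 1;
  uniform continuity of the charts turns it into an admissible error \<eta> of the return map;
  compactness of the shrunken h-sets turns \<eta> into an error \<delta> of the vector field. Only
  afterwards do \<open>e\<close>, \<open>t0\<close> and the itinerary enter, and the mesh of the
  polygons is refined last.

  The two ways of disturbing the flow, adding \<open>e\<close> and replacing solutions by polygons,
  are measured by the same integral inequality, so one shadowing estimate serves both. The field is
  only locally Lipschitz and its orbits may escape in finite time; composing it with the retraction
  onto a large ball gives global bounds and changes nothing up to the return.

  With restarted polygons an itinerary is an iteration of one continuous map of (time, position).
  Time is a passenger: the topological argument constrains only the position, so all bounds have to
  be uniform in time.\<close>

lemma norm_has_integral_le:
  fixes f :: "real \<Rightarrow> 'a::real_normed_vector"
  assumes "(f has_integral i) {s..t}" "s \<le> t" "0 \<le> B" "\<And>r. r \<in> {s..t} \<Longrightarrow> norm (f r) \<le> B"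
  shows "norm i \<le> B * (t - s)"
  using has_integral_bound_real[of B "{}" f i s t] assms by simp

text \<open>Maximise \<open>D\<close> against the weight \<open>exp (- (2 * L * r))\<close>. If the
  maximum is positive, the integral term amounts to at most half of \<open>D\<close> at the maximum
  point and can be absorbed on the left; otherwise the bound is immediate from \<open>C\<close>
  being nonnegative.\<close>

lemma gronwall:
  fixes D :: "real \<Rightarrow> real"
  assumes cont: "continuous_on {0..S} D" and L: "0 < L"
    and D: "\<And>t. t \<in> {0..S} \<Longrightarrow> D t \<le> C + L * integral {0..t} D"
    and C: "0 \<le> C" and t: "t \<in> {0..S}"
  shows "D t \<le> 2 * C * exp (2 * L * t)"
proof -
  let ?w = "\<lambda>r. D r * exp (- (2 * L * r))"
  have "continuous_on {0..S} ?w"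
    by (intro continuous_intros cont)
  then obtain m where m: "m \<in> {0..S}" and max: "\<And>r. r \<in> {0..S} \<Longrightarrow> ?w r \<le> ?w m"
    using continuous_attains_sup[of "{0..S}" ?w] t by (metis compact_Icc empty_iff)
  define B where "B = ?w m"
  have le: "D r \<le> B * exp (2 * L * r)" if "r \<in> {0..S}" for r
    using max[OF that] unfolding B_def by (simp add: exp_minus field_simps)
  have Dm: "D m = B * exp (2 * L * m)"
    unfolding B_def by (simp add: exp_minus field_simps)
  have int: "((\<lambda>r. B * exp (2 * L * r)) has_integral (B * exp (2 * L * m) / (2 * L) - B * exp (2 * L * 0) / (2 * L))) {0..m}"
    using m L by (intro fundamental_theorem_of_calculus)
      (auto intro!: derivative_eq_intros simp: has_real_derivative_iff_has_vector_derivative[symmetric])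
  have "integral {0..m} D \<le> integral {0..m} (\<lambda>r. B * exp (2 * L * r))"
    using m by (intro integral_le integrable_continuous_real continuous_on_subset[OF cont]
      continuous_intros le) auto
  also have "\<dots> = B * exp (2 * L * m) / (2 * L) - B / (2 * L)"
    using integral_unique[OF int] by simp
  finally have "L * integral {0..m} D \<le> L * (B * exp (2 * L * m) / (2 * L) - B / (2 * L))"
    using L by simp
  also have "\<dots> = B * exp (2 * L * m) / 2 - B / 2"
    using L by (simp add: field_simps)
  finally have "B * exp (2 * L * m) \<le> C + B * exp (2 * L * m) / 2 - B / 2"
    using D[OF m] Dm by linarith
  then have 1: "B * exp (2 * L * m) / 2 \<le> C - B / 2" by linarith
  have "B \<le> 2 * C"
  proof (cases "B \<le> 0")
    case False
    have "1 \<le> exp (2 * L * m)" using L m by simp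
    then have "B * 1 \<le> B * exp (2 * L * m)" using False by (intro mult_left_mono) auto
    then show ?thesis using 1 C False by linarith
  qed (use C in linarith)
  then have "B * exp (2 * L * t) \<le> 2 * C * exp (2 * L * t)" by simp
  with le[OF t] show ?thesis by linarith
qed

text \<open>The integral form admits polygons, which have corners. It is required between any two
  times, not just from 0, because the growth of the first coordinate near the section is read off
  from arbitrary short intervals.\<close>

definition pseudo_orbit ::
    "(real^3 \<Rightarrow> real^3) \<Rightarrow> real \<Rightarrow> (real \<Rightarrow> real^3) \<Rightarrow> real \<Rightarrow> bool" where
  "pseudo_orbit f \<delta> x S \<longleftrightarrow> continuous_on {0..S} x \<and>
     (\<forall>s t. 0 \<le> s \<and> s \<le> t \<and> t \<le> S \<longrightarrow>
        norm (x t - x s - integral {s..t} (\<lambda>r. f (x r))) \<le> \<delta> * (t - s))"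

lemma pseudo_orbitD:
  assumes "pseudo_orbit f \<delta> x S"
  shows "continuous_on {0..S} x"
    and "\<And>s t. \<lbrakk>0 \<le> s; s \<le> t; t \<le> S\<rbrakk> \<Longrightarrow>
      norm (x t - x s - integral {s..t} (\<lambda>r. f (x r))) \<le> \<delta> * (t - s)"
  using assms by (auto simp: pseudo_orbit_def)

lemma pseudo_orbit_subset: "pseudo_orbit f \<delta> x S \<Longrightarrow> S' \<le> S \<Longrightarrow> pseudo_orbit f \<delta> x S'"
  by (auto simp: pseudo_orbit_def intro: continuous_on_subset)

lemma pseudo_orbit_mono: "pseudo_orbit f \<delta> x S \<Longrightarrow> \<delta> \<le> \<delta>' \<Longrightarrow> pseudo_orbit f \<delta>' x S"
  unfolding pseudo_orbit_def by (meson diff_ge_0_iff_ge mult_right_mono order_trans)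

lemma pseudo_orbit_cong:
  assumes "pseudo_orbit f \<delta> x S" "\<And>r. r \<in> {0..S} \<Longrightarrow> g (x r) = f (x r)"
  shows "pseudo_orbit g \<delta> x S"
  unfolding pseudo_orbit_def
proof (intro conjI allI impI)
  fix s t assume st: "0 \<le> s \<and> s \<le> t \<and> t \<le> S"
  then have "integral {s..t} (\<lambda>r. g (x r)) = integral {s..t} (\<lambda>r. f (x r))"
    by (intro integral_cong) (auto simp: assms(2))
  then show "norm (x t - x s - integral {s..t} (\<lambda>r. g (x r))) \<le> \<delta> * (t - s)"
    using pseudo_orbitD(2)[OF assms(1)] st by simp
qed (use pseudo_orbitD[OF assms(1)] in auto)

lemma pseudo_orbit_of_solution:
  assumes x: "ode_solution (\<lambda>t v. f v + e t v) x {0..S}" and f: "continuous_on UNIV f"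
    and e: "\<And>t v. norm (e t v) \<le> \<delta>"
  shows "pseudo_orbit f \<delta> x S"
  unfolding pseudo_orbit_def
proof (intro conjI allI impI)
  have d: "(x has_vector_derivative f (x t) + e t (x t)) (at t within {0..S})" if "t \<in> {0..S}" for t
    using x that by (auto simp: ode_solution_def)
  show cont: "continuous_on {0..S} x"
    using d by (meson continuous_on_eq_continuous_within has_vector_derivative_continuous)
  fix s t assume st: "0 \<le> s \<and> s \<le> t \<and> t \<le> S"
  have i1: "((\<lambda>r. f (x r) + e r (x r)) has_integral (x t - x s)) {s..t}"
    using st by (intro fundamental_theorem_of_calculus has_vector_derivative_within_subset[OF d]) auto
  have "continuous_on {s..t} (\<lambda>r. f (x r))"
    using st by (intro continuous_on_compose2[OF f] continuous_on_subset[OF cont]) auto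
  then have "((\<lambda>r. f (x r)) has_integral integral {s..t} (\<lambda>r. f (x r))) {s..t}"
    by (simp add: integrable_continuous_real integrable_integral)
  from has_integral_diff[OF i1 this]
  have "((\<lambda>r. e r (x r)) has_integral (x t - x s - integral {s..t} (\<lambda>r. f (x r)))) {s..t}"
    by simp
  moreover have "0 \<le> \<delta>" using e norm_ge_zero order_trans by blast
  ultimately show "norm (x t - x s - integral {s..t} (\<lambda>r. f (x r))) \<le> \<delta> * (t - s)"
    using norm_has_integral_le e st by metis
qed

lemma pseudo_orbit_of_exact_solution:
  assumes "ode_solution (\<lambda>t. f) x {0..S}" "continuous_on UNIV f"
  shows "pseudo_orbit f 0 x S"
  using pseudo_orbit_of_solution[of f "\<lambda>_ _. 0" x S 0] assms by simp

lemma pseudo_orbit_close_in_tube: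
  assumes y: "pseudo_orbit f 0 y S" and x: "pseudo_orbit f \<delta> x S"
    and f: "continuous_on UNIV f" and L: "0 < L" and \<delta>: "0 \<le> \<delta>"
    and lip: "\<And>r. r \<in> {0..S} \<Longrightarrow> norm (f (x r) - f (y r)) \<le> L * norm (x r - y r)"
    and t: "t \<in> {0..S}"
  shows "norm (x t - y t) \<le> 2 * (norm (x 0 - y 0) + \<delta> * S) * exp (2 * L * S)"
proof -
  note cx = pseudo_orbitD(1)[OF x] and cy = pseudo_orbitD(1)[OF y]
  let ?D = "\<lambda>r. norm (x r - y r)"
  have cD: "continuous_on {0..S} ?D" by (intro continuous_intros cx cy)
  have cfx: "continuous_on {0..S} (\<lambda>r. f (x r))" and cfy: "continuous_on {0..S} (\<lambda>r. f (y r))"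
    by (auto intro!: continuous_on_compose2[OF f] cx cy)
  have "?D t \<le> 2 * (norm (x 0 - y 0) + \<delta> * S) * exp (2 * L * t)"
  proof (rule gronwall[OF cD L _ _ t])
    show "0 \<le> norm (x 0 - y 0) + \<delta> * S" using \<delta> t by auto
    fix r assume r: "r \<in> {0..S}"
    have ifx: "(\<lambda>q. f (x q)) integrable_on {0..r}" and ify: "(\<lambda>q. f (y q)) integrable_on {0..r}"
      using r by (auto intro!: integrable_continuous_real continuous_on_subset[OF cfx] continuous_on_subset[OF cfy])
    have "norm (integral {0..r} (\<lambda>q. f (x q)) - integral {0..r} (\<lambda>q. f (y q)))
        = norm (integral {0..r} (\<lambda>q. f (x q) - f (y q)))"
      using integral_diff[OF ifx ify] by simp
    also have "\<dots> \<le> integral {0..r} (\<lambda>q. L * ?D q)"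
      using r lip by (intro integral_norm_bound_integral integrable_diff ifx ify
        integrable_continuous_real continuous_intros continuous_on_subset[OF cD]) auto
    also have "\<dots> = L * integral {0..r} ?D" by simp
    finally have 1: "norm (integral {0..r} (\<lambda>q. f (x q)) - integral {0..r} (\<lambda>q. f (y q)))
      \<le> L * integral {0..r} ?D" .
    have 2: "norm (x r - x 0 - integral {0..r} (\<lambda>q. f (x q))) \<le> \<delta> * r"
      using pseudo_orbitD(2)[OF x, of 0 r] r by simp
    have 3: "y r - y 0 = integral {0..r} (\<lambda>q. f (y q))"
      using pseudo_orbitD(2)[OF y, of 0 r] r by simp
    have "x r - y r = (x r - x 0 - integral {0..r} (\<lambda>q. f (x q))) + (x 0 - y 0)
      + (integral {0..r} (\<lambda>q. f (x q)) - integral {0..r} (\<lambda>q. f (y q)))"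
      using 3 by (simp add: algebra_simps)
    then have "?D r \<le> \<delta> * r + norm (x 0 - y 0) + L * integral {0..r} ?D"
      using 1 2 by (smt (verit, best) norm_triangle_ineq)
    moreover have "\<delta> * r \<le> \<delta> * S" using \<delta> r by (intro mult_left_mono) auto
    ultimately show "?D r \<le> norm (x 0 - y 0) + \<delta> * S + L * integral {0..r} ?D" by linarith
  qed
  also have "\<dots> \<le> 2 * (norm (x 0 - y 0) + \<delta> * S) * exp (2 * L * S)"
    using \<delta> t L by (intro mult_left_mono) auto
  finally show ?thesis .
qed

text \<open>The Lipschitz bound is available only in the unit tube around \<open>y\<close>. At a
  first time when the distance reaches 1 the estimate in the tube is still valid, and
  \<open>small\<close> makes it give a distance below 1.\<close>

lemma pseudo_orbit_close:
  assumes y: "pseudo_orbit f 0 y S" and x: "pseudo_orbit f \<delta> x S"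
    and f: "continuous_on UNIV f" and L: "0 < L" and \<delta>: "0 \<le> \<delta>"
    and lip: "\<And>r v. \<lbrakk>r \<in> {0..S}; norm (v - y r) \<le> 1\<rbrakk> \<Longrightarrow> norm (f v - f (y r)) \<le> L * norm (v - y r)"
    and small: "2 * (norm (x 0 - y 0) + \<delta> * S) * exp (2 * L * S) < 1"
    and t: "t \<in> {0..S}"
  shows "norm (x t - y t) \<le> 2 * (norm (x 0 - y 0) + \<delta> * S) * exp (2 * L * S)"
proof -
  note cx = pseudo_orbitD(1)[OF x] and cy = pseudo_orbitD(1)[OF y]
  have cD: "continuous_on {0..S} (\<lambda>r. norm (x r - y r))" by (intro continuous_intros cx cy)
  have close: "norm (x s - y s) \<le> 2 * (norm (x 0 - y 0) + \<delta> * S) * exp (2 * L * S)"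
    if s: "s \<in> {0..S}" and tube: "\<And>r. r \<in> {0..s} \<Longrightarrow> norm (x r - y r) \<le> 1" for s
  proof -
    have "norm (x s - y s) \<le> 2 * (norm (x 0 - y 0) + \<delta> * s) * exp (2 * L * s)"
      using s tube by (intro pseudo_orbit_close_in_tube[OF pseudo_orbit_subset[OF y] pseudo_orbit_subset[OF x] f L \<delta>] lip) auto
    also have "\<dots> \<le> 2 * (norm (x 0 - y 0) + \<delta> * S) * exp (2 * L * S)"
      using s L \<delta> by (intro mult_mono mult_left_mono add_mono) auto
    finally show ?thesis .
  qed
  have "norm (x r - y r) < 1" if r: "r \<in> {0..S}" for r
  proof (rule ccontr)
    define E where "E = {r \<in> {0..S}. 1 \<le> norm (x r - y r)}"
    assume "\<not> norm (x r - y r) < 1"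
    with r have ne: "E \<noteq> {}" by (auto simp: E_def)
    have "closed E" unfolding E_def
      by (intro continuous_on_closed_Collect_le continuous_on_const cD) auto
    moreover have bdd: "bdd_below E" by (auto simp: E_def intro!: bdd_belowI[of _ 0])
    ultimately have s: "Inf E \<in> E" using ne closed_contains_Inf by blast
    let ?s = "Inf E"
    have lt: "norm (x q - y q) < 1" if "q \<in> {0..<?s}" for q
      using cInf_lower[OF _ bdd, of q] that s by (force simp: E_def)
    have s0: "0 \<le> ?s" "?s \<le> S" "1 \<le> norm (x ?s - y ?s)" using s by (auto simp: E_def)
    \<comment> \<open>The exponential factor in \<open>small\<close> is at least 1, so the distance
      is below 1 at the start and the exit time is positive.\<close>
    have "norm (x 0 - y 0) < 1"
    proof -
      have "norm (x 0 - y 0) * 1 \<le> (norm (x 0 - y 0) + \<delta> * S) * (2 * exp (2 * L * S))"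
      proof (intro mult_mono)
        have "1 \<le> exp (2 * L * S)" using L s0 by simp
        then show "1 \<le> 2 * exp (2 * L * S)" by linarith
      qed (use \<delta> s0 in auto)
      then show ?thesis using small by (simp add: algebra_simps)
    qed
    then have pos: "0 < ?s" using s0 by (cases "?s = 0") auto
    \<comment> \<open>At the exit time itself the bound comes by continuity from the times
      before.\<close>
    have "norm (x q - y q) \<le> 1" if "q \<in> {0..?s}" for q
    proof -
      have cl: "closure {0..<?s} = {0..?s}" using pos by simp
      show ?thesis
        by (rule continuous_le_on_closure[where S = "{0..<?s}" and f = "\<lambda>r. norm (x r - y r)"])
           (use cl lt that s0 in \<open>auto intro: less_imp_le continuous_on_subset[OF cD]\<close>)
    qed
    then show False using close[of ?s] s0 small by auto
  qed
  then show ?thesis using close[OF t] t by (meson atLeastAtMost_iff less_imp_le order_trans)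
qed

section \<open>Euler polygons and the theorem of Peano\<close>

primrec euler_node :: "(real \<Rightarrow> real^3 \<Rightarrow> real^3) \<Rightarrow> real \<Rightarrow> real \<times> (real^3) \<Rightarrow> nat \<Rightarrow> real^3" where
  "euler_node F d p 0 = snd p"
| "euler_node F d p (Suc j) =
     euler_node F d p j + d *\<^sub>R F (fst p + real j * d) (euler_node F d p j)"

text \<open>The pair \<open>p\<close> holds the initial time and position, while \<open>s\<close> is
  the time elapsed since then. Each cell contributes its slope times a ramp that grows from 0 to
  \<open>d\<close> while \<open>s\<close> crosses the cell; without case distinctions, joint
  continuity in \<open>p\<close> and \<open>s\<close> is evident.\<close>

definition euler :: "(real \<Rightarrow> real^3 \<Rightarrow> real^3) \<Rightarrow> real \<Rightarrow> nat \<Rightarrow> real \<times> (real^3) \<Rightarrow> real \<Rightarrow> real^3" where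
  "euler F S J p s = (let d = S / real J in
     snd p + (\<Sum>j<J. max 0 (min d (s - real j * d)) *\<^sub>R F (fst p + real j * d) (euler_node F d p j)))"

lemma continuous_on_euler_node:
  assumes F: "continuous_on UNIV (\<lambda>(t, v). F t v)"
  shows "continuous_on A (\<lambda>p. euler_node F d p j)"
proof (induction j)
  case (Suc j)
  have "continuous_on A (\<lambda>p. (\<lambda>(t, v). F t v) (fst p + real j * d, euler_node F d p j))"
    by (rule continuous_on_compose2[OF F]) (auto intro!: continuous_intros Suc.IH)
  then show ?case by (auto intro!: continuous_intros Suc.IH)
qed (auto intro!: continuous_intros)

lemma continuous_on_euler:
  assumes F: "continuous_on UNIV (\<lambda>(t, v). F t v)"
  shows "continuous_on A (\<lambda>(p, s). euler F S J p s)"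
proof -
  have node: "continuous_on A (\<lambda>q. euler_node F d (fst q) j)" for d j and A :: "((real \<times> (real^3)) \<times> real) set"
    by (rule continuous_on_compose2[OF continuous_on_euler_node[OF F, of UNIV]])
      (auto intro!: continuous_intros)
  have "continuous_on A (\<lambda>q. (\<lambda>(t, v). F t v) (fst (fst q) + real j * d, euler_node F d (fst q) j))"
    for d j and A :: "((real \<times> (real^3)) \<times> real) set"
    by (rule continuous_on_compose2[OF F]) (auto intro!: continuous_intros node)
  then have slope: "continuous_on A (\<lambda>q. F (fst (fst q) + real j * d) (euler_node F d (fst q) j))"
    for d j and A :: "((real \<times> (real^3)) \<times> real) set"
    by simp
  show ?thesis
    unfolding euler_def Let_def case_prod_beta by (intro continuous_intros slope)
qed

lemma euler_node_eq_sum: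
  "euler_node F d p i = snd p + (\<Sum>j<i. d *\<^sub>R F (fst p + real j * d) (euler_node F d p j))"
  by (induction i) (auto simp: algebra_simps)

text \<open>Earlier ramps are saturated at \<open>d\<close>, later ones are still 0, and only ramp
  \<open>i\<close> is moving.\<close>

lemma euler_on_cell:
  assumes d: "d = S / real J" "0 < d" and i: "i < J"
    and s: "real i * d \<le> s" "s \<le> real (Suc i) * d"
  shows "euler F S J p s =
    euler_node F d p i + (s - real i * d) *\<^sub>R F (fst p + real i * d) (euler_node F d p i)"
proof -
  let ?F = "\<lambda>j. F (fst p + real j * d) (euler_node F d p j)"
  let ?g = "\<lambda>j. max 0 (min d (s - real j * d)) *\<^sub>R ?F j"
  have lt: "?g j = d *\<^sub>R ?F j" if "j < i" for j
  proof -
    have "real (Suc j) * d \<le> real i * d" using that d by (intro mult_right_mono) auto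
    then have "d \<le> s - real j * d" using s by (simp add: algebra_simps)
    then show ?thesis using d by simp
  qed
  have gt: "?g j = 0" if "i < j" for j
  proof -
    have "real (Suc i) * d \<le> real j * d" using that d by (intro mult_right_mono) auto
    then show ?thesis using s d by simp
  qed
  have eq: "?g i = (s - real i * d) *\<^sub>R ?F i"
    using s by (simp add: algebra_simps)
  have "(\<Sum>j<J. ?g j) = (\<Sum>j<Suc i. ?g j)"
    using i gt by (intro sum.mono_neutral_right) auto
  also have "\<dots> = (\<Sum>j<i. ?g j) + (s - real i * d) *\<^sub>R ?F i"
    by (simp only: sum.lessThan_Suc eq)
  also have "(\<Sum>j<i. ?g j) = (\<Sum>j<i. d *\<^sub>R ?F j)"
    by (intro sum.cong refl lt) simp
  finally show ?thesis
    unfolding euler_def d(1)[symmetric] Let_def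
    by (subst (2) euler_node_eq_sum) simp
qed

lemma euler_at_node:
  assumes d: "d = S / real J" "0 < d" and i: "i \<le> J"
  shows "euler F S J p (real i * d) = euler_node F d p i"
proof (cases "i < J")
  case True
  moreover have "real i * d \<le> real (Suc i) * d" using d(2) by simp
  ultimately show ?thesis using euler_on_cell[OF d, of i "real i * d"] by simp
next
  case False
  \<comment> \<open>Division by zero yields 0, so \<open>0 < d\<close> excludes
    \<open>J = 0\<close>.\<close>
  have "J > 0" using d by (intro Nat.gr0I) auto
  then obtain k where k: "i = Suc k" "k < J" using False i by (cases i) auto
  moreover have "real k * d \<le> real i * d" "real i * d - real k * d = d"
    using k d(2) by (auto simp: algebra_simps)
  ultimately show ?thesis
    using euler_on_cell[OF d k(2), of "real i * d"] by simp
qed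

lemma euler_0: "0 < S \<Longrightarrow> 0 < J \<Longrightarrow> euler F S J p 0 = snd p"
  using euler_at_node[of "S / real J" S J 0 F p] by simp

text \<open>The slope at time \<open>r\<close> is the one computed at the last node, whose number is
  the floor of \<open>r / d\<close>. The finitely many nodes form the exceptional set of the
  fundamental theorem.\<close>

lemma euler_has_integral:
  assumes F: "continuous_on UNIV (\<lambda>(t, v). F t v)" and d: "d = S / real J" "0 < d"
    and st: "0 \<le> s" "s \<le> t" "t \<le> S"
  shows "((\<lambda>r. F (fst p + real (nat \<lfloor>r / d\<rfloor>) * d) (euler F S J p (real (nat \<lfloor>r / d\<rfloor>) * d)))
    has_integral (euler F S J p t - euler F S J p s)) {s..t}"
proof (rule fundamental_theorem_of_calculus_interior_strong[where S = "(\<lambda>j. real j * d) ` {..J}"])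
  have J: "J > 0" using d by (intro Nat.gr0I) auto
  have Jd: "real J * d = S" using d J by simp
  show "continuous_on {s..t} (euler F S J p)"
    by (rule continuous_on_compose2[OF continuous_on_euler[OF F, of UNIV], of _ "\<lambda>s. (p, s)", simplified])
      (auto intro!: continuous_intros)
  fix r assume r: "r \<in> {s<..<t} - (\<lambda>j. real j * d) ` {..J}"
  define i where "i = nat \<lfloor>r / d\<rfloor>"
  have "0 < r / d" using r st d(2) by (intro divide_pos_pos) auto
  then have i: "real i \<le> r / d" "r / d < real i + 1"
    unfolding i_def by linarith+
  then have i': "real i * d \<le> r" "r < real (Suc i) * d"
    using d(2) by (simp_all add: pos_le_divide_eq pos_divide_less_eq algebra_simps)
  have "real i * d < real J * d" using i' r st Jd by auto
  then have iJ: "i < J" using d(2) mult_less_cancel_right_pos of_nat_less_iff by blast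
  then have "r \<noteq> real i * d" using r by auto
  with i' have i'': "r \<in> {real i * d <..< real (Suc i) * d}" by auto
  have "((\<lambda>s. euler_node F d p i + (s - real i * d) *\<^sub>R F (fst p + real i * d) (euler_node F d p i))
    has_vector_derivative F (fst p + real i * d) (euler_node F d p i)) (at r)"
    by (auto intro!: derivative_eq_intros)
  then have "(euler F S J p has_vector_derivative F (fst p + real i * d) (euler_node F d p i)) (at r)"
    by (rule has_vector_derivative_transform_within_open[OF _ _ i''])
      (auto simp: euler_on_cell[OF d iJ])
  then show "(euler F S J p has_vector_derivative F (fst p + real (nat \<lfloor>r / d\<rfloor>) * d)
     (euler F S J p (real (nat \<lfloor>r / d\<rfloor>) * d))) (at r)"
    using euler_at_node[OF d, of i F p] iJ by (simp add: i_def)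
qed (use st in auto)

lemma euler_lipschitz:
  assumes F: "continuous_on UNIV (\<lambda>(t, v). F t v)" and V: "\<And>t v. norm (F t v) \<le> V"
    and S: "0 < S" "0 < J" and st: "s \<in> {0..S}" "t \<in> {0..S}"
  shows "norm (euler F S J p t - euler F S J p s) \<le> V * \<bar>t - s\<bar>"
proof -
  have V0: "0 \<le> V" using V norm_ge_zero order_trans by blast
  have *: "norm (euler F S J p t - euler F S J p s) \<le> V * (t - s)" if "0 \<le> s" "s \<le> t" "t \<le> S" for s t
    using S by (intro norm_has_integral_le[OF euler_has_integral[OF F refl _ that]] that V0 V) auto
  show ?thesis
    using *[of s t] *[of t s] st by (cases "s \<le> t") (auto simp: norm_minus_commute)
qed

lemma floor_cell:
  fixes r d :: real
  assumes "0 \<le> r" "0 < d"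
  shows "real (nat \<lfloor>r / d\<rfloor>) * d \<le> r" "r - real (nat \<lfloor>r / d\<rfloor>) * d \<le> d"
proof -
  have "real (nat \<lfloor>r / d\<rfloor>) \<le> r / d" "r / d \<le> real (nat \<lfloor>r / d\<rfloor>) + 1"
    using assms by (auto simp: of_nat_nat le_floor_iff intro: less_imp_le)
  then show "real (nat \<lfloor>r / d\<rfloor>) * d \<le> r" "r - real (nat \<lfloor>r / d\<rfloor>) * d \<le> d"
    using assms(2) by (simp_all add: pos_le_divide_eq pos_divide_le_eq algebra_simps del: of_nat_nat)
qed

text \<open>The perturbation accounts for \<delta>. Freezing the field at the last node accounts for
  the rest: \<open>L\<close> times the distance \<open>V * S / J\<close> that the polygon can travel
  within one cell.\<close>

lemma euler_pseudo_orbit: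
  assumes f: "continuous_on UNIV f" and e: "continuous_on UNIV (\<lambda>(t, v). e t v)"
    and V: "\<And>t v. norm (f v + e t v) \<le> V" and \<delta>: "\<And>t v. norm (e t v) \<le> \<delta>"
    and L: "0 \<le> L" "\<And>u v. norm (f u - f v) \<le> L * norm (u - v)" and S: "0 < S" "0 < J"
  shows "pseudo_orbit f (\<delta> + L * V * S / real J) (euler (\<lambda>t v. f v + e t v) S J p) S"
proof -
  let ?F = "\<lambda>t v. f v + e t v" let ?X = "euler ?F S J p"
  define d where "d = S / real J"
  have d: "0 < d" using S by (simp add: d_def)
  have fs: "continuous_on UNIV (\<lambda>q. f (snd q))"
    by (rule continuous_on_compose2[OF f]) (auto intro!: continuous_intros)
  have F: "continuous_on UNIV (\<lambda>(t, v). ?F t v)"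
    using continuous_on_add[OF fs e] by (simp add: case_prod_beta)
  have cX: "continuous_on A ?X" for A
    by (rule continuous_on_compose2[OF continuous_on_euler[OF F, of UNIV], of _ "\<lambda>s. (p, s)", simplified])
      (auto intro!: continuous_intros)
  have V0: "0 \<le> V" and \<delta>0: "0 \<le> \<delta>" using V \<delta> norm_ge_zero order_trans by blast+
  show ?thesis
    unfolding pseudo_orbit_def
  proof (intro conjI cX allI impI)
    fix s t assume st: "0 \<le> s \<and> s \<le> t \<and> t \<le> S"
    let ?n = "\<lambda>r. real (nat \<lfloor>r / d\<rfloor>) * d"
    have "continuous_on {s..t} (\<lambda>r. f (?X r))" by (rule continuous_on_compose2[OF f cX]) auto
    then have "((\<lambda>r. f (?X r)) has_integral integral {s..t} (\<lambda>r. f (?X r))) {s..t}"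
      by (simp add: integrable_continuous_real integrable_integral)
    then have "((\<lambda>r. ?F (fst p + ?n r) (?X (?n r)) - f (?X r)) has_integral
      (?X t - ?X s - integral {s..t} (\<lambda>r. f (?X r)))) {s..t}"
      using st by (intro has_integral_diff euler_has_integral[OF F d_def d]) auto
    then show "norm (?X t - ?X s - integral {s..t} (\<lambda>r. f (?X r))) \<le> (\<delta> + L * V * S / real J) * (t - s)"
    proof (rule norm_has_integral_le)
      fix r assume r: "r \<in> {s..t}"
      then have n: "?n r \<le> r" "r - ?n r \<le> d" "0 \<le> ?n r" "?n r \<le> S"
        using floor_cell[of r d] d st by (auto simp del: of_nat_nat)
      have "norm (f (?X (?n r)) - f (?X r)) \<le> L * norm (?X (?n r) - ?X r)" by (rule L)
      also have "norm (?X (?n r) - ?X r) \<le> V * \<bar>?n r - r\<bar>"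
        using n r st S by (intro euler_lipschitz[OF F V]) (auto simp del: of_nat_nat)
      also have "V * \<bar>?n r - r\<bar> \<le> V * d" using n V0 by (intro mult_left_mono) auto
      finally have "norm (f (?X (?n r)) - f (?X r)) \<le> L * (V * d)" using L by (simp add: mult_left_mono)
      moreover have "?F (fst p + ?n r) (?X (?n r)) - f (?X r)
        = e (fst p + ?n r) (?X (?n r)) + (f (?X (?n r)) - f (?X r))" by simp
      ultimately show "norm (?F (fst p + ?n r) (?X (?n r)) - f (?X r)) \<le> \<delta> + L * V * S / real J"
        using \<delta>[of "fst p + ?n r" "?X (?n r)"] unfolding d_def
        by (smt (verit) norm_triangle_ineq mult.assoc times_divide_eq_right)
    qed (use st \<delta>0 V0 L S in auto)
  qed
qed

text \<open>This prepares the differentiation of limits of polygons. A slope in force at time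
  \<open>r\<close> was computed at a node up to \<open>S / J\<close> earlier, whence the radius
  \<open>\<rho> + S / real J\<close> in time and \<open>V\<close> times as much in space.\<close>

lemma euler_increment:
  assumes F: "continuous_on UNIV (\<lambda>(t, v). F t v)" and V: "\<And>t v. norm (F t v) \<le> V"
    and S: "0 < S" "0 < J" and st: "0 \<le> s" "s \<le> t" "t \<le> S"
    and near: "\<bar>s - \<tau>\<bar> \<le> \<rho>" "\<bar>t - \<tau>\<bar> \<le> \<rho>" "\<tau> \<in> {0..S}" and B: "0 \<le> B"
    and bound: "\<And>q v. \<bar>q - (fst p + \<tau>)\<bar> \<le> \<rho> + S / real J \<Longrightarrow>
      norm (v - euler F S J p \<tau>) \<le> V * (\<rho> + S / real J) \<Longrightarrow> norm (F q v - c) \<le> B"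
  shows "norm (euler F S J p t - euler F S J p s - (t - s) *\<^sub>R c) \<le> B * (t - s)"
proof -
  define d where "d = S / real J"
  have d: "0 < d" using S by (simp add: d_def)
  let ?X = "euler F S J p" and ?n = "\<lambda>r. real (nat \<lfloor>r / d\<rfloor>) * d"
  have V0: "0 \<le> V" using V norm_ge_zero order_trans by blast
  have "((\<lambda>r. F (fst p + ?n r) (?X (?n r)) - c) has_integral (?X t - ?X s - (t - s) *\<^sub>R c)) {s..t}"
    using st has_integral_const_real[of c s t]
    by (intro has_integral_diff euler_has_integral[OF F d_def d]) auto
  then show ?thesis
  proof (rule norm_has_integral_le[OF _ st(2) B])
    fix r assume r: "r \<in> {s..t}"
    have n: "?n r \<le> r" "r - ?n r \<le> d" "0 \<le> ?n r" "0 \<le> r" "r \<le> S" "?n r \<le> S"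
      using floor_cell[of r d] d st r by (auto simp del: of_nat_nat)
    have "s \<le> r" "r \<le> t" using r by auto
    then have 1: "\<bar>?n r - \<tau>\<bar> \<le> \<rho> + d" using n(1,2) near(1,2) d unfolding abs_le_iff by linarith
    have "norm (?X (?n r) - ?X \<tau>) \<le> V * \<bar>?n r - \<tau>\<bar>"
      using n near by (intro euler_lipschitz[OF F V S]) (auto simp del: of_nat_nat)
    also have "\<dots> \<le> V * (\<rho> + d)" using 1 V0 by (rule mult_left_mono)
    finally show "norm (F (fst p + ?n r) (?X (?n r)) - c) \<le> B"
      using 1 by (intro bound) (auto simp: d_def)
  qed
qed

text \<open>The polygons share the Lipschitz constant \<open>V\<close>, so Arzela-Ascoli gives a
  uniform limit. That it solves the equation is checked on increments: by continuity of
  \<open>F\<close> at a single point, all late polygons have nearly the same slope around \<tau>,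
  and such a bound on increments survives pointwise limits.\<close>

lemma euler_limit:
  assumes F: "continuous_on UNIV (\<lambda>(t, v). F t v)" and V: "\<And>t v. norm (F t v) \<le> V"
    and S: "0 < S" and J: "\<And>n. 0 < J n" "filterlim J at_top sequentially"
    and p: "p \<longlonglongrightarrow> p0"
  obtains k z where "strict_mono (k :: nat \<Rightarrow> nat)"
    and "uniform_limit {0..S} (\<lambda>n. euler F S (J (k n)) (p (k n))) z sequentially"
    and "z 0 = snd p0"
    and "ode_solution (\<lambda>s. F (fst p0 + s)) z {0..S}"
proof -
  have V0: "0 \<le> V" using V norm_ge_zero order_trans by blast
  let ?X = "\<lambda>n. euler F S (J n) (p n)"
  have lip: "norm (?X n t - ?X n s) \<le> V * \<bar>t - s\<bar>" if "s \<in> {0..S}" "t \<in> {0..S}" for n s t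
    using that by (intro euler_lipschitz[OF F V S J(1)])
  obtain K where K: "\<And>n. norm (p n) \<le> K"
    using convergent_imp_Bseq[OF convergentI[OF p]] by (auto simp: Bseq_def)
  have bound: "norm (?X n s) \<le> K + V * S" if "s \<in> {0..S}" for n s
  proof -
    have "norm (?X n s - ?X n 0) \<le> V * S"
      using order_trans[OF lip[of 0 s n] mult_left_mono[of "\<bar>s - 0\<bar>" S V]] that V0 S by auto
    moreover have "norm (?X n 0) \<le> K"
      using euler_0[OF S J(1)] order_trans[OF norm_snd_le[of "snd (p n)" "fst (p n)"]] K by simp
    ultimately show ?thesis by (smt (verit) norm_triangle_ineq2)
  qed
  obtain z k where k: "strict_mono (k :: nat \<Rightarrow> nat)"
    and lim: "\<And>e. 0 < e \<Longrightarrow> \<exists>N. \<forall>n s. n \<ge> N \<and> s \<in> {0..S} \<longrightarrow> norm (?X (k n) s - z s) < e"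
  proof (rule Arzela_Ascoli[of "{0..S}" ?X "K + V * S"])
    fix s e :: real assume "s \<in> {0..S}" "0 < e"
    then have "norm (?X n s - ?X n t) < e" if "t \<in> {0..S}" "norm (s - t) < e / (V + 1)" for n t
    proof -
      have "norm (?X n s - ?X n t) \<le> V * \<bar>s - t\<bar>" using that \<open>s \<in> {0..S}\<close> by (intro lip)
      also have "\<dots> \<le> (V + 1) * \<bar>s - t\<bar>" by (intro mult_right_mono) auto
      also have "\<dots> < e" using that V0 by (simp add: field_simps)
      finally show ?thesis .
    qed
    then show "\<exists>d. 0 < d \<and> (\<forall>n y. y \<in> {0..S} \<and> norm (s - y) < d \<longrightarrow> norm (?X n s - ?X n y) < e)"
      using \<open>0 < e\<close> V0 by (intro exI[of _ "e / (V + 1)"]) auto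
  qed (use bound in auto)
  have ul: "uniform_limit {0..S} (\<lambda>n. ?X (k n)) z sequentially"
    unfolding uniform_limit_sequentially_iff dist_norm using lim by meson
  have pt: "(\<lambda>n. ?X (k n) s) \<longlonglongrightarrow> z s" if "s \<in> {0..S}" for s
    using tendsto_uniform_limitI[OF ul that] .
  have pk: "(\<lambda>n. p (k n)) \<longlonglongrightarrow> p0"
    using LIMSEQ_subseq_LIMSEQ[OF p k] by (simp add: o_def)
  have "(\<lambda>n. ?X (k n) 0) \<longlonglongrightarrow> snd p0"
    using tendsto_snd[OF pk] euler_0[OF S J(1)] by simp
  then have z0: "z 0 = snd p0" using LIMSEQ_unique pt[of 0] S by auto
  have "filterlim (\<lambda>n. J (k n)) at_top sequentially"
    using filterlim_compose[OF J(2) filterlim_subseq[OF k]] by (simp add: o_def)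
  then have dk: "(\<lambda>n. S / real (J (k n))) \<longlonglongrightarrow> 0"
    by (intro tendsto_divide_0[OF tendsto_const] filterlim_at_top_imp_at_infinity
      filterlim_compose[OF filterlim_real_sequentially])
  have "(z has_vector_derivative F (fst p0 + \<tau>) (z \<tau>)) (at \<tau> within {0..S})" if \<tau>: "\<tau> \<in> {0..S}" for \<tau>
  proof -
    let ?c = "F (fst p0 + \<tau>) (z \<tau>)"
    \<comment> \<open>Both end points are free, so that \<tau> may be taken as the left or as the
      right one; this gives the two one-sided derivatives.\<close>
    have inc: "\<exists>\<rho>>0. \<forall>s t. 0 \<le> s \<longrightarrow> s \<le> t \<longrightarrow> t \<le> S \<longrightarrow> \<bar>s - \<tau>\<bar> \<le> \<rho> \<longrightarrow> \<bar>t - \<tau>\<bar> \<le> \<rho> \<longrightarrow>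
        norm (z t - z s - (t - s) *\<^sub>R ?c) \<le> e * (t - s)" if e: "0 < e" for e
    proof -
      have "isCont (\<lambda>(t, v). F t v) (fst p0 + \<tau>, z \<tau>)"
        using F by (simp add: continuous_on_eq_continuous_at)
      then obtain \<eta> where \<eta>: "0 < \<eta>" and F\<eta>: "\<And>q. dist q (fst p0 + \<tau>, z \<tau>) < \<eta> \<Longrightarrow>
          dist ((\<lambda>(t, v). F t v) q) ?c < e"
        unfolding continuous_at_eps_delta using e by (metis case_prod_conv)
      \<comment> \<open>For a mesh of at most \<rho>, a node is within 2 * \<rho> of \<tau> and its
        position within V * 2 * \<rho>, each at most \<eta> / 4. Adding \<eta> / 8 for the
        convergence leaves 3 / 8 * \<eta> in time and in space, less than \<eta> together.\<close>
      define \<rho> where "\<rho> = \<eta> / (8 * (V + 1))"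
      have \<rho>: "0 < \<rho>" "V * \<rho> \<le> \<eta> / 8" "\<rho> \<le> \<eta> / 8" using \<eta> V0 by (auto simp: \<rho>_def field_simps)
      have "norm (z t - z s - (t - s) *\<^sub>R ?c) \<le> e * (t - s)"
        if st: "0 \<le> s" "s \<le> t" "t \<le> S" "\<bar>s - \<tau>\<bar> \<le> \<rho>" "\<bar>t - \<tau>\<bar> \<le> \<rho>" for s t
      proof (rule tendsto_upperbound)
        show "(\<lambda>n. norm (?X (k n) t - ?X (k n) s - (t - s) *\<^sub>R ?c)) \<longlonglongrightarrow> norm (z t - z s - (t - s) *\<^sub>R ?c)"
          using st by (intro tendsto_intros pt) auto
        have ev: "\<forall>\<^sub>F n in sequentially. dist (fst (p (k n))) (fst p0) < \<eta> / 8"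
          "\<forall>\<^sub>F n in sequentially. dist (?X (k n) \<tau>) (z \<tau>) < \<eta> / 8"
          "\<forall>\<^sub>F n in sequentially. dist (S / real (J (k n))) 0 < \<rho>"
          using tendstoD[OF tendsto_fst[OF pk], of "\<eta> / 8"] tendstoD[OF pt[OF \<tau>], of "\<eta> / 8"] tendstoD[OF dk \<rho>(1)] \<eta>
          by auto
        show "\<forall>\<^sub>F n in sequentially. norm (?X (k n) t - ?X (k n) s - (t - s) *\<^sub>R ?c) \<le> e * (t - s)"
          using ev
        proof eventually_elim
          case (elim n)
          show ?case
          proof (rule euler_increment[OF F V S J(1) st \<tau>])
            fix q v assume q: "\<bar>q - (fst (p (k n)) + \<tau>)\<bar> \<le> \<rho> + S / real (J (k n))"
              and v: "norm (v - ?X (k n) \<tau>) \<le> V * (\<rho> + S / real (J (k n)))"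
            have dk': "S / real (J (k n)) \<le> \<rho>" using elim(3) S by simp
            have "V * (\<rho> + S / real (J (k n))) \<le> V * (\<rho> + \<rho>)"
              using dk' V0 by (intro mult_left_mono) auto
            then have v': "norm (v - ?X (k n) \<tau>) \<le> \<eta> / 4" using v \<rho>(2) by (simp add: algebra_simps)
            have "dist v (z \<tau>) \<le> norm (v - ?X (k n) \<tau>) + dist (?X (k n) \<tau>) (z \<tau>)"
              by (metis dist_norm dist_triangle)
            then have 1: "dist v (z \<tau>) \<le> 3 / 8 * \<eta>" using v' elim(2) by simp
            have 2: "dist q (fst p0 + \<tau>) \<le> 3 / 8 * \<eta>"
              using q elim(1) dk' \<rho>(3) unfolding dist_real_def by linarith
            have "dist (q, v) (fst p0 + \<tau>, z \<tau>) \<le> dist q (fst p0 + \<tau>) + dist v (z \<tau>)"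
              unfolding dist_Pair_Pair by (rule sqrt_sum_squares_le_sum) auto
            then have "dist (q, v) (fst p0 + \<tau>, z \<tau>) < \<eta>" using 1 2 \<eta> by simp
            from F\<eta>[OF this] show "norm (F q v - ?c) \<le> e" by (simp add: dist_norm)
          qed (use e in auto)
        qed
      qed auto
      then show ?thesis using \<rho>(1) by blast
    qed
    have "\<exists>d>0. \<forall>t\<in>{0..S}. norm (t - \<tau>) < d \<longrightarrow>
        norm (z t - z \<tau> - (t - \<tau>) *\<^sub>R ?c) \<le> e * norm (t - \<tau>)" if "0 < e" for e
    proof -
      from inc[OF that] obtain \<rho> where \<rho>: "\<rho> > 0"
        and inc\<rho>: "\<forall>s t. 0 \<le> s \<longrightarrow> s \<le> t \<longrightarrow> t \<le> S \<longrightarrow> \<bar>s - \<tau>\<bar> \<le> \<rho> \<longrightarrow> \<bar>t - \<tau>\<bar> \<le> \<rho> \<longrightarrow>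
          norm (z t - z s - (t - s) *\<^sub>R ?c) \<le> e * (t - s)"
        by (elim exE conjE)
      note * = inc\<rho>[rule_format]
      have "norm (z t - z \<tau> - (t - \<tau>) *\<^sub>R ?c) \<le> e * norm (t - \<tau>)"
        if t: "t \<in> {0..S}" "norm (t - \<tau>) < \<rho>" for t
      proof (cases "\<tau> \<le> t")
        case True
        then show ?thesis using *[of \<tau> t] \<tau> t \<rho> by simp
      next
        case False
        have "z t - z \<tau> - (t - \<tau>) *\<^sub>R ?c = - (z \<tau> - z t - (\<tau> - t) *\<^sub>R ?c)"
          by (simp add: algebra_simps)
        then have "norm (z t - z \<tau> - (t - \<tau>) *\<^sub>R ?c) = norm (z \<tau> - z t - (\<tau> - t) *\<^sub>R ?c)"
          by (metis norm_minus_cancel)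
        then show ?thesis using *[of t \<tau>] \<tau> t \<rho> False by simp
      qed
      then show ?thesis using \<rho> by (intro exI[of _ \<rho>]) simp
    qed
    then show ?thesis
      unfolding has_vector_derivative_def has_derivative_within_alt
      by (intro conjI bounded_linear_scaleR_left) simp
  qed
  then have "ode_solution (\<lambda>s. F (fst p0 + s)) z {0..S}" by (simp add: ode_solution_def)
  then show ?thesis by (rule that[OF k ul z0])
qed

text \<open>Applied to truncated fields, this supplies the continuation of solutions and the
  backward orbits used near the section.\<close>

corollary peano:
  assumes f: "continuous_on UNIV f" and V: "\<And>v. norm (f v) \<le> V" and S: "0 < S"
  obtains z where "z 0 = w" "ode_solution (\<lambda>_. f) z {0..S}"
proof -
  have "continuous_on UNIV (\<lambda>q :: real \<times> (real^3). f (snd q))"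
    by (rule continuous_on_compose2[OF f]) (auto intro!: continuous_intros)
  then have F: "continuous_on UNIV (\<lambda>(t :: real, v). f v)" by (simp add: case_prod_beta)
  show ?thesis
  proof (rule euler_limit[OF F V S, of Suc "\<lambda>_. (0, w)" "(0, w)"])
    fix z k assume "z 0 = snd (0 :: real, w)" "ode_solution (\<lambda>s. f) z {0..S}"
    then show ?thesis using that by simp
  qed (auto simp: filterlim_Suc)
qed

section \<open>Shadowing and gluing of solutions\<close>

lemma ode_solution_subset: "ode_solution F x I \<Longrightarrow> I' \<subseteq> I \<Longrightarrow> ode_solution F x I'"
  by (meson has_vector_derivative_within_subset ode_solution_def subsetD)

lemma ode_solution_cong:
  assumes "ode_solution F x I" "\<And>t. t \<in> I \<Longrightarrow> G t (x t) = F t (x t)"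
  shows "ode_solution G x I"
  using assms by (auto simp: ode_solution_def)

lemma ode_solution_transform:
  assumes "ode_solution F x I" "\<And>t. t \<in> I \<Longrightarrow> z t = x t"
  shows "ode_solution F z I"
  using assms by (auto simp: ode_solution_def intro: has_vector_derivative_transform[where f = x])

lemma ode_solution_continuous: "ode_solution F x I \<Longrightarrow> continuous_on I x"
  unfolding ode_solution_def continuous_on_eq_continuous_within
  using has_vector_derivative_continuous by blast

lemma ode_solution_join:
  assumes x: "ode_solution F x {a..b}" and z: "ode_solution F z {b..c}"
    and ab: "a \<le> b" "b \<le> c" and eq: "x b = z b"
  shows "ode_solution F (\<lambda>t. if t \<le> b then x t else z t) {a..c}"
  unfolding ode_solution_def
proof
  fix t assume t: "t \<in> {a..c}"
  have "((\<lambda>t. if t \<in> {a..b} then x t else z t) has_vector_derivative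
      (if t \<in> {a..b} then F t (x t) else F t (z t))) (at t within {a..c})"
  proof (rule has_vector_derivative_If_within_closures[where T = "{b..c}"])
    have *: "{a..b} \<inter> {b..c} = {b}" using ab by auto
    then have "{a..b} \<union> (closure {a..b} \<inter> closure {b..c}) = {a..b}" "{b..c} \<union> (closure {a..b} \<inter> closure {b..c}) = {b..c}"
      using ab by auto
    note un = this
    show "(x has_vector_derivative F t (x t)) (at t within {a..b} \<union> (closure {a..b} \<inter> closure {b..c}))"
      if "t \<in> {a..b} \<union> (closure {a..b} \<inter> closure {b..c})"
      using x that unfolding un by (auto simp: ode_solution_def)
    show "(z has_vector_derivative F t (z t)) (at t within {b..c} \<union> (closure {a..b} \<inter> closure {b..c}))"
      if "t \<in> {b..c} \<union> (closure {a..b} \<inter> closure {b..c})"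
      using z that unfolding un by (auto simp: ode_solution_def)
  qed (use t ab eq in auto)
  then have "((\<lambda>t. if t \<in> {a..b} then x t else z t) has_vector_derivative
      F t (if t \<le> b then x t else z t)) (at t within {a..c})"
    using t by (simp split: if_splits)
  then show "((\<lambda>t. if t \<le> b then x t else z t) has_vector_derivative
      F t (if t \<le> b then x t else z t)) (at t within {a..c})"
    by (rule has_vector_derivative_transform[OF t, rotated]) auto
qed

lemma ode_solution_shift:
  assumes x: "ode_solution F x {0..S}" and F: "\<And>s. F s = G (T + s)"
  shows "ode_solution G (\<lambda>t. x (t - T)) {T..T + S}"
  unfolding ode_solution_def
proof
  fix t assume t: "t \<in> {T..T + S}"
  have "((\<lambda>t. t - T) has_vector_derivative 1) (at t within {T..T + S})"
    by (auto intro!: derivative_eq_intros)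
  moreover have "(x has_vector_derivative G t (x (t - T))) (at (t - T) within {0..S})"
    using bspec[OF x[unfolded ode_solution_def], of "t - T"] t F[of "t - T"] by simp
  then have "(x has_vector_derivative G t (x (t - T))) (at (t - T) within (\<lambda>t. t - T) ` {T..T + S})"
    by (rule has_vector_derivative_within_subset) auto
  ultimately have "((x \<circ> (\<lambda>t. t - T)) has_vector_derivative 1 *\<^sub>R G t (x (t - T))) (at t within {T..T + S})"
    by (rule vector_diff_chain_within)
  then show "((\<lambda>t. x (t - T)) has_vector_derivative G t (x (t - T))) (at t within {T..T + S})"
    by (simp add: o_def)
qed

lemma ode_solution_reverse:
  assumes x: "ode_solution (\<lambda>_. g) x {0..S}" and s: "s \<le> S"
  shows "ode_solution (\<lambda>_ v. - g v) (\<lambda>t. x (s - t)) {0..s}"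
  unfolding ode_solution_def
proof
  fix t assume t: "t \<in> {0..s}"
  have "((\<lambda>t. s - t) has_vector_derivative - 1) (at t within {0..s})"
    by (auto intro!: derivative_eq_intros)
  moreover have "(x has_vector_derivative g (x (s - t))) (at (s - t) within {0..S})"
    using x t s by (simp add: ode_solution_def)
  then have "(x has_vector_derivative g (x (s - t))) (at (s - t) within (\<lambda>t. s - t) ` {0..s})"
    by (rule has_vector_derivative_within_subset) (use s in auto)
  ultimately have "((x \<circ> (\<lambda>t. s - t)) has_vector_derivative (- 1) *\<^sub>R g (x (s - t))) (at t within {0..s})"
    by (rule vector_diff_chain_within)
  then show "((\<lambda>t. x (s - t)) has_vector_derivative - g (x (s - t))) (at t within {0..s})"
    by (simp add: o_def)
qed

section \<open>Truncation and shadowing for locally Lipschitz fields\<close>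

definition trunc :: "real \<Rightarrow> real^3 \<Rightarrow> real^3" where
  "trunc M = closest_point (cball 0 M)"

lemma trunc_eq: "norm v \<le> M \<Longrightarrow> trunc M v = v"
  by (simp add: trunc_def closest_point_self)

lemma norm_trunc_le: "0 \<le> M \<Longrightarrow> norm (trunc M v) \<le> M"
  using closest_point_in_set[of "cball (0 :: real^3) M" v] by (auto simp: trunc_def)

lemma continuous_on_trunc: "0 \<le> M \<Longrightarrow> continuous_on A (trunc M)"
  unfolding trunc_def by (intro continuous_on_closest_point) auto

lemma lipschitz_on_trunc: "0 \<le> M \<Longrightarrow> 1-lipschitz_on A (trunc M)"
  unfolding trunc_def lipschitz_on_def
  using closest_point_lipschitz[of "cball (0 :: real^3) M"] by auto

text \<open>The nearest-point retraction does not increase distances, so a Lipschitz bound on the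
  ball becomes global, while orbits inside the ball do not notice the change.\<close>

lemma lipschitz_on_comp_trunc:
  assumes "L-lipschitz_on (cball 0 M) g" "0 \<le> M"
  shows "L-lipschitz_on UNIV (g \<circ> trunc M)"
proof -
  have "trunc M ` UNIV \<subseteq> cball 0 M" using norm_trunc_le[OF assms(2)] by auto
  then show ?thesis
    using lipschitz_on_compose[OF lipschitz_on_trunc[OF assms(2)] lipschitz_on_subset[OF assms(1)]]
    by simp
qed

lemma bounded_comp_trunc:
  assumes "continuous_on UNIV g" "0 \<le> M"
  obtains V where "\<And>v. norm ((g \<circ> trunc M) v) \<le> V"
proof -
  have "compact (g ` cball 0 M)"
    by (intro compact_continuous_image continuous_on_subset[OF assms(1)]) auto
  then obtain V where "\<And>w. w \<in> g ` cball 0 M \<Longrightarrow> norm w \<le> V"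
    by (meson bounded_iff compact_imp_bounded)
  then show ?thesis using that[of V] norm_trunc_le[OF assms(2)] by auto
qed

lemma solution_bounded:
  assumes "ode_solution F x {0..S}"
  obtains M where "0 \<le> M" "\<And>t. t \<in> {0..S} \<Longrightarrow> norm (x t) \<le> M"
proof -
  have "compact (x ` {0..S})"
    by (intro compact_continuous_image ode_solution_continuous[OF assms]) auto
  then obtain M where "\<And>w. w \<in> x ` {0..S} \<Longrightarrow> norm w \<le> M"
    by (meson bounded_iff compact_imp_bounded)
  then show ?thesis using that[of "max 0 M"] by force
qed

text \<open>The radius \<open>M\<close> is left open because it is fixed later, as a maximum over a
  finite cover. The shorter intervals \<open>S'\<close> admit orbits that are not known to exist up
  to \<open>S\<close>.\<close>

definition shadowed ::
    "(real^3 \<Rightarrow> real^3) \<Rightarrow> real \<Rightarrow> real \<Rightarrow> real \<Rightarrow> (real \<Rightarrow> real^3) \<Rightarrow> real \<Rightarrow> bool" where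
  "shadowed g M0 \<delta> \<epsilon> y S \<longleftrightarrow> (\<forall>M\<ge>M0. \<forall>S'\<le>S. \<forall>x. pseudo_orbit (g \<circ> trunc M) \<delta> x S' \<longrightarrow>
      norm (x 0 - y 0) < \<delta> \<longrightarrow> (\<forall>t\<in>{0..S'}. norm (x t - y t) < \<epsilon>))"

lemma shadowedD:
  "\<lbrakk>shadowed g M0 \<delta> \<epsilon> y S; M0 \<le> M; S' \<le> S; pseudo_orbit (g \<circ> trunc M) \<delta> x S';
    norm (x 0 - y 0) < \<delta>; t \<in> {0..S'}\<rbrakk> \<Longrightarrow> norm (x t - y t) < \<epsilon>"
  unfolding shadowed_def by blast

locale locally_lipschitz =
  fixes g :: "real^3 \<Rightarrow> real^3"
  assumes lipschitz: "\<And>M. \<exists>L. L-lipschitz_on (cball 0 M) g"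
begin

lemma uminus: "locally_lipschitz (\<lambda>v. - g v)"
  using lipschitz by unfold_locales simp

lemma continuous: "continuous_on A g"
proof -
  have "isCont g v" for v
  proof -
    obtain L where "L-lipschitz_on (cball 0 (norm v + 1)) g" using lipschitz by blast
    then have "continuous_on (ball 0 (norm v + 1)) g"
      using lipschitz_on_continuous_on continuous_on_subset ball_subset_cball by blast
    then show ?thesis by (simp add: continuous_on_eq_continuous_at)
  qed
  then show ?thesis by (simp add: continuous_at_imp_continuous_on)
qed

lemma continuous_comp_trunc: "0 \<le> M \<Longrightarrow> continuous_on A (g \<circ> trunc M)"
  by (intro continuous_on_compose continuous_on_trunc continuous)

lemma solution_pseudo_orbit:
  assumes x: "ode_solution (\<lambda>_. g) x {0..S}" and M: "0 \<le> M" "\<And>t. t \<in> {0..S} \<Longrightarrow> norm (x t) \<le> M"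
  shows "pseudo_orbit (g \<circ> trunc M) 0 x S"
  by (intro pseudo_orbit_of_exact_solution ode_solution_cong[OF x] continuous_comp_trunc M(1))
    (auto simp: M trunc_eq)

text \<open>The unit tube around \<open>y\<close> lies in the ball of radius \<open>M1 + 1\<close>.
  There the field has one Lipschitz constant, and truncation at any larger radius is invisible, so
  the same \<delta> works for all such radii.\<close>

lemma stability:
  assumes y: "ode_solution (\<lambda>_. g) y {0..S}" and S: "0 \<le> S"
  shows "\<exists>M0\<ge>0. (\<forall>t\<in>{0..S}. norm (y t) + 1 \<le> M0) \<and>
    (\<forall>\<epsilon>>0. \<exists>\<delta>>0. shadowed g M0 \<delta> \<epsilon> y S)"
proof -
  obtain M1 where M1: "0 \<le> M1" "\<And>t. t \<in> {0..S} \<Longrightarrow> norm (y t) \<le> M1"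
    using solution_bounded[OF y] by blast
  obtain L0 where "L0-lipschitz_on (cball 0 (M1 + 1)) g" using lipschitz by blast
  then have "(max L0 1)-lipschitz_on (cball 0 (M1 + 1)) g" by (rule lipschitz_on_le) simp
  then obtain L where L: "0 < L" "L-lipschitz_on (cball 0 (M1 + 1)) g" by (rule that[rotated]) simp
  \<comment> \<open>\<open>K\<close> is the factor by which Gronwall amplifies an error \<delta> in
    both the initial point and the field. The minimum with 1 in the choice of \<delta> below keeps
    the orbit in the unit tube.\<close>
  define K where "K = 2 * (1 + S) * exp (2 * L * S)"
  have K: "0 < K" using S by (simp add: K_def)
  show ?thesis
  proof (rule exI[of _ "M1 + 1"], intro conjI ballI allI impI)
    show "0 \<le> M1 + 1" using M1 by simp
    show "norm (y t) + 1 \<le> M1 + 1" if "t \<in> {0..S}" for t using M1 that by simp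
    fix \<epsilon> :: real assume \<epsilon>: "0 < \<epsilon>"
    define \<delta> where "\<delta> = min \<epsilon> 1 / (2 * K)"
    have \<delta>: "0 < \<delta>" "\<delta> * K < \<epsilon>" "\<delta> * K < 1" using \<epsilon> K by (auto simp: \<delta>_def)
    have "norm (x t - y t) < \<epsilon>" if M: "M1 + 1 \<le> M" and S': "S' \<le> S"
      and x: "pseudo_orbit (g \<circ> trunc M) \<delta> x S'" and 0: "norm (x 0 - y 0) < \<delta>"
      and t: "t \<in> {0..S'}" for M S' x t
    proof -
      let ?f = "g \<circ> trunc M"
      have y': "pseudo_orbit ?f 0 y S'"
      proof (rule pseudo_orbit_subset[OF solution_pseudo_orbit[OF y] S'])
        show "norm (y t) \<le> M" if "t \<in> {0..S}" for t using M1(2)[OF that] M by linarith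
      qed (use M M1 in linarith)
      have "2 * (norm (x 0 - y 0) + \<delta> * S') * exp (2 * L * S') \<le> 2 * (\<delta> + \<delta> * S) * exp (2 * L * S)"
        using 0 \<delta> S S' t L by (intro mult_mono add_mono) auto
      also have "\<dots> = \<delta> * K" by (simp add: K_def algebra_simps)
      finally have small: "2 * (norm (x 0 - y 0) + \<delta> * S') * exp (2 * L * S') \<le> \<delta> * K" .
      have "norm (x t - y t) \<le> 2 * (norm (x 0 - y 0) + \<delta> * S') * exp (2 * L * S')"
      proof (rule pseudo_orbit_close[OF y' x continuous_comp_trunc L(1) _ _ _ t])
        show "2 * (norm (x 0 - y 0) + \<delta> * S') * exp (2 * L * S') < 1"
          using small \<delta> by linarith
        fix r v assume r: "r \<in> {0..S'}" and v: "norm (v - y r) \<le> 1"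
        have "norm (y r) \<le> M1" using r S' M1 by auto
        moreover have "norm v \<le> norm (y r) + norm (v - y r)" by (metis add.commute diff_add_cancel norm_triangle_ineq)
        ultimately have "norm v \<le> M1 + 1" "norm (y r) \<le> M1 + 1" using v by auto
        then show "norm (?f v - ?f (y r)) \<le> L * norm (v - y r)"
          using lipschitz_on_normD[OF L(2), of v "y r"] M by (simp add: trunc_eq)
      qed (use M M1 \<delta> in auto)
      then show ?thesis using small \<delta> by linarith
    qed
    then show "\<exists>\<delta>>0. shadowed g (M1 + 1) \<delta> \<epsilon> y S"
      using \<delta>(1) unfolding shadowed_def by blast
  qed
qed

text \<open>A solution is a pseudo-orbit with every positive error. Two solutions with the same
  start that differ at \<open>t\<close> would contradict shadowing with \<epsilon> equal to their
  distance.\<close>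

lemma solution_unique:
  assumes x: "ode_solution (\<lambda>_. g) x {0..S}" and y: "ode_solution (\<lambda>_. g) y {0..S}"
    and eq: "x 0 = y 0" and t: "t \<in> {0..S}"
  shows "x t = y t"
proof (rule ccontr)
  assume "x t \<noteq> y t"
  then have pos: "0 < norm (x t - y t)" by simp
  obtain M1 where M1: "0 \<le> M1" "\<And>t. t \<in> {0..S} \<Longrightarrow> norm (x t) \<le> M1"
    using solution_bounded[OF x] by blast
  have S: "0 \<le> S" using t by simp
  obtain M0 \<delta> where \<delta>: "0 < \<delta>" and sh: "shadowed g M0 \<delta> (norm (x t - y t)) y S"
    using stability[OF y S] pos by blast
  have "pseudo_orbit (g \<circ> trunc (max M0 M1)) \<delta> x S"
  proof (intro pseudo_orbit_mono[OF solution_pseudo_orbit[OF x]])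
    show "norm (x t) \<le> max M0 M1" if "t \<in> {0..S}" for t using M1(2)[OF that] by simp
  qed (use M1 \<delta> in auto)
  from shadowedD[OF sh _ _ this _ t] show False using eq \<delta> by simp
qed

text \<open>A solution of the truncated field that starts at \<open>y S\<close> stays within
  distance 1 of \<open>y S\<close> for a short time, and there truncation has no effect.\<close>

lemma solution_extend:
  assumes y: "ode_solution (\<lambda>_. g) y {0..S}" and S: "0 \<le> S"
  obtains \<kappa> z where "0 < \<kappa>" "ode_solution (\<lambda>_. g) z {0..S + \<kappa>}" "\<And>t. t \<in> {0..S} \<Longrightarrow> z t = y t"
proof -
  define M where "M = norm (y S) + 1"
  have M: "0 \<le> M" by (simp add: M_def)
  obtain V where V: "\<And>v. norm ((g \<circ> trunc M) v) \<le> V" using bounded_comp_trunc[OF continuous M] by blast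
  obtain v where v: "v 0 = y S" "ode_solution (\<lambda>_. g \<circ> trunc M) v {0..1}"
    by (rule peano[OF continuous_comp_trunc[OF M] V zero_less_one])
  have "continuous_on {0..1} v" using v(2) by (rule ode_solution_continuous)
  then obtain d where d: "0 < d" "\<And>t. t \<in> {0..1} \<Longrightarrow> dist t 0 < d \<Longrightarrow> dist (v t) (v 0) < 1"
    unfolding continuous_on_iff by (metis atLeastAtMost_iff order_refl zero_le_one zero_less_one)
  define \<kappa> where "\<kappa> = min 1 (d / 2)"
  have \<kappa>: "0 < \<kappa>" "\<kappa> \<le> 1" "\<kappa> < d" using d(1) by (auto simp: \<kappa>_def)
  have "norm (v t) \<le> M" if "t \<in> {0..\<kappa>}" for t
  proof -
    have "dist (v t) (v 0) < 1" using d(2)[of t] that \<kappa> by auto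
    then show ?thesis using norm_triangle_ineq2[of "v t" "v 0"] v(1) by (simp add: M_def dist_norm)
  qed
  then have "ode_solution (\<lambda>_. g) v {0..\<kappa>}"
    using \<kappa> by (intro ode_solution_cong[OF ode_solution_subset[OF v(2)]]) (auto simp: trunc_eq)
  from ode_solution_shift[OF this, of "\<lambda>_. g" S]
  have v': "ode_solution (\<lambda>_. g) (\<lambda>t. v (t - S)) {S..S + \<kappa>}" by simp
  have "ode_solution (\<lambda>_. g) (\<lambda>t. if t \<le> S then y t else v (t - S)) {0..S + \<kappa>}"
    using S \<kappa> v(1) by (intro ode_solution_join[OF y v']) auto
  then show ?thesis using that[OF \<kappa>(1)] by fastforce
qed

end

section \<open>The Roessler flow near the section\<close>

lemma norm_vec3_le: "norm (v :: real^3) \<le> \<bar>v$1\<bar> + \<bar>v$2\<bar> + \<bar>v$3\<bar>"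
  using norm_le_l1_cart[of v] by (simp add: sum_3)

lemma locally_lipschitz_rossler: "locally_lipschitz (rossler a b)"
proof
  fix M :: real
  \<comment> \<open>The summands are Lipschitz constants of the three components. The last component
    is quadratic and brings in the radius; its absolute value keeps \<open>K\<close> nonnegative for
    every real \<open>M\<close>.\<close>
  define K where "K = 2 + (1 + \<bar>b\<bar>) + (2 * \<bar>M\<bar> + \<bar>a\<bar>)"
  have "dist (rossler a b u) (rossler a b v) \<le> K * dist u v"
    if "u \<in> cball 0 M" "v \<in> cball 0 M" for u v :: "real^3"
  proof -
    define d where "d = dist u v"
    have d: "\<bar>u$i - v$i\<bar> \<le> d" for i
      using component_le_norm_cart[of "u - v" i] by (simp add: d_def dist_norm)
    have M: "\<bar>u$i\<bar> \<le> M" "\<bar>v$i\<bar> \<le> M" for i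
      using that component_le_norm_cart[of u i] component_le_norm_cart[of v i] by auto
    have d0: "0 \<le> d" by (simp add: d_def)
    have 1: "\<bar>- (u$2 + u$3) + (v$2 + v$3)\<bar> \<le> 2 * d"
      using d[of 2] d[of 3] by linarith
    have "\<bar>b * (u$2 - v$2)\<bar> \<le> \<bar>b\<bar> * d" by (simp add: abs_mult mult_left_mono d)
    then have 2: "\<bar>(u$1 + b * u$2) - (v$1 + b * v$2)\<bar> \<le> (1 + \<bar>b\<bar>) * d"
      using d[of 1] by (simp add: algebra_simps)
    have "u$3 * (u$1 - a) - v$3 * (v$1 - a) = u$3 * (u$1 - v$1) + (u$3 - v$3) * v$1 - a * (u$3 - v$3)"
      by (simp add: algebra_simps)
    moreover have "\<bar>u$3 * (u$1 - v$1)\<bar> \<le> M * d" "\<bar>(u$3 - v$3) * v$1\<bar> \<le> d * M" "\<bar>a * (u$3 - v$3)\<bar> \<le> \<bar>a\<bar> * d"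
      unfolding abs_mult using d M d0 by (auto intro!: mult_mono intro: order_trans[OF abs_ge_zero])
    ultimately have "\<bar>u$3 * (u$1 - a) - v$3 * (v$1 - a)\<bar> \<le> M * d + d * M + \<bar>a\<bar> * d" by linarith
    moreover have "M * d \<le> \<bar>M\<bar> * d" using d0 by (intro mult_right_mono) auto
    ultimately have 3: "\<bar>(b + u$3 * (u$1 - a)) - (b + v$3 * (v$1 - a))\<bar> \<le> (2 * \<bar>M\<bar> + \<bar>a\<bar>) * d"
      by (simp add: algebra_simps)
    have "norm (rossler a b u - rossler a b v) \<le> 2 * d + (1 + \<bar>b\<bar>) * d + (2 * \<bar>M\<bar> + \<bar>a\<bar>) * d"
    proof -
      let ?n = "rossler a b u - rossler a b v"
      have n: "?n$1 = - (u$2 + u$3) + (v$2 + v$3)" "?n$2 = (u$1 + b * u$2) - (v$1 + b * v$2)"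
        "?n$3 = (b + u$3 * (u$1 - a)) - (b + v$3 * (v$1 - a))"
        by (simp_all add: rossler_def)
      show ?thesis using norm_vec3_le[of ?n] 1 2 3 unfolding n by linarith
    qed
    then show ?thesis by (simp add: K_def d_def dist_norm algebra_simps)
  qed
  then have "K-lipschitz_on (cball 0 M) (rossler a b)"
    by (intro lipschitz_onI) (auto simp: K_def)
  then show "\<exists>L. L-lipschitz_on (cball 0 M) (rossler a b)" by blast
qed

interpretation rossler: locally_lipschitz "rossler a b" for a b
  by (rule locally_lipschitz_rossler)

lemma closure_Theta: "v \<in> closure Theta \<Longrightarrow> v$1 = 0"
proof -
  have "closed {v :: real^3. v$1 = 0}" by (intro closed_Collect_eq continuous_intros)
  moreover have "Theta \<subseteq> {v. v$1 = 0}" by (auto simp: Theta_def)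
  ultimately show "v \<in> closure Theta \<Longrightarrow> v$1 = 0" using closure_minimal by blast
qed

text \<open>Quantitative transversality: \<open>c\<close> is half of the crossing speed -(y + z) at
  \<open>w\<close>, and moving by \<rho> costs at most 2 * \<rho> \<le> c of that speed.\<close>

lemma Theta_neighbourhood:
  assumes "w \<in> Theta"
  obtains \<rho> c where "0 < \<rho>" "0 < c"
    and "\<And>v. norm (v - w) \<le> \<rho> \<Longrightarrow> v$2 < 0 \<and> c \<le> rossler a b v $ 1"
proof -
  define c where "c = - (w$2 + w$3) / 2"
  have w: "w$2 < 0" "0 < c" using assms by (auto simp: Theta_def c_def)
  define \<rho> where "\<rho> = min (- w$2) c / 2"
  have \<rho>: "0 < \<rho>" using w by (auto simp: \<rho>_def)
  have "v$2 < 0 \<and> c \<le> rossler a b v $ 1" if "norm (v - w) \<le> \<rho>" for v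
  proof -
    have "\<bar>v$2 - w$2\<bar> \<le> \<rho>" "\<bar>v$3 - w$3\<bar> \<le> \<rho>"
      using order_trans[OF component_le_norm_cart that] by (metis vector_minus_component)+
    moreover have "2 * \<rho> \<le> c" "2 * \<rho> \<le> - w$2" by (auto simp: \<rho>_def)
    moreover have "w$2 + w$3 = - (2 * c)" by (simp add: c_def field_simps)
    ultimately show ?thesis using \<rho> unfolding rossler_def vector_3 by linarith
  qed
  then show ?thesis using that \<rho> w(2) by blast
qed

lemma Theta_iff: "v \<in> Theta \<longleftrightarrow> v$1 = 0 \<and> v$2 < 0 \<and> 0 < rossler a b v $ 1"
  by (simp add: Theta_def rossler_def)

text \<open>A field that pushes the first coordinate with speed at least \<open>c\<close> cannot be
  stopped by an error below \<open>c\<close>. Crossings of the section by polygons are therefore as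
  simple as those of solutions.\<close>

lemma pseudo_orbit_increase:
  assumes x: "pseudo_orbit f \<delta> x S" and f: "continuous_on UNIV f" and \<delta>: "\<delta> < c"
    and st: "0 \<le> s" "s < t" "t \<le> S" and c: "\<And>r. r \<in> {s..t} \<Longrightarrow> c \<le> f (x r) $ 1"
  shows "x s $ 1 < x t $ 1"
proof -
  have "continuous_on {s..t} (\<lambda>r. f (x r))"
    using st by (intro continuous_on_compose2[OF f] continuous_on_subset[OF pseudo_orbitD(1)[OF x]]) auto
  then have int: "(\<lambda>r. f (x r)) integrable_on {s..t}" by (rule integrable_continuous_real)
  have "c * (t - s) \<le> integral {s..t} (\<lambda>r. f (x r)) $ 1"
  proof -
    have i1: "((\<lambda>r. f (x r) $ 1) has_integral (integral {s..t} (\<lambda>r. f (x r)) $ 1)) {s..t}"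
      using has_integral_linear[OF integrable_integral[OF int] bounded_linear_vec_nth[of 1]]
      by (simp add: o_def)
    have i2: "((\<lambda>r. c) has_integral (c * (t - s))) {s..t}"
      using has_integral_const_real[of c s t] st by (simp add: mult.commute)
    show ?thesis by (rule has_integral_le[OF i2 i1 c])
  qed
  moreover have "\<bar>(x t - x s - integral {s..t} (\<lambda>r. f (x r))) $ 1\<bar> \<le> \<delta> * (t - s)"
    using st by (intro order_trans[OF component_le_norm_cart pseudo_orbitD(2)[OF x]]) auto
  moreover have "\<delta> * (t - s) < c * (t - s)" using \<delta> st by simp
  ultimately show ?thesis by simp
qed

section \<open>First returns of exact solutions\<close>

definition first_hit :: "(real \<Rightarrow> real^3) \<Rightarrow> real \<Rightarrow> bool" where
  "first_hit x t \<longleftrightarrow> 0 < t \<and> x t \<in> Theta \<and> (\<forall>s. 0 < s \<and> s < t \<longrightarrow> x s \<notin> Theta)"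

lemma first_hit_unique: "first_hit x s \<Longrightarrow> first_hit x t \<Longrightarrow> s = t"
  unfolding first_hit_def by (meson linorder_neqE_linordered_idom)

text \<open>Orbits start on the section itself; this keeps return times from accumulating at 0, so
  that their infimum is a genuine first return.\<close>

lemma solution_leaves_Theta:
  assumes x: "ode_solution (\<lambda>_. rossler a b) x {0..S}" and "x 0 \<in> Theta" and S: "0 < S"
  obtains \<kappa> where "0 < \<kappa>" "\<kappa> \<le> S" "\<And>t. \<lbrakk>0 < t; t \<le> \<kappa>\<rbrakk> \<Longrightarrow> 0 < x t $ 1"
proof -
  obtain \<rho> c where \<rho>: "0 < \<rho>" "0 < c"
    "\<And>v. norm (v - x 0) \<le> \<rho> \<Longrightarrow> v$2 < 0 \<and> c \<le> rossler a b v $ 1"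
    using Theta_neighbourhood[OF assms(2)] by blast
  have po: "pseudo_orbit (rossler a b) 0 x S"
    by (rule pseudo_orbit_of_exact_solution[OF x rossler.continuous])
  have "continuous_on {0..S} x" by (rule ode_solution_continuous[OF x])
  then obtain d where d: "0 < d" "\<And>t. \<lbrakk>t \<in> {0..S}; dist t 0 < d\<rbrakk> \<Longrightarrow> dist (x t) (x 0) < \<rho>"
    unfolding continuous_on_iff using \<rho>(1) S by (metis atLeastAtMost_iff less_imp_le order_refl)
  define \<kappa> where "\<kappa> = min S (d / 2)"
  have \<kappa>: "0 < \<kappa>" "\<kappa> \<le> S" "\<kappa> < d" using d S by (auto simp: \<kappa>_def)
  have "0 < x t $ 1" if t: "0 < t" "t \<le> \<kappa>" for t
  proof -
    have "c \<le> rossler a b (x r) $ 1" if "r \<in> {0..t}" for r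
      using d(2)[of r] \<rho>(3)[of "x r"] that t \<kappa> by (simp add: dist_norm)
    then have "x 0 $ 1 < x t $ 1"
      using t \<kappa> by (intro pseudo_orbit_increase[OF po rossler.continuous \<rho>(2)]) auto
    then show ?thesis using assms(2) by (simp add: Theta_def)
  qed
  then show ?thesis using that \<kappa> by blast
qed

lemma first_return_iff:
  assumes w: "w \<in> Theta"
  shows "first_return a b w p \<longleftrightarrow> (\<exists>y \<sigma>. ode_solution (\<lambda>_. rossler a b) y {0..\<sigma>} \<and> y 0 = w \<and>
    first_hit y \<sigma> \<and> p = y \<sigma>)"
proof
  assume "first_return a b w p"
  then obtain x T where x: "ode_solution (\<lambda>_. rossler a b) x {0..T}" "x 0 = w"
    and ne: "return_times x T \<noteq> {}" and \<sigma>: "x (Inf (return_times x T)) \<in> Theta" "p = x (Inf (return_times x T))"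
    unfolding first_return_def by blast
  let ?A = "return_times x T" and ?\<sigma> = "Inf (return_times x T)"
  have bdd: "bdd_below ?A" by (auto simp: return_times_def intro!: bdd_belowI[of _ 0])
  have T: "0 < T" using ne by (auto simp: return_times_def)
  have ge: "0 \<le> ?\<sigma>" by (rule cInf_greatest[OF ne]) (auto simp: return_times_def)
  have le: "?\<sigma> \<le> T" using ne cInf_lower[OF _ bdd] by (force simp: return_times_def)
  have "?\<sigma> \<noteq> 0"
  proof
    assume 0: "?\<sigma> = 0"
    obtain \<kappa> where \<kappa>: "0 < \<kappa>" "\<And>t. \<lbrakk>0 < t; t \<le> \<kappa>\<rbrakk> \<Longrightarrow> 0 < x t $ 1"
      using solution_leaves_Theta[OF x(1) _ T] x(2) w by metis
    obtain t where "t \<in> ?A" "t < \<kappa>" using cInf_lessD[OF ne, of \<kappa>] 0 \<kappa> by auto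
    then show False using \<kappa>(2)[of t] by (auto simp: return_times_def Theta_def)
  qed
  then have pos: "0 < ?\<sigma>" using ge by simp
  have "x s \<notin> Theta" if "0 < s" "s < ?\<sigma>" for s
    using cInf_lower[OF _ bdd, of s] that le by (auto simp: return_times_def)
  then have "first_hit x ?\<sigma>" using pos \<sigma> by (simp add: first_hit_def)
  moreover have "ode_solution (\<lambda>_. rossler a b) x {0..?\<sigma>}"
    by (rule ode_solution_subset[OF x(1)]) (use le in auto)
  ultimately show "\<exists>y \<sigma>. ode_solution (\<lambda>_. rossler a b) y {0..\<sigma>} \<and> y 0 = w \<and> first_hit y \<sigma> \<and> p = y \<sigma>"
    using x(2) \<sigma>(2) by blast
next
  assume "\<exists>y \<sigma>. ode_solution (\<lambda>_. rossler a b) y {0..\<sigma>} \<and> y 0 = w \<and> first_hit y \<sigma> \<and> p = y \<sigma>"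
  then obtain y \<sigma> where y: "ode_solution (\<lambda>_. rossler a b) y {0..\<sigma>}" "y 0 = w" "first_hit y \<sigma>" "p = y \<sigma>"
    by blast
  \<comment> \<open>An orbit stopped at its first hit has a single return time, so the infimum is
    trivial.\<close>
  have "return_times y \<sigma> = {\<sigma>}"
    using y(3) unfolding return_times_def first_hit_def by force
  then show "first_return a b w p"
    unfolding first_return_def using y by (intro exI[of _ y] exI[of _ \<sigma>]) (auto simp: first_hit_def)
qed

lemma first_hit_solution_unique:
  assumes y: "ode_solution (\<lambda>_. rossler a b) y {0..\<sigma>}" "first_hit y \<sigma>"
    and z: "ode_solution (\<lambda>_. rossler a b) z {0..\<tau>}" "first_hit z \<tau>" and eq: "y 0 = z 0"
  shows "\<sigma> = \<tau> \<and> y \<sigma> = z \<tau>"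
proof -
  have le: "\<tau>' \<le> \<sigma>'" if y: "ode_solution (\<lambda>_. rossler a b) y {0..\<sigma>'}" "first_hit y \<sigma>'"
    and z: "ode_solution (\<lambda>_. rossler a b) z {0..\<tau>'}" "first_hit z \<tau>'" and eq: "y 0 = z 0" for y z \<sigma>' \<tau>'
  proof (rule ccontr)
    assume "\<not> \<tau>' \<le> \<sigma>'"
    then have lt: "\<sigma>' < \<tau>'" by simp
    have "ode_solution (\<lambda>_. rossler a b) z {0..\<sigma>'}"
      by (rule ode_solution_subset[OF z(1)]) (use lt in auto)
    from rossler.solution_unique[OF y(1) this eq, of \<sigma>'] have "y \<sigma>' = z \<sigma>'"
      using y(2) by (simp add: first_hit_def)
    then show False using y(2) z(2) lt by (auto simp: first_hit_def)
  qed
  have st: "\<sigma> = \<tau>" using le[OF y z eq] le[OF z y eq[symmetric]] by simp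
  then show ?thesis
    using rossler.solution_unique[OF y(1) z(1)[folded st] eq, of \<sigma>] y(2) by (simp add: first_hit_def)
qed

lemma poincare_eq:
  assumes y: "ode_solution (\<lambda>_. rossler a b) y {0..\<sigma>}" "first_hit y \<sigma>" and w: "y 0 \<in> Theta"
  shows "poincare a b (y 0) = y \<sigma>"
  unfolding poincare_def first_return_iff[OF w]
proof (rule the_equality)
  fix p
  assume "\<exists>z \<tau>. ode_solution (\<lambda>_. rossler a b) z {0..\<tau>} \<and> z 0 = y 0 \<and> first_hit z \<tau> \<and> p = z \<tau>"
  then show "p = y \<sigma>" using first_hit_solution_unique[OF _ _ y] by blast
qed (use y in blast)

lemma poincare_orbit:
  assumes "w \<in> poincare_domain a b"
  obtains y \<sigma> where "ode_solution (\<lambda>_. rossler a b) y {0..\<sigma>}" "y 0 = w" "first_hit y \<sigma>"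
    and "poincare a b w = y \<sigma>"
proof -
  obtain p where w: "w \<in> Theta" and "first_return a b w p"
    using assms by (auto simp: poincare_domain_def)
  then obtain y \<sigma> where y: "ode_solution (\<lambda>_. rossler a b) y {0..\<sigma>}" "y 0 = w" "first_hit y \<sigma>"
    using first_return_iff[OF w] by blast
  then show ?thesis using that poincare_eq[OF y(1,3)] w by auto
qed

text \<open>An exact solution is not known beforehand to stay in the ball of radius
  \<open>M0\<close>. Truncating at a radius that also covers the solution leaves it a solution, and
  \<open>shadowed\<close> allows any such radius.\<close>

lemma (in locally_lipschitz) shadowed_solution:
  assumes sh: "shadowed g M0 \<delta> \<epsilon> y S" and \<delta>: "0 < \<delta>" and x: "ode_solution (\<lambda>_. g) x {0..S'}"
    and "S' \<le> S" "norm (x 0 - y 0) < \<delta>" "t \<in> {0..S'}"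
  shows "norm (x t - y t) < \<epsilon>"
proof -
  obtain M1 where M1: "0 \<le> M1" "\<And>t. t \<in> {0..S'} \<Longrightarrow> norm (x t) \<le> M1"
    using solution_bounded[OF x] by blast
  have "pseudo_orbit (g \<circ> trunc (max M0 M1)) 0 x S'"
  proof (rule solution_pseudo_orbit[OF x])
    show "norm (x t) \<le> max M0 M1" if "t \<in> {0..S'}" for t using M1(2)[OF that] by simp
  qed (use M1 in simp)
  then have "pseudo_orbit (g \<circ> trunc (max M0 M1)) \<delta> x S'"
    by (rule pseudo_orbit_mono) (use \<delta> in simp)
  from shadowedD[OF sh _ _ this] show ?thesis using assms by simp
qed

lemma continuous_on_near:
  fixes x :: "real \<Rightarrow> 'a::real_normed_vector"
  assumes "continuous_on {a..b} x" "\<tau> \<in> {a..b}" "0 < \<rho>"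
  obtains d where "0 < d" "\<And>t. \<lbrakk>t \<in> {a..b}; \<bar>t - \<tau>\<bar> < d\<rbrakk> \<Longrightarrow> norm (x t - x \<tau>) < \<rho>"
  using assms unfolding continuous_on_iff dist_norm real_norm_def by metis

text \<open>A point \<open>q\<close> of \<open>Theta\<close> close to \<open>y s\<close> flows back
  to the vicinity of \<open>y 0\<close>. The flow is transversal to the plane there, so the backward
  orbit crosses \<open>Theta\<close> after a time close to \<open>s\<close>; read forwards, it
  starts at this crossing and ends at \<open>q\<close>.\<close>

lemma closure_Theta_hit_by_near_orbit:
  assumes y: "ode_solution (\<lambda>_. rossler a b) y {0..s}" and s: "0 < s"
    and y0: "y 0 \<in> Theta" and ys: "y s \<in> closure Theta" and \<epsilon>: "0 < \<epsilon>"
  obtains u r where "ode_solution (\<lambda>_. rossler a b) u {0..r}" "u 0 \<in> Theta" "norm (u 0 - y 0) < \<epsilon>"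
    "u r \<in> Theta" "0 < r" "r < s + \<epsilon>"
proof -
  let ?R = "rossler a b" and ?B = "\<lambda>v. - rossler a b v"
  interpret backward: locally_lipschitz "\<lambda>v. - rossler a b v" by (rule rossler.uminus)
  obtain \<rho>0 c where \<rho>0: "0 < \<rho>0" and c: "0 < c"
    and nb: "\<And>v. norm (v - y 0) \<le> \<rho>0 \<Longrightarrow> v$2 < 0 \<and> c \<le> ?R v $ 1"
    using Theta_neighbourhood[OF y0, of a b] by blast
  define \<rho> where "\<rho> = min \<rho>0 \<epsilon>"
  have \<rho>: "0 < \<rho>" "\<rho> \<le> \<rho>0" "\<rho> \<le> \<epsilon>" using \<rho>0 \<epsilon> by (auto simp: \<rho>_def)
  \<comment> \<open>The crossing may occur after backward time slightly more than \<open>s\<close>,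
    so the reversed orbit is continued beyond \<open>y 0\<close>.\<close>
  obtain \<kappa>0 z where \<kappa>0: "0 < \<kappa>0" and z: "ode_solution (\<lambda>_. ?B) z {0..s + \<kappa>0}"
    and zy: "\<And>t. t \<in> {0..s} \<Longrightarrow> z t = y (s - t)"
    using backward.solution_extend[OF ode_solution_reverse[OF y order_refl]] s by (metis less_imp_le)
  have zs: "z s = y 0" "z 0 = y s" using zy s by auto
  obtain d where d: "0 < d" and near: "\<And>t. \<lbrakk>t \<in> {0..s + \<kappa>0}; \<bar>t - s\<bar> < d\<rbrakk> \<Longrightarrow> norm (z t - z s) < \<rho> / 2"
    using continuous_on_near[OF ode_solution_continuous[OF z], of s "\<rho> / 2"] s \<kappa>0 \<rho> by auto
  define \<kappa> where "\<kappa> = min (min \<kappa>0 s) (min d \<epsilon>) / 2"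
  have \<kappa>: "0 < \<kappa>" "\<kappa> < \<kappa>0" "\<kappa> < s" "\<kappa> < d" "\<kappa> < \<epsilon>"
    using \<kappa>0 s d \<epsilon> by (auto simp: \<kappa>_def)
  let ?S = "s + \<kappa>"
  have z': "ode_solution (\<lambda>_. ?B) z {0..?S}" by (rule ode_solution_subset[OF z]) (use \<kappa> in auto)
  \<comment> \<open>This is the continued orbit in forward time with the clock advanced by \<kappa>,
    so \<open>v \<kappa> = y 0\<close>. The interval [0, 2 * \<kappa>] surrounds the
    crossing.\<close>
  define v where "v t = z (?S - t)" for t
  have v: "ode_solution (\<lambda>_. ?R) v {0..?S}"
    using ode_solution_reverse[OF z' order_refl] unfolding v_def[abs_def] by simp
  have vpo: "pseudo_orbit ?R 0 v ?S" by (rule pseudo_orbit_of_exact_solution[OF v rossler.continuous])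
  have vnear: "norm (v t - y 0) < \<rho> / 2" if "t \<in> {0..2 * \<kappa>}" for t
    using near[of "?S - t"] that \<kappa> zs by (auto simp: v_def)
  have vR: "c \<le> ?R (v t) $ 1" if "t \<in> {0..2 * \<kappa>}" for t
    using nb[of "v t"] vnear[OF that] \<rho> by auto
  have v\<kappa>: "v \<kappa> $ 1 = 0" using zs y0 by (simp add: v_def Theta_def)
  have v0: "v 0 $ 1 < 0" and v2: "0 < v (2 * \<kappa>) $ 1"
    using pseudo_orbit_increase[OF vpo rossler.continuous c, of 0 \<kappa>]
      pseudo_orbit_increase[OF vpo rossler.continuous c, of \<kappa> "2 * \<kappa>"] vR v\<kappa> \<kappa> by auto
  \<comment> \<open>The last two bounds preserve the signs of the first coordinate at times 0 and 2
    * \<kappa>; the bound 1 keeps the neighbouring orbit in the ball of radius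
    \<open>M0\<close>.\<close>
  define \<epsilon>' where "\<epsilon>' = min (\<rho> / 2) (min 1 (min (- v 0 $ 1) (v (2 * \<kappa>) $ 1)))"
  have \<epsilon>': "0 < \<epsilon>'" "\<epsilon>' \<le> \<rho> / 2" "\<epsilon>' \<le> 1" "\<epsilon>' \<le> - v 0 $ 1" "\<epsilon>' \<le> v (2 * \<kappa>) $ 1"
    using \<rho> v0 v2 by (auto simp: \<epsilon>'_def)
  have S0: "0 \<le> ?S" and S1: "0 < ?S" using s \<kappa> by simp_all
  obtain M0 \<delta> where M0: "0 \<le> M0" "\<And>t. t \<in> {0..?S} \<Longrightarrow> norm (z t) + 1 \<le> M0"
    and \<delta>: "0 < \<delta>" and sh: "shadowed ?B M0 \<delta> \<epsilon>' z ?S"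
    using backward.stability[OF z' S0] \<epsilon>'(1) by blast
  obtain q where q: "q \<in> Theta" "dist q (y s) < \<delta>"
    using ys \<delta> unfolding closure_approachable by blast
  obtain V where V: "\<And>v. norm ((?B \<circ> trunc M0) v) \<le> V"
    using bounded_comp_trunc[OF backward.continuous M0(1)] by blast
  obtain x where x0: "x 0 = q" and x: "ode_solution (\<lambda>_. ?B \<circ> trunc M0) x {0..?S}"
    by (rule peano[OF backward.continuous_comp_trunc[OF M0(1)] V S1])
  have "pseudo_orbit (?B \<circ> trunc M0) 0 x ?S"
    by (rule pseudo_orbit_of_exact_solution[OF x backward.continuous_comp_trunc[OF M0(1)]])
  then have "pseudo_orbit (?B \<circ> trunc M0) \<delta> x ?S" by (rule pseudo_orbit_mono) (use \<delta> in simp)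
  from shadowedD[OF sh order_refl order_refl this]
  have close: "norm (x t - z t) < \<epsilon>'" if "t \<in> {0..?S}" for t
    using q that x0 zs by (simp add: dist_norm)
  have "norm (x t) \<le> M0" if "t \<in> {0..?S}" for t
    using close[OF that] M0(2)[OF that] \<epsilon>'(3) norm_triangle_ineq2[of "x t" "z t"] by linarith
  then have "ode_solution (\<lambda>_. ?B) x {0..?S}"
    by (intro ode_solution_cong[OF x]) (simp add: trunc_eq)
  from ode_solution_reverse[OF this order_refl]
  have xr: "ode_solution (\<lambda>_. ?R) (\<lambda>t. x (?S - t)) {0..?S}" by simp
  have closer: "norm (x (?S - t) - v t) < \<epsilon>'" if "t \<in> {0..?S}" for t
    using close[of "?S - t"] that by (simp add: v_def)
  have comp: "\<bar>x (?S - t) $ 1 - v t $ 1\<bar> < \<epsilon>'" if "t \<in> {0..?S}" for t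
    using le_less_trans[OF component_le_norm_cart closer[OF that], of 1] by simp
  have "\<exists>t\<ge>0. t \<le> 2 * \<kappa> \<and> x (?S - t) $ 1 = 0"
  proof (rule IVT')
    show "x (?S - 0) $ 1 \<le> 0" using comp[of 0] \<epsilon>' S0 by auto
    show "0 \<le> x (?S - 2 * \<kappa>) $ 1" using comp[of "2 * \<kappa>"] \<epsilon>' \<kappa> by auto
    show "continuous_on {0..2 * \<kappa>} (\<lambda>t. x (?S - t) $ 1)"
      using \<kappa> by (intro continuous_intros continuous_on_subset[OF ode_solution_continuous[OF xr]]) auto
  qed (use \<kappa> in simp)
  then obtain \<theta> where \<theta>: "0 \<le> \<theta>" "\<theta> \<le> 2 * \<kappa>" "x (?S - \<theta>) $ 1 = 0" by blast
  have w: "norm (x (?S - \<theta>) - y 0) < \<rho>"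
  proof -
    have "norm (x (?S - \<theta>) - y 0) \<le> norm (x (?S - \<theta>) - v \<theta>) + norm (v \<theta> - y 0)"
      using norm_triangle_ineq[of "x (?S - \<theta>) - v \<theta>" "v \<theta> - y 0"] by simp
    then show ?thesis using closer[of \<theta>] vnear[of \<theta>] \<theta> \<kappa> \<epsilon>' by auto
  qed
  show ?thesis
  \<comment> \<open>Resetting the clock to 0 at the crossing time \<theta> makes the orbit start in
    \<open>Theta\<close>; it then needs \<open>?S - \<theta>\<close> to reach
    \<open>q\<close>.\<close>
  proof (rule that[of "\<lambda>t. x (?S - (t - (- \<theta>)))" "?S - \<theta>"])
    have "ode_solution (\<lambda>_. ?R) (\<lambda>t. x (?S - (t - (- \<theta>)))) {- \<theta>..- \<theta> + ?S}"
      using ode_solution_shift[OF xr, of "\<lambda>_. ?R" "- \<theta>"] by simp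
    then show "ode_solution (\<lambda>_. ?R) (\<lambda>t. x (?S - (t - (- \<theta>)))) {0..?S - \<theta>}"
      by (rule ode_solution_subset) (use \<theta> in auto)
    show "x (?S - (0 - (- \<theta>))) \<in> Theta"
      using nb[of "x (?S - \<theta>)"] w \<theta>(3) \<rho> c by (auto simp: Theta_iff[of _ a b])
    show "norm (x (?S - (0 - (- \<theta>))) - y 0) < \<epsilon>" using w \<rho> by simp
    show "x (?S - (?S - \<theta> - (- \<theta>))) \<in> Theta" using q x0 by simp
    show "0 < ?S - \<theta>" "?S - \<theta> < s + \<epsilon>" using \<theta> \<kappa> by auto
  qed
qed

lemma norm_from_plane_diff: "norm (from_plane v - from_plane w) = norm (v - w)"
  by (simp add: from_plane_def norm_vec_def L2_set_def sum_3 sum_2)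

lemma from_plane_to_plane: "v$1 = 0 \<Longrightarrow> from_plane (to_plane v) = v"
  by (simp add: from_plane_def to_plane_def vec_eq_iff forall_3)

lemma to_plane_from_plane [simp]: "to_plane (from_plane v) = v"
  by (simp add: from_plane_def to_plane_def vec_eq_iff forall_2)

lemma norm_to_plane_diff: "v$1 = 0 \<Longrightarrow> w$1 = 0 \<Longrightarrow> norm (to_plane v - to_plane w) = norm (v - w)"
  by (metis norm_from_plane_diff from_plane_to_plane)

text \<open>
  If the orbit touched the boundary of \<open>Theta\<close>, then flowing back from nearby points of \<open>Theta\<close>
  would give initial points close to \<open>y 0\<close> that return too early for the Poincare map to be
  continuous.
\<close>

lemma orbit_avoids_closure_Theta:
  assumes U: "open U" "v0 \<in> U" and dom: "from_plane ` U \<subseteq> poincare_domain a b"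
    and cont: "continuous_on U (plane_poincare a b)"
    and y: "ode_solution (\<lambda>_. rossler a b) y {0..\<sigma>}" "first_hit y \<sigma>" and y0: "y 0 = from_plane v0"
    and s: "0 < s" "s < \<sigma>"
  shows "y s \<notin> closure Theta"
proof
  assume touch: "y s \<in> closure Theta"
  let ?R = "rossler a b"
  have w0: "y 0 \<in> Theta" using dom U(2) y0 by (auto simp: poincare_domain_def)
  have y\<sigma>: "y \<sigma> \<in> Theta" and before: "\<And>t. \<lbrakk>0 < t; t < \<sigma>\<rbrakk> \<Longrightarrow> y t \<notin> Theta"
    using y(2) by (auto simp: first_hit_def)
  have P0: "poincare a b (y 0) = y \<sigma>" by (rule poincare_eq[OF y w0])
  note cy = ode_solution_continuous[OF y(1)]
  define s' where "s' = (s + \<sigma>) / 2"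
  have s': "s < s'" "s' < \<sigma>" using s by (auto simp: s'_def)
  obtain \<rho> c where \<rho>: "0 < \<rho>" and c: "0 < c"
    and nb: "\<And>v. norm (v - y 0) \<le> \<rho> \<Longrightarrow> v$2 < 0 \<and> c \<le> ?R v $ 1"
    using Theta_neighbourhood[OF w0, of a b] by blast
  obtain d where d: "0 < d" and near: "\<And>t. \<lbrakk>t \<in> {0..\<sigma>}; \<bar>t - 0\<bar> < d\<rbrakk> \<Longrightarrow> norm (y t - y 0) < \<rho> / 2"
    using continuous_on_near[OF cy, of 0 "\<rho> / 2"] s \<rho> by auto
  define \<kappa> where "\<kappa> = min d s / 2"
  have \<kappa>: "0 < \<kappa>" "\<kappa> < d" "\<kappa> < s" using d s by (auto simp: \<kappa>_def)
  \<comment> \<open>During [\<kappa>, s'] the orbit keeps at least the distance \<open>m\<close>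
    from its return point. A neighbouring orbit that returns in this time has its image at distance
    more than m / 2 from that of \<open>y 0\<close>, which continuity forbids.\<close>
  obtain \<tau> where \<tau>: "\<tau> \<in> {\<kappa>..s'}" and min: "\<And>t. t \<in> {\<kappa>..s'} \<Longrightarrow> norm (y \<tau> - y \<sigma>) \<le> norm (y t - y \<sigma>)"
    using continuous_attains_inf[of "{\<kappa>..s'}" "\<lambda>t. norm (y t - y \<sigma>)"] \<kappa> s s'
    by (force intro!: continuous_intros continuous_on_subset[OF cy])
  define m where "m = norm (y \<tau> - y \<sigma>)"
  have "y \<tau> \<noteq> y \<sigma>" using before[of \<tau>] y\<sigma> \<tau> \<kappa> s' by auto
  then have m: "0 < m" by (simp add: m_def)
  have "isCont (plane_poincare a b) v0" using cont U by (simp add: continuous_on_eq_continuous_at)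
  then obtain \<eta>1 where \<eta>1: "0 < \<eta>1" "\<And>v. norm (v - v0) < \<eta>1 \<Longrightarrow>
      norm (plane_poincare a b v - plane_poincare a b v0) < m / 2"
    unfolding continuous_at_eps_delta dist_norm using m by (meson half_gt_zero)
  obtain \<eta>2 where \<eta>2: "0 < \<eta>2" "ball v0 \<eta>2 \<subseteq> U" using U open_contains_ball by blast
  have s'0: "0 \<le> s'" using s s' by simp
  have y': "ode_solution (\<lambda>_. ?R) y {0..s'}" by (rule ode_solution_subset[OF y(1)]) (use s' in auto)
  obtain M0 \<delta> where \<delta>: "0 < \<delta>" and sh: "shadowed ?R M0 \<delta> (min (\<rho> / 2) (m / 2)) y s'"
    using rossler.stability[OF y' s'0] \<rho> m by (metis half_gt_zero min_less_iff_conj)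
  define \<epsilon> where "\<epsilon> = min (min \<delta> (s' - s)) (min \<eta>1 \<eta>2)"
  have \<epsilon>: "0 < \<epsilon>" "\<epsilon> \<le> \<delta>" "\<epsilon> \<le> s' - s" "\<epsilon> \<le> \<eta>1" "\<epsilon> \<le> \<eta>2"
    using \<delta> s' \<eta>1 \<eta>2 by (auto simp: \<epsilon>_def)
  have ys: "ode_solution (\<lambda>_. ?R) y {0..s}" by (rule ode_solution_subset[OF y(1)]) (use s in auto)
  obtain u r where u: "ode_solution (\<lambda>_. ?R) u {0..r}" "u 0 \<in> Theta" "norm (u 0 - y 0) < \<epsilon>"
    and r: "u r \<in> Theta" "0 < r" "r < s + \<epsilon>"
    by (rule closure_Theta_hit_by_near_orbit[OF ys s(1) w0 touch \<epsilon>(1)])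
  define v where "v = to_plane (u 0)"
  have u0: "u 0 = from_plane v" using u(2) by (simp add: v_def from_plane_to_plane Theta_def)
  have v: "norm (v - v0) < \<epsilon>" using u(3) by (simp add: u0 y0 norm_from_plane_diff)
  then have "v \<in> U" using \<eta>2 \<epsilon> by (auto simp: dist_norm norm_minus_commute)
  then have "u 0 \<in> poincare_domain a b" using dom u0 by auto
  then obtain x \<tau>' where x: "ode_solution (\<lambda>_. ?R) x {0..\<tau>'}" "x 0 = u 0" "first_hit x \<tau>'"
    and Px: "poincare a b (u 0) = x \<tau>'"
    by (rule poincare_orbit)
  have le: "\<tau>' \<le> r"
  proof (rule ccontr)
    assume "\<not> \<tau>' \<le> r"
    then have lt: "r < \<tau>'" by simp
    have "ode_solution (\<lambda>_. ?R) x {0..r}" by (rule ode_solution_subset[OF x(1)]) (use lt in auto)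
    from rossler.solution_unique[OF this u(1) x(2), of r] have "x r = u r" using r by simp
    then show False using r x(3) lt by (auto simp: first_hit_def)
  qed
  have \<tau>'0: "0 < \<tau>'" and x\<tau>: "x \<tau>' \<in> Theta" using x(3) by (auto simp: first_hit_def)
  have "ode_solution (\<lambda>_. ?R) u {0..\<tau>'}" by (rule ode_solution_subset[OF u(1)]) (use le in auto)
  from rossler.solution_unique[OF x(1) this x(2), of \<tau>'] have xu: "x \<tau>' = u \<tau>'" using \<tau>'0 by simp
  have close: "norm (u t - y t) < min (\<rho> / 2) (m / 2)" if "t \<in> {0..r}" for t
    using u(3) \<epsilon> r s' that by (intro rossler.shadowed_solution[OF sh \<delta> u(1)]) auto
  show False
  \<comment> \<open>Before \<kappa> the first coordinate of the neighbouring orbit has only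
    increased from 0, so no return is possible; a later return falls into the interval controlled by
    \<open>m\<close>.\<close>
  proof (cases "\<tau>' \<le> \<kappa>")
    case True
    have "c \<le> ?R (u t) $ 1" if t: "t \<in> {0..\<tau>'}" for t
    proof -
      have "norm (u t - y 0) \<le> norm (u t - y t) + norm (y t - y 0)"
        using norm_triangle_ineq[of "u t - y t" "y t - y 0"] by simp
      also have "\<dots> \<le> \<rho>" using close[of t] near[of t] t True le \<kappa> s by auto
      finally show ?thesis using nb by blast
    qed
    then have "u 0 $ 1 < u \<tau>' $ 1"
      using le \<tau>'0 by (intro pseudo_orbit_increase[OF pseudo_orbit_of_exact_solution[OF u(1)
        rossler.continuous] rossler.continuous c]) auto
    then show False using u(2) x\<tau> xu by (simp add: Theta_def)
  next
    case False
    have "norm (plane_poincare a b v - plane_poincare a b v0) < m / 2" using \<eta>1(2) v \<epsilon> by simp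
    then have "norm (u \<tau>' - y \<sigma>) < m / 2"
      using x\<tau> y\<sigma> xu P0 Px
      by (simp add: plane_poincare_def u0[symmetric] y0[symmetric] norm_to_plane_diff Theta_def)
    moreover have "m \<le> norm (y \<tau>' - y \<sigma>)"
      unfolding m_def using False le r \<epsilon> by (intro min) auto
    moreover have "norm (y \<tau>' - y \<sigma>) \<le> norm (u \<tau>' - y \<tau>') + norm (u \<tau>' - y \<sigma>)"
      using norm_triangle_ineq[of "y \<tau>' - u \<tau>'" "u \<tau>' - y \<sigma>"] by (simp add: norm_minus_commute)
    ultimately show False using close[of \<tau>'] le \<tau>'0 by auto
  qed
qed

section \<open>Uniform return windows\<close>

text \<open>The times \<alpha> and \<beta> will be common to all curves that start near a given
  point, which makes their return times comparable. The closure of \<open>Theta\<close> is avoided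
  up to \<alpha>, and monotonicity of the first coordinate makes the crossing afterwards
  unique.\<close>

definition window ::
    "real \<Rightarrow> real \<Rightarrow> real \<Rightarrow> real^3 \<Rightarrow> (real \<Rightarrow> real^3) \<Rightarrow> real \<Rightarrow> real \<Rightarrow> bool" where
  "window a b \<eta> p x \<alpha> \<beta> \<longleftrightarrow> continuous_on {0..\<beta>} x \<and>
     (\<forall>t. 0 < t \<and> t \<le> \<alpha> \<longrightarrow> x t \<notin> closure Theta) \<and> x \<alpha> $ 1 < 0 \<and> 0 < x \<beta> $ 1 \<and>
     (\<forall>s t. \<alpha> \<le> s \<and> s < t \<and> t \<le> \<beta> \<longrightarrow> x s $ 1 < x t $ 1) \<and>
     (\<forall>t\<in>{\<alpha>..\<beta>}. x t $ 2 < 0 \<and> 0 < rossler a b (x t) $ 1 \<and> norm (x t - p) < \<eta>)"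

definition return_time :: "(real \<Rightarrow> real^3) \<Rightarrow> real" where
  "return_time x = (THE t. first_hit x t)"

lemma return_time_eq: "first_hit x t \<Longrightarrow> return_time x = t"
  unfolding return_time_def using first_hit_unique by blast

lemma window_mono:
  "\<lbrakk>window a b \<eta> p x \<alpha> \<beta>; \<alpha> \<le> s; s < t; t \<le> \<beta>\<rbrakk> \<Longrightarrow> x s $ 1 < x t $ 1"
  unfolding window_def by blast

lemma window_return_time:
  assumes w: "window a b \<eta> p x \<alpha> \<beta>" and ab: "0 < \<alpha>" "\<alpha> < \<beta>"
  shows "first_hit x (return_time x)" "\<alpha> < return_time x" "return_time x < \<beta>"
    "x (return_time x) $ 1 = 0"
proof -
  have "\<exists>t\<ge>\<alpha>. t \<le> \<beta> \<and> x t $ 1 = 0"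
  proof (rule IVT')
    show "continuous_on {\<alpha>..\<beta>} (\<lambda>t. x t $ 1)"
      using w ab by (auto simp: window_def intro!: continuous_intros elim: continuous_on_subset)
  qed (use w ab in \<open>auto simp: window_def\<close>)
  then obtain t where t: "\<alpha> \<le> t" "t \<le> \<beta>" "x t $ 1 = 0" by blast
  have t': "\<alpha> < t" "t < \<beta>" using t w by (auto simp: window_def le_less)
  have "x t \<in> Theta" using w t by (auto simp: Theta_iff[of _ a b] window_def)
  moreover have "x s \<notin> Theta" if s: "0 < s" "s < t" for s
  proof (cases "s \<le> \<alpha>")
    case True
    then show ?thesis using w s closure_subset[of Theta] by (auto simp: window_def)
  next
    case False
    then have "x s $ 1 < x t $ 1" using s t by (intro window_mono[OF w]) auto
    then show ?thesis using t by (auto simp: Theta_def)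
  qed
  ultimately have hit: "first_hit x t" using t' ab by (auto simp: first_hit_def)
  show "first_hit x (return_time x)" "\<alpha> < return_time x" "return_time x < \<beta>" "x (return_time x) $ 1 = 0"
    unfolding return_time_eq[OF hit] using hit t t' by auto
qed

text \<open>As the first coordinate increases throughout the window, its signs at two times around
  the limiting return time confine the nearby return times. Pointwise convergence at these two times
  is enough.\<close>

lemma return_time_tendsto:
  assumes X: "\<forall>\<^sub>F i in F. window a b \<eta> p (X i) \<alpha> \<beta>" and x: "window a b \<eta> p x \<alpha> \<beta>"
    and ab: "0 < \<alpha>" "\<alpha> < \<beta>" and lim: "\<And>t. t \<in> {\<alpha>..\<beta>} \<Longrightarrow> ((\<lambda>i. X i t) \<longlongrightarrow> x t) F"
  shows "((\<lambda>i. return_time (X i)) \<longlongrightarrow> return_time x) F"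
proof (rule tendstoI)
  fix e :: real assume e: "0 < e"
  let ?t = "return_time x"
  note t = window_return_time[OF x ab]
  define t1 where "t1 = max \<alpha> (?t - e / 2)"
  define t2 where "t2 = min \<beta> (?t + e / 2)"
  have t12: "\<alpha> \<le> t1" "t1 < ?t" "?t < t2" "t2 \<le> \<beta>" "?t - e < t1" "t2 < ?t + e"
    using t e by (auto simp: t1_def t2_def)
  have "x t1 $ 1 < 0" "0 < x t2 $ 1"
    using window_mono[OF x, of t1 ?t] window_mono[OF x, of ?t t2] t12 t by auto
  moreover have "((\<lambda>i. X i t1 $ 1) \<longlongrightarrow> x t1 $ 1) F" "((\<lambda>i. X i t2 $ 1) \<longlongrightarrow> x t2 $ 1) F"
    using t12 by (auto intro!: tendsto_vec_nth lim)
  ultimately have "\<forall>\<^sub>F i in F. X i t1 $ 1 < 0" "\<forall>\<^sub>F i in F. 0 < X i t2 $ 1"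
    by (auto dest: order_tendstoD)
  with X show "\<forall>\<^sub>F i in F. dist (return_time (X i)) ?t < e"
  proof eventually_elim
    case (elim i)
    note ti = window_return_time[OF elim(1) ab]
    have mono: "X i r $ 1 < X i s $ 1" if "\<alpha> \<le> r" "r < s" "s \<le> \<beta>" for r s
      by (rule window_mono[OF elim(1) that])
    have "t1 < return_time (X i)"
    proof (rule ccontr)
      assume "\<not> t1 < return_time (X i)"
      then show False using mono[of "return_time (X i)" t1] ti elim(2) t12 by (cases "return_time (X i) = t1") auto
    qed
    moreover have "return_time (X i) < t2"
    proof (rule ccontr)
      assume "\<not> return_time (X i) < t2"
      then show False using mono[of t2 "return_time (X i)"] ti elim(3) t12 by (cases "return_time (X i) = t2") auto
    qed
    ultimately show ?case using t12 by (auto simp: dist_real_def)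
  qed
qed

text \<open>Three stretches of time need different arguments. Near the start the first coordinate
  increases away from 0; on the middle stretch the orbit has positive distance from the closure of
  \<open>Theta\<close> by compactness; near the return the crossing is transversal. Each property
  tolerates a small error.\<close>

lemma local_window:
  assumes y: "ode_solution (\<lambda>_. rossler a b) y {0..\<sigma>}" "y 0 \<in> Theta" "first_hit y \<sigma>"
    and avoid: "\<And>s. \<lbrakk>0 < s; s < \<sigma>\<rbrakk> \<Longrightarrow> y s \<notin> closure Theta" and \<eta>: "0 < \<eta>"
  shows "\<exists>M0\<ge>0. \<exists>\<delta>>0. \<exists>\<alpha> \<beta>. 0 < \<alpha> \<and> \<alpha> < \<beta> \<and> (\<forall>M\<ge>M0. \<forall>S\<ge>\<beta>. \<forall>x.
    pseudo_orbit (rossler a b \<circ> trunc M) \<delta> x S \<longrightarrow> norm (x 0 - y 0) < \<delta> \<longrightarrow> x 0 \<in> Theta \<longrightarrow>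
    window a b \<eta> (y \<sigma>) x \<alpha> \<beta> \<and> (\<forall>t\<in>{0..\<beta>}. norm (x t) \<le> M0))"
proof -
  let ?R = "rossler a b"
  have \<sigma>: "0 < \<sigma>" "y \<sigma> \<in> Theta" using y(3) by (auto simp: first_hit_def)
  obtain \<rho>1 c1 where \<rho>1: "0 < \<rho>1" "0 < c1"
    and nb1: "\<And>v. norm (v - y \<sigma>) \<le> \<rho>1 \<Longrightarrow> v$2 < 0 \<and> c1 \<le> ?R v $ 1"
    using Theta_neighbourhood[OF \<sigma>(2), of a b] by blast
  obtain \<rho>2 c2 where \<rho>2: "0 < \<rho>2" "0 < c2"
    and nb2: "\<And>v. norm (v - y 0) \<le> \<rho>2 \<Longrightarrow> v$2 < 0 \<and> c2 \<le> ?R v $ 1"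
    using Theta_neighbourhood[OF y(2), of a b] by blast
  define \<rho> where "\<rho> = min \<rho>1 \<eta>"
  have \<rho>: "0 < \<rho>" "\<rho> \<le> \<rho>1" "\<rho> \<le> \<eta>" using \<rho>1 \<eta> by (auto simp: \<rho>_def)
  \<comment> \<open>The window reaches beyond the return time, where \<open>y\<close> itself need
    not be a solution.\<close>
  obtain \<kappa>0 z where \<kappa>0: "0 < \<kappa>0" and z0: "ode_solution (\<lambda>_. ?R) z {0..\<sigma> + \<kappa>0}"
    and zy: "\<And>t. t \<in> {0..\<sigma>} \<Longrightarrow> z t = y t"
    using rossler.solution_extend[OF y(1)] \<sigma> by (metis less_imp_le)
  note cz0 = ode_solution_continuous[OF z0]
  have zs: "z \<sigma> = y \<sigma>" "z 0 = y 0" using zy \<sigma> by auto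
  obtain d1 where d1: "0 < d1"
    and near1: "\<And>t. \<lbrakk>t \<in> {0..\<sigma> + \<kappa>0}; \<bar>t - \<sigma>\<bar> < d1\<rbrakk> \<Longrightarrow> norm (z t - z \<sigma>) < \<rho> / 2"
    using continuous_on_near[OF cz0, of \<sigma> "\<rho> / 2"] \<sigma> \<kappa>0 \<rho> by auto
  obtain d2 where d2: "0 < d2"
    and near2: "\<And>t. \<lbrakk>t \<in> {0..\<sigma> + \<kappa>0}; \<bar>t - 0\<bar> < d2\<rbrakk> \<Longrightarrow> norm (z t - z 0) < \<rho>2 / 2"
    using continuous_on_near[OF cz0, of 0 "\<rho>2 / 2"] \<sigma> \<kappa>0 \<rho>2 by auto
  define \<kappa> where "\<kappa> = min (min \<kappa>0 \<sigma>) d1 / 2"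
  have \<kappa>: "0 < \<kappa>" "\<kappa> < \<kappa>0" "\<kappa> < \<sigma>" "\<kappa> < d1" using \<kappa>0 \<sigma> d1 by (auto simp: \<kappa>_def)
  define \<alpha> where "\<alpha> = \<sigma> - \<kappa>"
  define \<beta> where "\<beta> = \<sigma> + \<kappa>"
  have ab: "0 < \<alpha>" "\<alpha> < \<beta>" "\<alpha> < \<sigma>" "\<sigma> < \<beta>" "\<beta> \<le> \<sigma> + \<kappa>0" using \<kappa> by (auto simp: \<alpha>_def \<beta>_def)
  define \<kappa>2 where "\<kappa>2 = min d2 \<alpha> / 2"
  have \<kappa>2: "0 < \<kappa>2" "\<kappa>2 < d2" "\<kappa>2 < \<alpha>" using d2 ab by (auto simp: \<kappa>2_def)
  have z: "ode_solution (\<lambda>_. ?R) z {0..\<beta>}" by (rule ode_solution_subset[OF z0]) (use ab in auto)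
  have zpo: "pseudo_orbit ?R 0 z \<beta>" by (rule pseudo_orbit_of_exact_solution[OF z rossler.continuous])
  have znear1: "norm (z t - y \<sigma>) < \<rho> / 2" if "t \<in> {\<alpha>..\<beta>}" for t
    using near1[of t] that ab \<kappa> zs by (auto simp: \<alpha>_def \<beta>_def)
  have zR: "c1 \<le> ?R (z t) $ 1" if "t \<in> {\<alpha>..\<beta>}" for t
    using nb1[of "z t"] znear1[OF that] \<rho> by auto
  have znear2: "norm (z t - y 0) < \<rho>2 / 2" if "t \<in> {0..\<kappa>2}" for t
    using near2[of t] that ab \<kappa>2 zs by auto
  have z1: "z \<sigma> $ 1 = 0" using zs \<sigma> by (simp add: Theta_def)
  have z\<alpha>: "z \<alpha> $ 1 < 0"
    using pseudo_orbit_increase[OF zpo rossler.continuous \<rho>1(2), of \<alpha> \<sigma>] zR z1 ab by auto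
  have z\<beta>: "0 < z \<beta> $ 1"
    using pseudo_orbit_increase[OF zpo rossler.continuous \<rho>1(2), of \<sigma> \<beta>] zR z1 ab by auto
  have "compact (z ` {\<kappa>2..\<alpha>})"
    using ab \<kappa>2 by (intro compact_continuous_image continuous_on_subset[OF cz0]) auto
  moreover have "z ` {\<kappa>2..\<alpha>} \<inter> closure Theta = {}" using avoid zy ab \<kappa>2 by auto
  ultimately obtain \<rho>3 where \<rho>3: "0 < \<rho>3"
    and far: "\<And>v w. \<lbrakk>v \<in> z ` {\<kappa>2..\<alpha>}; w \<in> closure Theta\<rbrakk> \<Longrightarrow> \<rho>3 \<le> dist v w"
    using separate_compact_closed[of "z ` {\<kappa>2..\<alpha>}" "closure Theta"] by auto
  \<comment> \<open>The bounds keep a shadowing curve, in this order: in the two transversality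
    balls, off the closure of \<open>Theta\<close>, inside the ball of radius \<open>M0\<close>, and
    on the correct sides of the plane at \<alpha> and \<beta>.\<close>
  define \<epsilon> where "\<epsilon> = min (min (\<rho> / 2) (\<rho>2 / 2)) (min (min \<rho>3 1) (min (- z \<alpha> $ 1) (z \<beta> $ 1)))"
  have \<epsilon>: "0 < \<epsilon>" "\<epsilon> \<le> \<rho> / 2" "\<epsilon> \<le> \<rho>2 / 2" "\<epsilon> \<le> \<rho>3" "\<epsilon> \<le> 1" "\<epsilon> \<le> - z \<alpha> $ 1" "\<epsilon> \<le> z \<beta> $ 1"
    using \<rho> \<rho>2 \<rho>3 z\<alpha> z\<beta> by (auto simp: \<epsilon>_def)
  have \<beta>0: "0 \<le> \<beta>" using ab by simp
  obtain M0 \<delta>1 where M0: "0 \<le> M0" "\<And>t. t \<in> {0..\<beta>} \<Longrightarrow> norm (z t) + 1 \<le> M0"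
    and \<delta>1: "0 < \<delta>1" and sh: "shadowed ?R M0 \<delta>1 \<epsilon> z \<beta>"
    using rossler.stability[OF z \<beta>0] \<epsilon>(1) by blast
  \<comment> \<open>Besides shadowing, the error has to stay below both crossing speeds, as
    \<open>pseudo_orbit_increase\<close> demands.\<close>
  define \<delta> where "\<delta> = min \<delta>1 (min c1 c2 / 2)"
  have \<delta>: "0 < \<delta>" "\<delta> \<le> \<delta>1" "\<delta> < c1" "\<delta> < c2" using \<delta>1 \<rho>1 \<rho>2 by (auto simp: \<delta>_def)
  have "window a b \<eta> (y \<sigma>) x \<alpha> \<beta> \<and> (\<forall>t\<in>{0..\<beta>}. norm (x t) \<le> M0)"
    if M: "M0 \<le> M" and S: "\<beta> \<le> S" and x: "pseudo_orbit (?R \<circ> trunc M) \<delta> x S"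
      and x0: "norm (x 0 - y 0) < \<delta>" "x 0 \<in> Theta" for M S x
  proof -
    have close: "norm (x t - z t) < \<epsilon>" if "t \<in> {0..\<beta>}" for t
      using shadowedD[OF sh M order_refl pseudo_orbit_mono[OF pseudo_orbit_subset[OF x S] \<delta>(2)]]
        that x0 \<delta> zs by auto
    have bound: "norm (x t) \<le> M0" if "t \<in> {0..\<beta>}" for t
      using close[OF that] M0(2)[OF that] \<epsilon>(5) norm_triangle_ineq2[of "x t" "z t"] by linarith
    have po: "pseudo_orbit ?R \<delta> x \<beta>"
      by (rule pseudo_orbit_cong[OF pseudo_orbit_subset[OF x S]])
        (use bound M in \<open>auto simp: trunc_eq order_trans[OF bound M]\<close>)
    have comp: "\<bar>x t $ 1 - z t $ 1\<bar> < \<epsilon>" if "t \<in> {0..\<beta>}" for t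
      using le_less_trans[OF component_le_norm_cart close[OF that], of 1] by simp
    have xnear1: "norm (x t - y \<sigma>) < \<rho>" if "t \<in> {\<alpha>..\<beta>}" for t
      using norm_triangle_ineq[of "x t - z t" "z t - y \<sigma>"] close[of t] znear1[OF that] that ab \<epsilon> by auto
    have xR: "c1 \<le> ?R (x t) $ 1" if "t \<in> {\<alpha>..\<beta>}" for t
      using nb1[of "x t"] xnear1[OF that] \<rho> by auto
    have xnear2: "norm (x t - y 0) < \<rho>2" if "t \<in> {0..\<kappa>2}" for t
      using norm_triangle_ineq[of "x t - z t" "z t - y 0"] close[of t] znear2[OF that] that ab \<kappa>2 \<epsilon> by auto
    have "x t \<notin> closure Theta" if t: "0 < t" "t \<le> \<alpha>" for t
    proof (cases "t \<le> \<kappa>2")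
      case True
      have "c2 \<le> ?R (x r) $ 1" if "r \<in> {0..t}" for r
        using nb2[of "x r"] xnear2[of r] that True by auto
      then have "x 0 $ 1 < x t $ 1"
        using t ab by (intro pseudo_orbit_increase[OF po rossler.continuous \<delta>(4)]) auto
      then show ?thesis using closure_Theta[of "x t"] x0(2) by (auto simp: Theta_def)
    next
      case False
      show ?thesis
      proof
        assume "x t \<in> closure Theta"
        then have "\<rho>3 \<le> dist (z t) (x t)" using far False t by auto
        then show False using close[of t] t ab \<epsilon> by (auto simp: dist_norm norm_minus_commute)
      qed
    qed
    moreover have "x \<alpha> $ 1 < 0" "0 < x \<beta> $ 1" using comp[of \<alpha>] comp[of \<beta>] \<epsilon> ab by auto
    moreover have "x s $ 1 < x t $ 1" if "\<alpha> \<le> s" "s < t" "t \<le> \<beta>" for s t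
      using xR that ab by (intro pseudo_orbit_increase[OF po rossler.continuous \<delta>(3)]) auto
    moreover have "x t $ 2 < 0 \<and> 0 < ?R (x t) $ 1 \<and> norm (x t - y \<sigma>) < \<eta>" if "t \<in> {\<alpha>..\<beta>}" for t
      using nb1[of "x t"] xnear1[OF that] \<rho> \<rho>1 by auto
    moreover have "continuous_on {0..\<beta>} x" using pseudo_orbitD(1)[OF po] .
    ultimately show ?thesis using bound by (auto simp: window_def)
  qed
  then show ?thesis using M0(1) \<delta>(1) ab(1,2) by blast
qed

text \<open>A finite cover makes \<open>M\<close>, \<delta>, \<open>S\<close> and \<theta> global.
  The data \<alpha>, \<beta> and \<open>p\<close> stay local, which suffices because continuity of
  the return map is a local matter.\<close>

lemma uniform_window:
  assumes Q: "compact Q" "Q \<subseteq> Theta" and \<eta>: "0 < \<eta>" and P: "continuous_on Q (poincare a b)"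
    and orbit: "\<And>w. w \<in> Q \<Longrightarrow> \<exists>y \<sigma>. ode_solution (\<lambda>_. rossler a b) y {0..\<sigma>} \<and> y 0 = w \<and>
      first_hit y \<sigma> \<and> (\<forall>s. 0 < s \<and> s < \<sigma> \<longrightarrow> y s \<notin> closure Theta)"
  obtains M \<delta> S \<theta> where "0 \<le> M" "0 < \<delta>" "0 < S" "0 < \<theta>"
    and "\<And>w. w \<in> Q \<Longrightarrow> \<exists>\<rho>>0. \<exists>\<alpha> \<beta> p. \<theta> \<le> \<alpha> \<and> \<alpha> < \<beta> \<and> \<beta> \<le> S \<and>
    (\<forall>x. pseudo_orbit (rossler a b \<circ> trunc M) \<delta> x S \<longrightarrow> x 0 \<in> Q \<longrightarrow> norm (x 0 - w) < \<rho> \<longrightarrow>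
      window a b \<eta> p x \<alpha> \<beta> \<and> (\<forall>t\<in>{0..\<beta>}. norm (x t) \<le> M) \<and> norm (p - poincare a b (x 0)) < \<eta>)"
proof -
  let ?R = "rossler a b"
  have "\<exists>M \<delta> r \<alpha> \<beta>. 0 \<le> M \<and> 0 < \<delta> \<and> 0 < r \<and> 0 < \<alpha> \<and> \<alpha> < \<beta> \<and>
      (\<forall>M'\<ge>M. \<forall>S\<ge>\<beta>. \<forall>x. pseudo_orbit (?R \<circ> trunc M') \<delta> x S \<longrightarrow> x 0 \<in> Q \<longrightarrow> norm (x 0 - w) < r \<longrightarrow>
        window a b \<eta> (poincare a b w) x \<alpha> \<beta> \<and> (\<forall>t\<in>{0..\<beta>}. norm (x t) \<le> M) \<and>
        norm (poincare a b w - poincare a b (x 0)) < \<eta>)" if w: "w \<in> Q" for w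
  proof -
    obtain y \<sigma> where y: "ode_solution (\<lambda>_. ?R) y {0..\<sigma>}" "y 0 = w" "first_hit y \<sigma>"
      and avoid: "\<And>s. \<lbrakk>0 < s; s < \<sigma>\<rbrakk> \<Longrightarrow> y s \<notin> closure Theta"
      using orbit[OF w] by blast
    have y0: "y 0 \<in> Theta" using w y(2) Q by auto
    have Pw: "poincare a b w = y \<sigma>" using poincare_eq[OF y(1,3) y0] y(2) by simp
    obtain M \<delta> \<alpha> \<beta> where M: "0 \<le> M" "0 < \<delta>" "0 < \<alpha>" "\<alpha> < \<beta>"
      and win: "\<forall>M'\<ge>M. \<forall>S\<ge>\<beta>. \<forall>x. pseudo_orbit (?R \<circ> trunc M') \<delta> x S \<longrightarrow> norm (x 0 - y 0) < \<delta> \<longrightarrow>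
        x 0 \<in> Theta \<longrightarrow> window a b \<eta> (y \<sigma>) x \<alpha> \<beta> \<and> (\<forall>t\<in>{0..\<beta>}. norm (x t) \<le> M)"
      using local_window[OF y(1) y0 y(3) avoid \<eta>] by blast
    obtain r where r: "0 < r" "\<And>w'. \<lbrakk>w' \<in> Q; dist w' w < r\<rbrakk> \<Longrightarrow> dist (poincare a b w') (poincare a b w) < \<eta>"
      using P w \<eta> unfolding continuous_on_iff by metis
    show ?thesis
    proof (rule exI[of _ M], rule exI[of _ \<delta>], rule exI[of _ "min r \<delta>"], rule exI[of _ \<alpha>], rule exI[of _ \<beta>], intro conjI allI impI)
      fix M' S x assume x: "M \<le> M'" "\<beta> \<le> S" "pseudo_orbit (?R \<circ> trunc M') \<delta> x S" "x 0 \<in> Q" "norm (x 0 - w) < min r \<delta>"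
      have *: "window a b \<eta> (y \<sigma>) x \<alpha> \<beta> \<and> (\<forall>t\<in>{0..\<beta>}. norm (x t) \<le> M)"
        using win[rule_format, OF x(1-3)] x(4,5) Q y(2) by auto
      show "window a b \<eta> (poincare a b w) x \<alpha> \<beta>" using * Pw by simp
      show "\<forall>t\<in>{0..\<beta>}. norm (x t) \<le> M" using * by simp
      show "norm (poincare a b w - poincare a b (x 0)) < \<eta>"
        using r(2)[OF x(4)] x(5) by (simp add: dist_norm norm_minus_commute)
    qed (use M r in auto)
  qed
  then obtain M \<delta> r \<alpha> \<beta> where *: "\<And>w. w \<in> Q \<Longrightarrow> 0 \<le> M w \<and> 0 < \<delta> w \<and> 0 < r w \<and> 0 < \<alpha> w \<and> \<alpha> w < \<beta> w \<and>
      (\<forall>M'\<ge>M w. \<forall>S\<ge>\<beta> w. \<forall>x. pseudo_orbit (?R \<circ> trunc M') (\<delta> w) x S \<longrightarrow> x 0 \<in> Q \<longrightarrow> norm (x 0 - w) < r w \<longrightarrow>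
        window a b \<eta> (poincare a b w) x (\<alpha> w) (\<beta> w) \<and> (\<forall>t\<in>{0..\<beta> w}. norm (x t) \<le> M w) \<and>
        norm (poincare a b w - poincare a b (x 0)) < \<eta>)"
    by metis
  obtain C where C: "C \<subseteq> Q" "finite C" "Q \<subseteq> (\<Union>w\<in>C. ball w (r w))"
  proof (rule compactE_image[OF Q(1), of Q "\<lambda>w. ball w (r w)"])
    show "Q \<subseteq> (\<Union>w\<in>Q. ball w (r w))" using * by force
  qed auto
  \<comment> \<open>The inserted values keep \<open>Max\<close> and \<open>Min\<close> meaningful
    for an empty cover.\<close>
  define M' where "M' = Max (insert 0 (M ` C))"
  define \<delta>' where "\<delta>' = Min (insert 1 (\<delta> ` C))"
  define S' where "S' = Max (insert 1 (\<beta> ` C))"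
  define \<theta>' where "\<theta>' = Min (insert 1 (\<alpha> ` C))"
  have M': "0 \<le> M'" "\<And>w. w \<in> C \<Longrightarrow> M w \<le> M'" using C by (auto simp: M'_def)
  have \<delta>': "0 < \<delta>'" "\<And>w. w \<in> C \<Longrightarrow> \<delta>' \<le> \<delta> w" using C * by (auto simp: \<delta>'_def)
  have S': "1 \<le> S'" "\<And>w. w \<in> C \<Longrightarrow> \<beta> w \<le> S'" using C by (auto simp: S'_def)
  have \<theta>': "0 < \<theta>'" "\<And>w. w \<in> C \<Longrightarrow> \<theta>' \<le> \<alpha> w" using C * by (auto simp: \<theta>'_def)
  have "\<exists>\<rho>>0. \<exists>\<alpha> \<beta> p. \<theta>' \<le> \<alpha> \<and> \<alpha> < \<beta> \<and> \<beta> \<le> S' \<and>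
    (\<forall>x. pseudo_orbit (?R \<circ> trunc M') \<delta>' x S' \<longrightarrow> x 0 \<in> Q \<longrightarrow> norm (x 0 - w) < \<rho> \<longrightarrow>
      window a b \<eta> p x \<alpha> \<beta> \<and> (\<forall>t\<in>{0..\<beta>}. norm (x t) \<le> M') \<and> norm (p - poincare a b (x 0)) < \<eta>)"
    if w: "w \<in> Q" for w
  proof -
    obtain v where v: "v \<in> C" "dist v w < r v" using C w by auto
    then have vQ: "v \<in> Q" using C by auto
    show ?thesis
    proof (rule exI[of _ "r v - dist v w"], rule conjI, use v in simp, rule exI[of _ "\<alpha> v"], rule exI[of _ "\<beta> v"], rule exI[of _ "poincare a b v"], intro conjI allI impI)
      fix x assume x: "pseudo_orbit (?R \<circ> trunc M') \<delta>' x S'" "x 0 \<in> Q" "norm (x 0 - w) < r v - dist v w"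
      have "norm (x 0 - v) < r v"
        using x(3) norm_triangle_ineq[of "x 0 - w" "w - v"] by (simp add: dist_norm norm_minus_commute)
      then have "window a b \<eta> (poincare a b v) x (\<alpha> v) (\<beta> v) \<and> (\<forall>t\<in>{0..\<beta> v}. norm (x t) \<le> M v) \<and>
        norm (poincare a b v - poincare a b (x 0)) < \<eta>"
        using *[OF vQ] M'(2)[OF v(1)] S'(2)[OF v(1)] pseudo_orbit_mono[OF x(1) \<delta>'(2)[OF v(1)]] x(2) by blast
      then show "window a b \<eta> (poincare a b v) x (\<alpha> v) (\<beta> v)" "\<forall>t\<in>{0..\<beta> v}. norm (x t) \<le> M'"
        "norm (poincare a b v - poincare a b (x 0)) < \<eta>"
        using M'(2)[OF v(1)] by (auto intro: order_trans)
    qed (use v \<theta>' S' *[OF vQ] in auto)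
  qed
  note win = this
  have "0 < S'" using S'(1) by simp
  from that[OF M'(1) \<delta>'(1) this \<theta>'(1) win] show ?thesis .
qed

section \<open>Perturbed itineraries\<close>

lemma ode_solution_glue:
  assumes T: "\<And>i. T i < T (Suc i)" and unbounded: "\<And>t. \<exists>i. t < T i"
    and z: "\<And>i. ode_solution F (z i) {T i..T (Suc i)}"
    and eq: "\<And>i. z i (T (Suc i)) = z (Suc i) (T (Suc i))"
  obtains x where "ode_solution F x {T 0..}" "\<And>i t. t \<in> {T i..T (Suc i)} \<Longrightarrow> x t = z i t"
proof -
  have mono: "strict_mono T" using T by (simp add: strict_mono_Suc_iff)
  \<comment> \<open>At a joint the later piece is taken; \<open>eq\<close> says that the earlier one
    agrees with it.\<close>
  define x where "x t = z (LEAST i. t < T (Suc i)) t" for t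
  have x_in: "x t = z i t" if "T i \<le> t" "t < T (Suc i)" for i t
  proof -
    have "(LEAST i. t < T (Suc i)) = i"
    proof (rule Least_equality)
      fix j assume "t < T (Suc j)"
      then have "T i < T (Suc j)" using that by simp
      then show "i \<le> j" using strict_mono_less[OF mono] by simp
    qed (use that in simp)
    then show ?thesis by (simp add: x_def)
  qed
  have xz: "x t = z i t" if "t \<in> {T i..T (Suc i)}" for i t
  proof (cases "t = T (Suc i)")
    case True
    then show ?thesis using x_in[of "Suc i" t] T eq by simp
  qed (use x_in that in auto)
  have sol: "ode_solution F x {T 0..T (Suc n)}" for n
  proof (induction n)
    case 0
    show ?case by (rule ode_solution_transform[OF z xz])
  next
    case (Suc n)
    have "ode_solution F x {T (Suc n)..T (Suc (Suc n))}" by (rule ode_solution_transform[OF z xz])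
    moreover have "T 0 \<le> T (Suc n)" using strict_mono_less_eq[OF mono] by simp
    ultimately have "ode_solution F (\<lambda>t. if t \<le> T (Suc n) then x t else x t) {T 0..T (Suc (Suc n))}"
      using T by (intro ode_solution_join[OF Suc]) (auto intro: less_imp_le)
    then show ?case by simp
  qed
  have "(x has_vector_derivative F t (x t)) (at t within {T 0..})" if t: "t \<in> {T 0..}" for t
  proof -
    obtain i where i: "t < T i" using unbounded by blast
    then have i': "t < T (Suc i)" using T[of i] by simp
    have "at t within {T 0..} = at t within {T 0..T (Suc i)}"
      by (rule at_within_nhd[of t "{..<T (Suc i)}"]) (use i' in auto)
    then show ?thesis using sol[of i] t i' by (simp add: ode_solution_def)
  qed
  then have "ode_solution F x {T 0..}" by (simp add: ode_solution_def)
  then show ?thesis using that xz by blast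
qed

section \<open>The return map of restarted polygons\<close>

locale perturbed_rossler =
  fixes a b M \<delta> S \<theta> \<eta> L V :: real and Q :: "(real^3) set" and e :: "real \<times> (real^3) \<Rightarrow> real^3"
  assumes M: "0 \<le> M" and \<delta>: "0 < \<delta>" and S: "0 < S" and \<theta>: "0 < \<theta>" and Q: "Q \<subseteq> Theta" "closed Q"
    and e: "continuous_on UNIV e" "\<And>p. norm (e p) \<le> \<delta> / 2"
    and L: "L-lipschitz_on UNIV (rossler a b \<circ> trunc M)"
    and V: "\<And>t v. norm ((rossler a b \<circ> trunc M) v + e (t, v)) \<le> V"
    and windows: "\<And>w. w \<in> Q \<Longrightarrow> \<exists>\<rho>>0. \<exists>\<alpha> \<beta> p. \<theta> \<le> \<alpha> \<and> \<alpha> < \<beta> \<and> \<beta> \<le> S \<and>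
      (\<forall>x. pseudo_orbit (rossler a b \<circ> trunc M) \<delta> x S \<longrightarrow> x 0 \<in> Q \<longrightarrow> norm (x 0 - w) < \<rho> \<longrightarrow>
        window a b \<eta> p x \<alpha> \<beta> \<and> (\<forall>t\<in>{0..\<beta>}. norm (x t) \<le> M) \<and> norm (p - poincare a b (x 0)) < \<eta>)"
begin

definition rhs :: "real \<Rightarrow> real^3 \<Rightarrow> real^3" where
  "rhs t v = (rossler a b \<circ> trunc M) v + e (t, v)"

text \<open>The discretisation error of the polygons gets one half of \<delta>; the perturbation has
  already used the other half.\<close>

definition fine_mesh :: "nat \<Rightarrow> bool" where
  "fine_mesh J \<longleftrightarrow> 0 < J \<and> L * V * S / real J \<le> \<delta> / 2"

text \<open>The new polygon depends only on the time and place of the return, not on the position of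
  the return within the old mesh. This turns an itinerary into an iteration.\<close>

definition next_state :: "nat \<Rightarrow> real \<times> (real^3) \<Rightarrow> real \<times> (real^3)" where
  "next_state J p = (let x = euler rhs S J p in (fst p + return_time x, x (return_time x)))"

lemma continuous_rhs: "continuous_on UNIV (\<lambda>(t, v). rhs t v)"
proof -
  have "continuous_on UNIV (\<lambda>q :: real \<times> (real^3). (rossler a b \<circ> trunc M) (snd q))"
    by (rule continuous_on_compose2[OF rossler.continuous_comp_trunc[OF M]]) (auto intro!: continuous_intros)
  from continuous_on_add[OF this e(1)] show ?thesis
    by (simp add: rhs_def case_prod_beta)
qed

lemma norm_rhs_le: "norm (rhs t v) \<le> V"
  using V by (simp add: rhs_def)

lemma euler_pseudo_orbit_\<delta>: "fine_mesh J \<Longrightarrow> pseudo_orbit (rossler a b \<circ> trunc M) \<delta> (euler rhs S J p) S"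
proof -
  assume J: "fine_mesh J"
  have ce: "continuous_on UNIV (\<lambda>(t, v). e (t, v))" using e(1) by (simp add: case_prod_beta)
  have lip: "norm ((rossler a b \<circ> trunc M) u - (rossler a b \<circ> trunc M) v) \<le> L * norm (u - v)" for u v
    using lipschitz_on_normD[OF L] by simp
  have "pseudo_orbit (rossler a b \<circ> trunc M) (\<delta> / 2 + L * V * S / real J)
      (euler (\<lambda>t v. (rossler a b \<circ> trunc M) v + e (t, v)) S J p) S"
    by (rule euler_pseudo_orbit[OF rossler.continuous_comp_trunc[OF M] ce V e(2) lipschitz_on_nonneg[OF L] lip S])
      (use J in \<open>simp add: fine_mesh_def\<close>)
  moreover have "rhs = (\<lambda>t v. (rossler a b \<circ> trunc M) v + e (t, v))"
    by (intro ext) (simp add: rhs_def)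
  moreover have "\<delta> / 2 + L * V * S / real J \<le> \<delta>" using J unfolding fine_mesh_def by linarith
  ultimately show ?thesis using pseudo_orbit_mono by metis
qed

lemma euler_start: "fine_mesh J \<Longrightarrow> euler rhs S J p 0 = snd p"
  using euler_0[OF S] by (simp add: fine_mesh_def)

text \<open>The centre \<open>p\<close> of the window is within \<eta> of the return point and of
  the unperturbed image; hence the bound 2 * \<eta>.\<close>

lemma return_time_bounds:
  assumes x: "pseudo_orbit (rossler a b \<circ> trunc M) \<delta> x S" "x 0 \<in> Q"
  shows "first_hit x (return_time x)" "\<theta> < return_time x" "return_time x < S"
    and "\<And>t. \<lbrakk>0 \<le> t; t \<le> return_time x\<rbrakk> \<Longrightarrow> norm (x t) \<le> M"
    and "norm (x (return_time x) - poincare a b (x 0)) < 2 * \<eta>"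
proof -
  obtain \<rho> \<alpha> \<beta> p where r: "0 < \<rho>" and ab: "\<theta> \<le> \<alpha>" "\<alpha> < \<beta>" "\<beta> \<le> S"
    and win: "\<forall>z. pseudo_orbit (rossler a b \<circ> trunc M) \<delta> z S \<longrightarrow> z 0 \<in> Q \<longrightarrow> norm (z 0 - x 0) < \<rho> \<longrightarrow>
      window a b \<eta> p z \<alpha> \<beta> \<and> (\<forall>t\<in>{0..\<beta>}. norm (z t) \<le> M) \<and> norm (p - poincare a b (z 0)) < \<eta>"
    using windows[OF x(2)] by (elim exE conjE)
  have \<alpha>: "0 < \<alpha>" using ab \<theta> by simp
  have w: "window a b \<eta> p x \<alpha> \<beta>" and bnd: "\<forall>t\<in>{0..\<beta>}. norm (x t) \<le> M"
    and close: "norm (p - poincare a b (x 0)) < \<eta>"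
    using spec[OF win, of x] x r by simp_all
  note t = window_return_time[OF w \<alpha> ab(2)]
  show "first_hit x (return_time x)" "\<theta> < return_time x" "return_time x < S" using t ab by auto
  show "norm (x t) \<le> M" if "0 \<le> t" "t \<le> return_time x" for t
    using bnd that t by auto
  have "norm (x (return_time x) - p) < \<eta>" using w t by (auto simp: window_def)
  with close show "norm (x (return_time x) - poincare a b (x 0)) < 2 * \<eta>"
    using norm_triangle_ineq[of "x (return_time x) - p" "p - poincare a b (x 0)"] by simp
qed

text \<open>The general filter and the varying mesh cover both uses: continuity in the starting
  state for a fixed mesh, and convergence of polygons to a solution as the mesh is refined.\<close>

lemma return_time_euler_tendsto:
  assumes J: "\<And>i. fine_mesh (J i)" and x: "pseudo_orbit (rossler a b \<circ> trunc M) \<delta> x S" "x 0 \<in> Q"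
    and p: "((\<lambda>i. snd (p i)) \<longlongrightarrow> x 0) F" "\<forall>\<^sub>F i in F. snd (p i) \<in> Q"
    and lim: "\<And>t. t \<in> {0..S} \<Longrightarrow> ((\<lambda>i. euler rhs S (J i) (p i) t) \<longlongrightarrow> x t) F"
  shows "((\<lambda>i. return_time (euler rhs S (J i) (p i))) \<longlongrightarrow> return_time x) F"
proof -
  obtain \<rho> \<alpha> \<beta> q where r: "0 < \<rho>" and ab: "\<theta> \<le> \<alpha>" "\<alpha> < \<beta>" "\<beta> \<le> S"
    and "\<forall>z. pseudo_orbit (rossler a b \<circ> trunc M) \<delta> z S \<longrightarrow> z 0 \<in> Q \<longrightarrow> norm (z 0 - x 0) < \<rho> \<longrightarrow>
      window a b \<eta> q z \<alpha> \<beta> \<and> (\<forall>t\<in>{0..\<beta>}. norm (z t) \<le> M) \<and> norm (q - poincare a b (z 0)) < \<eta>"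
    using windows[OF x(2)] by (elim exE conjE)
  then have win: "\<And>z. \<lbrakk>pseudo_orbit (rossler a b \<circ> trunc M) \<delta> z S; z 0 \<in> Q; norm (z 0 - x 0) < \<rho>\<rbrakk> \<Longrightarrow>
      window a b \<eta> q z \<alpha> \<beta>" by blast
  have "\<forall>\<^sub>F i in F. dist (snd (p i)) (x 0) < \<rho>" using p(1) r by (rule tendstoD)
  with p(2) have "\<forall>\<^sub>F i in F. window a b \<eta> q (euler rhs S (J i) (p i)) \<alpha> \<beta>"
  proof eventually_elim
    case (elim i)
    then show ?case
      by (intro win euler_pseudo_orbit_\<delta> J) (simp_all add: euler_start[OF J] dist_norm)
  qed
  moreover have "window a b \<eta> q x \<alpha> \<beta>" using win[OF x] r by simp
  ultimately show ?thesis
    using ab \<theta> lim by (intro return_time_tendsto[of a b \<eta> q _ \<alpha> \<beta>]) auto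
qed

lemma next_state:
  assumes J: "fine_mesh J" and p: "snd p \<in> Q"
  shows "fst p + \<theta> < fst (next_state J p)" "fst (next_state J p) < fst p + S"
    "snd (next_state J p) \<in> Theta" "norm (snd (next_state J p) - poincare a b (snd p)) < 2 * \<eta>"
  using return_time_bounds[OF euler_pseudo_orbit_\<delta>[OF J, of p]] p
  unfolding euler_start[OF J] by (auto simp: next_state_def Let_def first_hit_def)

lemma continuous_on_next_state:
  assumes J: "fine_mesh J"
  shows "continuous_on (UNIV \<times> Q) (next_state J)"
proof -
  note ce = continuous_on_euler[OF continuous_rhs]
  have ct: "continuous_on (UNIV \<times> Q) (\<lambda>p. return_time (euler rhs S J p))"
    unfolding continuous_on_def
  proof
    fix p :: "real \<times> (real^3)" assume p: "p \<in> UNIV \<times> Q"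
    let ?F = "at p within UNIV \<times> Q"
    show "((\<lambda>p. return_time (euler rhs S J p)) \<longlongrightarrow> return_time (euler rhs S J p)) ?F"
    proof (rule return_time_euler_tendsto[where J = "\<lambda>_. J"])
      show "pseudo_orbit (rossler a b \<circ> trunc M) \<delta> (euler rhs S J p) S"
        by (rule euler_pseudo_orbit_\<delta>[OF J])
      show "((\<lambda>q. snd q) \<longlongrightarrow> euler rhs S J p 0) ?F"
        unfolding euler_start[OF J] by (intro tendsto_intros)
      show "\<forall>\<^sub>F q in ?F. snd q \<in> Q" by (auto simp: eventually_at_filter mem_Times_iff)
      fix t :: real
      have "continuous_on UNIV (\<lambda>q. (\<lambda>(p, s). euler rhs S J p s) (q, t))"
        by (rule continuous_on_compose2[OF ce[of UNIV]]) (auto intro!: continuous_intros)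
      then have "continuous_on UNIV (\<lambda>q. euler rhs S J q t)" by simp
      then have "isCont (\<lambda>q. euler rhs S J q t) p"
        using continuous_on_eq_continuous_at[OF open_UNIV] by blast
      then have "((\<lambda>q. euler rhs S J q t) \<longlongrightarrow> euler rhs S J p t) (at p)" by (simp only: isCont_def)
      then show "((\<lambda>q. euler rhs S J q t) \<longlongrightarrow> euler rhs S J p t) ?F"
        by (rule tendsto_within_subset) simp
    qed (use J p euler_start[OF J] in auto)
  qed
  have "continuous_on (UNIV \<times> Q) (\<lambda>p. (\<lambda>(p, s). euler rhs S J p s) (p, return_time (euler rhs S J p)))"
    by (rule continuous_on_compose2[OF ce[of UNIV]]) (auto intro!: continuous_intros ct)
  then show ?thesis
    unfolding next_state_def Let_def by (auto intro!: continuous_intros ct)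
qed

text \<open>A subsequence of the polygons converges to a solution of the truncated equation. Its
  window makes the return times converge as well, so the limit returns exactly at \<open>q0\<close>;
  up to then it stays in the ball of radius \<open>M\<close>, where the truncated and the original
  equation agree.\<close>

lemma segment_limit:
  assumes J: "\<And>n. fine_mesh (J n)" "filterlim J at_top sequentially"
    and p: "p \<longlonglongrightarrow> p0" "\<forall>\<^sub>F n in sequentially. snd (p n) \<in> Q"
    and q: "(\<lambda>n. next_state (J n) (p n)) \<longlonglongrightarrow> q0"
  obtains z where "ode_solution (\<lambda>t v. rossler a b v + e (t, v)) z {fst p0..fst q0}"
    and "z (fst p0) = snd p0" "z (fst q0) = snd q0" "fst p0 + \<theta> < fst q0"
    and "\<And>t. \<lbrakk>fst p0 < t; t < fst q0\<rbrakk> \<Longrightarrow> z t \<notin> Theta"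
proof -
  have Jpos: "0 < J n" for n using J(1) by (simp add: fine_mesh_def)
  obtain k x where k: "strict_mono (k :: nat \<Rightarrow> nat)"
    and ul: "uniform_limit {0..S} (\<lambda>n. euler rhs S (J (k n)) (p (k n))) x sequentially"
    and x0: "x 0 = snd p0" and x: "ode_solution (\<lambda>s. rhs (fst p0 + s)) x {0..S}"
    by (rule euler_limit[OF continuous_rhs norm_rhs_le S Jpos J(2) p(1)])
  let ?X = "\<lambda>n. euler rhs S (J (k n)) (p (k n))"
  have pk: "(\<lambda>n. p (k n)) \<longlonglongrightarrow> p0"
    using LIMSEQ_subseq_LIMSEQ[OF p(1) k] by (simp add: o_def)
  have pQ: "\<forall>\<^sub>F n in sequentially. snd (p (k n)) \<in> Q"
    using eventually_compose_filterlim[OF p(2) filterlim_subseq[OF k]] .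
  have p0Q: "snd p0 \<in> Q"
    by (rule Lim_in_closed_set[OF Q(2) pQ _ tendsto_snd[OF pk]]) simp
  have lim: "(\<lambda>n. ?X n t) \<longlonglongrightarrow> x t" if "t \<in> {0..S}" for t
    using tendsto_uniform_limitI[OF ul that] .
  have "ode_solution (\<lambda>s v. (rossler a b \<circ> trunc M) v + e (fst p0 + s, v)) x {0..S}"
    using x by (simp add: rhs_def[abs_def])
  then have po: "pseudo_orbit (rossler a b \<circ> trunc M) \<delta> x S"
    using e(2) \<delta> by (intro pseudo_orbit_of_solution rossler.continuous_comp_trunc M)
      (auto intro: order_trans[OF e(2)])
  have xQ: "x 0 \<in> Q" using p0Q x0 by simp
  let ?\<tau> = "return_time x"
  note \<tau> = return_time_bounds[OF po xQ]
  have \<tau>n: "(\<lambda>n. return_time (?X n)) \<longlonglongrightarrow> ?\<tau>"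
    using tendsto_snd[OF pk] pQ x0 lim J(1) by (intro return_time_euler_tendsto[OF _ po xQ]) auto
  have \<tau>in: "?\<tau> \<in> {0..S}" using \<tau> \<theta> by auto
  have qk: "(\<lambda>n. next_state (J (k n)) (p (k n))) \<longlonglongrightarrow> q0"
    using LIMSEQ_subseq_LIMSEQ[OF q k] by (simp add: o_def)
  have "(\<lambda>n. fst (p (k n)) + return_time (?X n)) \<longlonglongrightarrow> fst q0"
    using tendsto_fst[OF qk] by (simp add: next_state_def Let_def)
  then have q1: "fst q0 = fst p0 + ?\<tau>"
    using LIMSEQ_unique tendsto_add[OF tendsto_fst[OF pk] \<tau>n] by blast
  \<comment> \<open>The polygons are evaluated at moving times; their common Lipschitz constant
    \<open>V\<close> allows these to be replaced by the limit time.\<close>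
  have "(\<lambda>n. ?X n (return_time (?X n)) - ?X n ?\<tau>) \<longlonglongrightarrow> 0"
  proof (rule Lim_null_comparison)
    have "(\<lambda>n. V * \<bar>return_time (?X n) - ?\<tau>\<bar>) \<longlonglongrightarrow> V * \<bar>?\<tau> - ?\<tau>\<bar>"
      by (intro tendsto_intros \<tau>n)
    then show "(\<lambda>n. V * \<bar>return_time (?X n) - ?\<tau>\<bar>) \<longlonglongrightarrow> 0" by simp
    show "\<forall>\<^sub>F n in sequentially. norm (?X n (return_time (?X n)) - ?X n ?\<tau>) \<le> V * \<bar>return_time (?X n) - ?\<tau>\<bar>"
      using pQ
    proof eventually_elim
      case (elim n)
      have "?X n 0 \<in> Q" using elim euler_start[OF J(1)] by simp
      note return_time_bounds[OF euler_pseudo_orbit_\<delta>[OF J(1)] this]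
      then show ?case using \<theta> \<tau>in by (intro euler_lipschitz[OF continuous_rhs norm_rhs_le S Jpos]) auto
    qed
  qed
  from tendsto_add[OF this lim[OF \<tau>in]]
  have "(\<lambda>n. ?X n (return_time (?X n))) \<longlonglongrightarrow> x ?\<tau>" by simp
  moreover have "(\<lambda>n. ?X n (return_time (?X n))) \<longlonglongrightarrow> snd q0"
    using tendsto_snd[OF qk] by (simp add: next_state_def Let_def)
  ultimately have q2: "x ?\<tau> = snd q0" using LIMSEQ_unique by blast
  have "ode_solution (\<lambda>s. rhs (fst p0 + s)) x {0..?\<tau>}"
    by (rule ode_solution_subset[OF x]) (use \<tau>in in auto)
  then have "ode_solution (\<lambda>s v. rossler a b v + e (fst p0 + s, v)) x {0..?\<tau>}"
    by (rule ode_solution_cong) (use \<tau>(4) in \<open>auto simp: rhs_def trunc_eq\<close>)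
  from ode_solution_shift[OF this, of "\<lambda>t v. rossler a b v + e (t, v)" "fst p0"]
  have "ode_solution (\<lambda>t v. rossler a b v + e (t, v)) (\<lambda>t. x (t - fst p0)) {fst p0..fst q0}"
    by (simp add: q1)
  then show ?thesis
    by (rule that) (use x0 q1 q2 \<tau>(1,2) in \<open>auto simp: first_hit_def\<close>)
qed

text \<open>The i-th state of every chain lies in the compact set [t0, t0 + i * S] \<times> K i,
  whatever the mesh. Limits of all states exist along one subsequence, and
  \<open>segment_limit\<close> joins consecutive limits by solutions.\<close>

lemma infinite_itinerary:
  assumes K: "\<And>i. compact (K i)" "\<And>i. K i \<subseteq> Q"
    and chain: "\<And>J n. fine_mesh J \<Longrightarrow> \<exists>s. fst (s 0) = t0 \<and> (\<forall>i\<le>n. snd (s i) \<in> K i) \<and>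
      (\<forall>i<n. s (Suc i) = next_state J (s i))"
  shows "\<exists>x \<tau>. ode_solution (\<lambda>t v. rossler a b v + e (t, v)) x {t0..} \<and> \<tau> 0 = t0 \<and> strict_mono \<tau> \<and>
    (\<forall>t\<ge>t0. x t \<in> Theta \<longleftrightarrow> (\<exists>i. t = \<tau> i)) \<and> (\<forall>i. x (\<tau> i) \<in> K i)"
proof -
  obtain J0 :: nat where J0: "2 * (L * V * S) / \<delta> < real J0" using reals_Archimedean2 by blast
  define J where "J n = Suc (J0 + n)" for n
  have fine_mesh: "fine_mesh (J n)" for n
  proof -
    have "2 * (L * V * S) / \<delta> \<le> real (J n)" using J0 by (simp add: J_def)
    then show ?thesis using \<delta> by (simp add: fine_mesh_def J_def field_simps)
  qed
  have "strict_mono J" by (simp add: strict_mono_Suc_iff J_def)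
  then have Jlim: "filterlim J at_top sequentially" by (rule filterlim_subseq)
  \<comment> \<open>The index \<open>n\<close> serves as the length of the chain and also drives the
    mesh to 0, so one limit completes both.\<close>
  have "\<exists>s. fst (s 0) = t0 \<and> (\<forall>i\<le>n. snd (s i) \<in> K i) \<and>
      (\<forall>i<n. s (Suc i) = next_state (J n) (s i))" for n
    by (rule chain[OF fine_mesh])
  then have "\<exists>s. \<forall>n. fst (s n 0) = t0 \<and> (\<forall>i\<le>n. snd (s n i) \<in> K i) \<and>
      (\<forall>i<n. s n (Suc i) = next_state (J n) (s n i))"
    by (intro choice allI)
  then obtain s where s0: "\<And>n. fst (s n 0) = t0" and sK: "\<And>n i. i \<le> n \<Longrightarrow> snd (s n i) \<in> K i"
    and sS: "\<And>n i. i < n \<Longrightarrow> s n (Suc i) = next_state (J n) (s n i)"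
    by blast
  have times: "t0 \<le> fst (s n i) \<and> fst (s n i) \<le> t0 + real i * S" if "i \<le> n" for n i
    using that
  proof (induction i)
    case 0
    then show ?case by (simp add: s0)
  next
    case (Suc i)
    then have "snd (s n i) \<in> Q" using sK[of i n] K by auto
    from next_state(1,2)[OF fine_mesh this, of n] Suc \<theta> show ?case by (auto simp: sS algebra_simps)
  qed
  have "\<exists>B>0. \<forall>p\<in>{t0..t0 + real i * S} \<times> K i. norm p \<le> B" for i
  proof -
    have "bounded ({t0..t0 + real i * S} \<times> K i)"
      by (intro compact_imp_bounded compact_Times K) auto
    then show ?thesis by (simp only: bounded_pos)
  qed
  then obtain B where B: "\<And>i. 0 < B i" "\<And>i p. p \<in> {t0..t0 + real i * S} \<times> K i \<Longrightarrow> norm p \<le> B i"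
    by metis
  \<comment> \<open>The diagonal argument asks for one bound for all indices, so the i-th state is
    scaled by its own bound; states beyond the length of the chain are set to 0 and concern only
    finitely many n for each i.\<close>
  define f where "f n i = (if i \<le> n then (1 / B i) *\<^sub>R s n i else 0)" for n i
  have nf: "norm (f n i) \<le> 1" for n i
    using B(1)[of i] B(2)[of "s n i" i] times[of i n] sK[of i n] by (auto simp: f_def mem_Times_iff field_simps)
  obtain k where k: "strict_mono (k :: nat \<Rightarrow> nat)"
    and fconv: "\<And>i. i \<in> UNIV \<Longrightarrow> \<exists>l. (\<lambda>n. f (k n) i) \<longlonglongrightarrow> l"
    by (rule function_convergent_subsequence[of "UNIV :: nat set" f 1, OF countableI_type nf]) (rule that)
  have late: "\<forall>\<^sub>F n in sequentially. i \<le> k n" for i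
    using filterlim_subseq[OF k] by (simp add: filterlim_at_top)
  have conv: "\<exists>l. (\<lambda>n. s (k n) i) \<longlonglongrightarrow> l" for i
  proof -
    obtain l where "(\<lambda>n. f (k n) i) \<longlonglongrightarrow> l" using fconv[OF UNIV_I] by blast
    then have "(\<lambda>n. B i *\<^sub>R f (k n) i) \<longlonglongrightarrow> B i *\<^sub>R l" by (intro tendsto_intros)
    moreover have "\<forall>\<^sub>F n in sequentially. B i *\<^sub>R f (k n) i = s (k n) i"
      using late[of i] by eventually_elim (use B(1)[of i] in \<open>simp add: f_def\<close>)
    ultimately have "(\<lambda>n. s (k n) i) \<longlonglongrightarrow> B i *\<^sub>R l" by (rule Lim_transform_eventually)
    then show ?thesis by blast
  qed
  then obtain l where l: "\<And>i. (\<lambda>n. s (k n) i) \<longlonglongrightarrow> l i" by metis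
  have lK: "snd (l i) \<in> K i" for i
  proof (rule Lim_in_closed_set[OF compact_imp_closed[OF K(1)] _ _ tendsto_snd[OF l]])
    show "\<forall>\<^sub>F n in sequentially. snd (s (k n) i) \<in> K i"
      using late[of i] by eventually_elim (rule sK)
  qed simp
  have l0: "fst (l 0) = t0" using LIMSEQ_unique[OF tendsto_fst[OF l[of 0]]] s0 by simp
  have "\<exists>z. ode_solution (\<lambda>t v. rossler a b v + e (t, v)) z {fst (l i)..fst (l (Suc i))} \<and>
    z (fst (l i)) = snd (l i) \<and> z (fst (l (Suc i))) = snd (l (Suc i)) \<and> fst (l i) + \<theta> < fst (l (Suc i)) \<and>
    (\<forall>t. fst (l i) < t \<and> t < fst (l (Suc i)) \<longrightarrow> z t \<notin> Theta)" for i
  proof -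
    have "\<forall>\<^sub>F n in sequentially. next_state (J (k n)) (s (k n) i) = s (k n) (Suc i)"
      using late[of "Suc i"] by eventually_elim (simp add: sS)
    then have "(\<lambda>n. next_state (J (k n)) (s (k n) i)) \<longlonglongrightarrow> l (Suc i)"
      using l[of "Suc i"] by (simp cong: tendsto_cong)
    note f3 = this
    have f2: "\<forall>\<^sub>F n in sequentially. snd (s (k n) i) \<in> Q"
      using late[of i] by eventually_elim (use sK K in blast)
    have f1: "filterlim (\<lambda>n. J (k n)) at_top sequentially"
      using filterlim_compose[OF Jlim filterlim_subseq[OF k]] .
    show ?thesis
    proof (rule segment_limit[OF fine_mesh f1 l[of i] f2 f3])
      fix z
      assume "ode_solution (\<lambda>t v. rossler a b v + e (t, v)) z {fst (l i)..fst (l (Suc i))}"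
        "z (fst (l i)) = snd (l i)" "z (fst (l (Suc i))) = snd (l (Suc i))" "fst (l i) + \<theta> < fst (l (Suc i))"
        "\<And>t. \<lbrakk>fst (l i) < t; t < fst (l (Suc i))\<rbrakk> \<Longrightarrow> z t \<notin> Theta"
      then show ?thesis by (intro exI[of _ z]) simp
    qed
  qed
  then have "\<exists>z. \<forall>i. ode_solution (\<lambda>t v. rossler a b v + e (t, v)) (z i) {fst (l i)..fst (l (Suc i))} \<and>
    z i (fst (l i)) = snd (l i) \<and> z i (fst (l (Suc i))) = snd (l (Suc i)) \<and> fst (l i) + \<theta> < fst (l (Suc i)) \<and>
    (\<forall>t. fst (l i) < t \<and> t < fst (l (Suc i)) \<longrightarrow> z i t \<notin> Theta)"
    by (intro choice allI)
  then obtain z where z: "\<And>i. ode_solution (\<lambda>t v. rossler a b v + e (t, v)) (z i) {fst (l i)..fst (l (Suc i))}"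
    and z0: "\<And>i. z i (fst (l i)) = snd (l i)" and z1: "\<And>i. z i (fst (l (Suc i))) = snd (l (Suc i))"
    and gap: "\<And>i. fst (l i) + \<theta> < fst (l (Suc i))"
    and off: "\<And>i t. \<lbrakk>fst (l i) < t; t < fst (l (Suc i))\<rbrakk> \<Longrightarrow> z i t \<notin> Theta"
    by blast
  define \<tau> where "\<tau> i = fst (l i)" for i
  have inc: "\<tau> i < \<tau> (Suc i)" for i using gap[of i] \<theta> by (simp add: \<tau>_def)
  \<comment> \<open>The minimal return time \<theta> keeps the returns from accumulating, so the
    glued solution lives on the whole half-line.\<close>
  have grow: "t0 + real i * \<theta> \<le> \<tau> i" for i
  proof (induction i)
    case (Suc i)
    then show ?case using gap[of i] by (simp add: \<tau>_def algebra_simps)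
  qed (simp add: \<tau>_def l0)
  have unbounded: "\<exists>i. t < \<tau> i" for t
  proof -
    obtain i :: nat where "(t - t0) / \<theta> < real i" using reals_Archimedean2 by blast
    then have "t < t0 + real i * \<theta>" using \<theta> by (simp add: field_simps)
    then show ?thesis using grow[of i] by (intro exI[of _ i]) simp
  qed
  obtain x where x: "ode_solution (\<lambda>t v. rossler a b v + e (t, v)) x {\<tau> 0..}"
    and xz: "\<And>i t. t \<in> {\<tau> i..\<tau> (Suc i)} \<Longrightarrow> x t = z i t"
  proof (rule ode_solution_glue[OF inc unbounded])
    show "ode_solution (\<lambda>t v. rossler a b v + e (t, v)) (z i) {\<tau> i..\<tau> (Suc i)}" for i
      using z by (simp add: \<tau>_def)
    show "z i (\<tau> (Suc i)) = z (Suc i) (\<tau> (Suc i))" for i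
      using z0[of "Suc i"] z1[of i] by (simp add: \<tau>_def)
  qed (rule that)
  have x\<tau>: "x (\<tau> i) \<in> K i" for i
    using xz[of "\<tau> i" i] inc[of i] z0[of i] lK[of i] by (simp add: \<tau>_def)
  have "x t \<in> Theta \<longleftrightarrow> (\<exists>i. t = \<tau> i)" if t: "t0 \<le> t" for t
  proof
    assume xt: "x t \<in> Theta"
    define j where "j = (LEAST j. t < \<tau> j)"
    have j: "t < \<tau> j" unfolding j_def using unbounded by (rule LeastI_ex)
    have "j \<noteq> 0"
    proof
      assume "j = 0"
      then show False using j t l0 by (simp add: \<tau>_def)
    qed
    then obtain i where i: "j = Suc i" by (cases j) auto
    then have "\<tau> i \<le> t" using not_less_Least[of i "\<lambda>j. t < \<tau> j"] by (simp add: j_def)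
    then show "\<exists>i. t = \<tau> i"
      using xt xz[of t i] off[of i t] j i by (cases "t = \<tau> i") (auto simp: \<tau>_def)
  qed (use x\<tau> K Q in blast)
  then show ?thesis
    using x x\<tau> inc l0 by (intro exI[of _ x] exI[of _ \<tau>]) (auto simp: \<tau>_def strict_mono_Suc_iff)
qed

end

section \<open>Chains of covering relations\<close>

text \<open>The pair of horizontal part and height is the point with polar angle 2 * arcsin (norm
  v): the centre of the ball goes to the north pole, and the whole boundary to the south
  pole.\<close>

lemma sphere_collapse:
  fixes v :: "'a::euclidean_space"
  assumes "norm v \<le> 1"
  shows "(2 * sqrt (1 - (norm v)\<^sup>2)) *\<^sub>R v \<in> {w. (norm w)\<^sup>2 + (1 - 2 * (norm v)\<^sup>2)\<^sup>2 = 1}"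
proof -
  have "(norm v)\<^sup>2 \<le> 1" using assms by (simp add: power_le_one)
  then have "(2 * sqrt (1 - (norm v)\<^sup>2) * norm v)\<^sup>2 = 4 * (1 - (norm v)\<^sup>2) * (norm v)\<^sup>2"
    by (simp add: power_mult_distrib)
  also have "\<dots> + (1 - 2 * (norm v)\<^sup>2)\<^sup>2 = 1"
    by (simp add: power2_eq_square algebra_simps)
  finally show ?thesis by (simp add: power_mult_distrib)
qed

text \<open>The segment from \<open>f x\<close> to \<open>g x\<close> misses the origin unless the
  points are antipodal, so the linear homotopy can be projected radially to the sphere.\<close>

lemma homotopic_non_antipodal:
  fixes f g :: "'a::topological_space \<Rightarrow> 'b::real_normed_vector"
  assumes f: "continuous_on X f" "f \<in> X \<rightarrow> sphere 0 1" and g: "continuous_on X g" "g \<in> X \<rightarrow> sphere 0 1"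
    and ne: "\<And>x. x \<in> X \<Longrightarrow> f x \<noteq> - g x"
  shows "homotopic_with_canon (\<lambda>_. True) X (sphere 0 1) f g"
proof -
  have seg: "closed_segment (f x) (g x) \<subseteq> - {0}" if "x \<in> X" for x
  proof -
    have "(1 - u) *\<^sub>R f x + u *\<^sub>R g x \<noteq> 0" if "0 \<le> u" "u \<le> 1" for u
    proof
      assume *: "(1 - u) *\<^sub>R f x + u *\<^sub>R g x = 0"
      then have "norm ((1 - u) *\<^sub>R f x) = norm (u *\<^sub>R g x)"
        by (metis add.inverse_unique norm_minus_cancel)
      then have "u = 1 / 2" using f(2) g(2) \<open>x \<in> X\<close> that by force
      with * have "(1 / 2) *\<^sub>R (f x + g x) = 0" by (simp add: scaleR_right_distrib)
      then show False using ne[OF \<open>x \<in> X\<close>] by (simp add: eq_neg_iff_add_eq_0)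
    qed
    then show ?thesis by (auto simp: closed_segment_def)
  qed
  have "homotopic_with_canon (\<lambda>_. True) X (- {0}) f g"
    by (rule homotopic_with_linear[OF f(1) g(1) seg])
  moreover have "continuous_map (top_of_set (- {0})) (top_of_set (sphere (0 :: 'b) 1)) (\<lambda>y. y /\<^sub>R norm y)"
    by (auto intro!: continuous_intros)
  ultimately have "homotopic_with_canon (\<lambda>_. True) X (sphere 0 1)
      ((\<lambda>y. y /\<^sub>R norm y) \<circ> f) ((\<lambda>y. y /\<^sub>R norm y) \<circ> g)"
    by (rule homotopic_with_compose_continuous_map_left[where p = "\<lambda>_. True"]) auto
  then show ?thesis
    by (rule homotopic_with_eq) (use f(2) g(2) in \<open>force+\<close>)
qed

text \<open>
  The unit ball modulo its boundary is the sphere; \<open>G\<close> composed with this quotient map and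
  extended by the base point outside \<open>D\<close> is a homotopy of maps of spheres. It starts at a map
  that misses the north pole unless \<open>G (0, _)\<close> has a zero, and it ends at a map that is
  nowhere antipodal to the identity.
\<close>

lemma homotopy_to_linear_has_zero:
  fixes D :: "(real \<times> 'a::euclidean_space) set" and G :: "real \<times> 'a \<Rightarrow> 'a"
  assumes D: "compact D" "D \<subseteq> {0..1} \<times> UNIV" and G: "continuous_on D G"
    and le: "\<And>z. z \<in> D \<Longrightarrow> norm (G z) \<le> 1"
    and int: "openin (top_of_set ({0..1} \<times> UNIV)) {z \<in> D. norm (G z) < 1}"
    and \<Lambda>: "linear \<Lambda>" "inj \<Lambda>"
    and D1: "\<And>x. (1, x) \<in> D \<longleftrightarrow> norm (\<Lambda> x) \<le> 1"
    and G1: "\<And>x. norm (\<Lambda> x) \<le> 1 \<Longrightarrow> G (1, x) = \<Lambda> x"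
  obtains x where "(0, x) \<in> D" "G (0, x) = 0"
proof (rule ccontr)
  assume "\<not> thesis"
  then have nz: "\<And>x. (0, x) \<in> D \<Longrightarrow> G (0, x) \<noteq> 0" using that by blast
  let ?I = "{0..1} \<times> (UNIV :: 'a set)" and ?S = "sphere (0 :: 'a \<times> real) 1"
  define \<kappa> :: "'a \<Rightarrow> 'a \<times> real" where
    "\<kappa> v = ((2 * sqrt (1 - (norm v)\<^sup>2)) *\<^sub>R v, 1 - 2 * (norm v)\<^sup>2)" for v
  define \<Phi> where "\<Phi> z = (if z \<in> D then \<kappa> (G z) else (0, -1))" for z
  have sphere_iff: "q \<in> ?S \<longleftrightarrow> (norm (fst q))\<^sup>2 + (snd q)\<^sup>2 = 1" for q :: "'a \<times> real"
    by (cases q) (auto simp: norm_Pair)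
  have \<kappa>: "\<kappa> v \<in> ?S" if "norm v \<le> 1" for v
    using sphere_collapse[OF that] unfolding sphere_iff \<kappa>_def by simp
  have \<Phi>S: "\<Phi> z \<in> ?S" for z using \<kappa> le by (auto simp: \<Phi>_def norm_Pair)
  have c\<kappa>: "continuous_on A \<kappa>" for A unfolding \<kappa>_def by (intro continuous_intros)
  have c\<Phi>: "continuous_on ?I \<Phi>"
  proof -
    let ?C = "?I - {z \<in> D. norm (G z) < 1}"
    have "closedin (top_of_set ?I) ?I" by simp
    from closed_subset[OF D(2) compact_imp_closed[OF D(1)]] closedin_diff[OF this int]
    have cl: "closedin (top_of_set ?I) D" "closedin (top_of_set ?I) ?C" .
    \<comment> \<open>\<open>D\<close> and the complement of the open set where
      \<open>norm (G z) < 1\<close> are closed pieces. On their overlap the norm is 1, and there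
      \<kappa> already takes the value (0, -1).\<close>
    have "continuous_on (D \<union> ?C) (\<lambda>z. if z \<in> D then \<kappa> (G z) else (0, -1))"
    proof (rule continuous_on_cases_local)
      show "closedin (top_of_set (D \<union> ?C)) D" "closedin (top_of_set (D \<union> ?C)) ?C"
        using cl D(2) by (auto intro: closedin_subset_trans[where U = ?I])
      show "continuous_on D (\<lambda>z. \<kappa> (G z))" by (rule continuous_on_compose2[OF c\<kappa> G]) auto
      fix z assume "z \<in> D \<and> z \<notin> D \<or> z \<in> ?C \<and> z \<in> D"
      then have "norm (G z) = 1" using le by force
      then show "\<kappa> (G z) = (0, -1)" by (simp add: \<kappa>_def)
    qed auto
    moreover have "D \<union> ?C = ?I" using D(2) by auto
    ultimately show ?thesis by (simp add: \<Phi>_def)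
  qed
  obtain \<Lambda>' where \<Lambda>': "linear \<Lambda>'" and \<Lambda>\<Lambda>': "\<And>v. \<Lambda> (\<Lambda>' v) = v"
    using linear_injective_isomorphism[OF \<Lambda>] by blast
  have "continuous_on D (\<lambda>z. \<Lambda> (snd z))"
    by (rule linear_continuous_on_compose[OF continuous_on_snd[OF continuous_on_id] \<Lambda>(1)])
  from compact_imp_bounded[OF compact_continuous_image[OF this D(1)]]
  obtain R where R: "\<And>z. z \<in> D \<Longrightarrow> norm (\<Lambda> (snd z)) \<le> R"
    by (auto simp: bounded_iff)
  have out: "(l, \<Lambda>' v) \<notin> D" if "R < norm v" for l v
    using R[of "(l, \<Lambda>' v)"] that \<Lambda>\<Lambda>' by auto
  \<comment> \<open>At height h > -1 the stereographic image has squared norm (1 - h) / (1 + h),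
    which is at least \<open>K\<close> exactly for h \<le> c. Below height \<open>c\<close> its
    preimage under \<Lambda> is therefore outside the bounded set \<open>D\<close>.\<close>
  define K where "K = (\<bar>R\<bar> + 1)\<^sup>2"
  define c where "c = (1 - K) / (1 + K)"
  have K: "1 \<le> K" by (simp add: K_def)
  have c: "-1 < c" "c \<le> 0" using K by (simp_all add: c_def field_simps)
  \<comment> \<open>Stereographic projection from the south pole (0, -1); \<Lambda>' then leads to
    the space of the starting points.\<close>
  define \<sigma> :: "'a \<times> real \<Rightarrow> 'a" where "\<sigma> q = (1 / (1 + snd q)) *\<^sub>R fst q" for q
  have norm_\<sigma>: "(norm (\<sigma> q))\<^sup>2 = (1 - snd q) / (1 + snd q)" if "q \<in> ?S" "-1 < snd q" for q
  proof -
    have 1: "(norm (fst q))\<^sup>2 = (1 - snd q) * (1 + snd q)"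
      using that(1) unfolding sphere_iff by (simp add: power2_eq_square algebra_simps)
    have "norm (\<sigma> q) = norm (fst q) / (1 + snd q)" using that(2) by (simp add: \<sigma>_def)
    then have "(norm (\<sigma> q))\<^sup>2 = (norm (fst q))\<^sup>2 / (1 + snd q)\<^sup>2" by (simp add: power_divide)
    then show ?thesis using that(2) unfolding 1 by (simp add: power2_eq_square)
  qed
  have far: "\<Phi> (l, \<Lambda>' (\<sigma> q)) = (0, -1)" if "q \<in> ?S" "-1 < snd q" "snd q \<le> c" for l q
  proof -
    have "snd q * (1 + K) \<le> 1 - K"
      using that(3) K by (simp add: c_def pos_le_divide_eq)
    then have "K * (1 + snd q) \<le> 1 - snd q" by (simp add: algebra_simps)
    then have "K \<le> (norm (\<sigma> q))\<^sup>2"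
      using that(2) by (simp add: norm_\<sigma>[OF that(1,2)] pos_le_divide_eq)
    then have "\<bar>R\<bar> + 1 \<le> norm (\<sigma> q)"
      unfolding K_def by (rule power2_le_imp_le) simp
    then show ?thesis using out[of "\<sigma> q" l] by (simp add: \<Phi>_def)
  qed
  \<comment> \<open>Near the south pole \<Phi> would already be constant, so the constant continues
    the map over the pole itself, where \<sigma> has no meaning.\<close>
  define H where "H p = (if c \<le> snd (snd p) then \<Phi> (fst p, \<Lambda>' (\<sigma> (snd p))) else (0, -1))"
    for p :: "real \<times> ('a \<times> real)"
  have cH: "continuous_on ({0..1} \<times> ?S) H"
  proof -
    let ?A = "{p \<in> {0..1 :: real} \<times> ?S. c \<le> snd (snd p)}" and ?B = "{p \<in> {0..1 :: real} \<times> ?S. snd (snd p) \<le> c}"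
    have "continuous_on (?A \<union> ?B) (\<lambda>p. if c \<le> snd (snd p) then \<Phi> (fst p, \<Lambda>' (\<sigma> (snd p))) else (0, -1))"
    proof (rule continuous_on_cases)
      have AB: "?A = ({0..1 :: real} \<times> ?S) \<inter> {p. c \<le> snd (snd p)}" "?B = ({0..1 :: real} \<times> ?S) \<inter> {p. snd (snd p) \<le> c}"
        by auto
      show "closed ?A" unfolding AB(1)
        by (intro closed_Int closed_Times closed_Collect_le continuous_intros closed_sphere closed_atLeastAtMost)
      show "closed ?B" unfolding AB(2)
        by (intro closed_Int closed_Times closed_Collect_le continuous_intros closed_sphere closed_atLeastAtMost)
      have "continuous_on ?A (\<lambda>p. \<Lambda>' (\<sigma> (snd p)))" unfolding \<sigma>_def
        using c by (intro linear_continuous_on_compose[OF _ \<Lambda>'] continuous_intros) auto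
      then show "continuous_on ?A (\<lambda>p. \<Phi> (fst p, \<Lambda>' (\<sigma> (snd p))))"
        by (intro continuous_on_compose2[OF c\<Phi>] continuous_intros) auto
      show "\<forall>p. p \<in> ?A \<and> \<not> c \<le> snd (snd p) \<or> p \<in> ?B \<and> c \<le> snd (snd p) \<longrightarrow>
          \<Phi> (fst p, \<Lambda>' (\<sigma> (snd p))) = (0, -1)"
        using far c by auto
    qed auto
    moreover have "?A \<union> ?B = {0..1} \<times> ?S" by auto
    ultimately show ?thesis by (simp add: H_def)
  qed
  have HS: "H p \<in> ?S" for p using \<Phi>S by (auto simp: H_def norm_Pair)
  have cHl: "continuous_on ?S (\<lambda>q. H (l, q))" if "l \<in> {0..1}" for l
    by (rule continuous_on_compose2[OF cH]) (use that in \<open>auto intro!: continuous_intros\<close>)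
  have H01: "homotopic_with_canon (\<lambda>_. True) ?S ?S (\<lambda>q. H (0, q)) (\<lambda>q. H (1, q))"
    using cH HS by (subst homotopic_with) (auto intro!: exI[of _ H] simp: continuous_map_subtopology_eu)
  \<comment> \<open>The antipode of (0, -1) is the north pole, which \<kappa> takes only at 0, and
    zeros of \<open>G (0, _)\<close> have been excluded.\<close>
  have "homotopic_with_canon (\<lambda>_. True) ?S ?S (\<lambda>q. H (0, q)) (\<lambda>q. (0, -1))"
  proof (rule homotopic_non_antipodal)
    fix q :: "'a \<times> real"
    show "H (0, q) \<noteq> - (0, -1)"
      using nz by (auto simp: H_def \<Phi>_def \<kappa>_def)
  qed (use HS cHl in \<open>auto simp: norm_Pair\<close>)
  \<comment> \<open>Where \<open>H (1, q) = \<kappa> (\<sigma> q)\<close>, the horizontal parts of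
    \<open>q\<close> and \<open>H (1, q)\<close> are nonnegative multiples of the same vector, so
    antipodality forces \<open>\<sigma> q = 0\<close>, where both points are the north pole.
    Elsewhere \<open>H (1, q)\<close> is the south pole, and \<open>q\<close> is not the north
    pole.\<close>
  moreover have "homotopic_with_canon (\<lambda>_. True) ?S ?S id (\<lambda>q. H (1, q))"
  proof (rule homotopic_non_antipodal)
    fix q assume q: "q \<in> ?S"
    show "id q \<noteq> - H (1, q)"
    proof
      assume eq: "id q = - H (1, q)"
      show False
      proof (cases "c \<le> snd q \<and> norm (\<sigma> q) \<le> 1")
        case True
        let ?a = "2 * sqrt (1 - (norm (\<sigma> q))\<^sup>2)"
        have "H (1, q) = \<kappa> (\<sigma> q)"
          using True by (simp add: H_def \<Phi>_def D1 G1 \<Lambda>\<Lambda>')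
        then have q: "fst q = - (?a *\<^sub>R \<sigma> q)" "snd q = - (1 - 2 * (norm (\<sigma> q))\<^sup>2)"
          using eq by (simp_all add: \<kappa>_def prod_eq_iff)
        have "fst q = (1 + snd q) *\<^sub>R \<sigma> q" using True c by (simp add: \<sigma>_def)
        with q(1) have "(1 + snd q + ?a) *\<^sub>R \<sigma> q = 0"
          by (simp add: scaleR_add_left)
        moreover have "0 \<le> ?a" using True by (simp add: power_le_one)
        ultimately have "\<sigma> q = 0" using True c by auto
        then show False using q(2) True c by simp
      next
        case False
        then have "H (1, q) = (0, -1)" by (auto simp: H_def \<Phi>_def D1 \<Lambda>\<Lambda>')
        then have "q = (0, 1)" using eq by (simp add: prod_eq_iff)
        then show False using False c by (simp add: \<sigma>_def)
      qed
    qed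
  qed (use HS cHl in auto)
  ultimately have "homotopic_with_canon (\<lambda>_. True) ?S ?S id (\<lambda>q. (0, -1))"
    using H01 homotopic_with_trans homotopic_with_symD by blast
  then have "contractible ?S" unfolding contractible_def by blast
  then show False using contractible_sphere[of "0 :: 'a \<times> real" 1] by simp
qed

section \<open>Unstable and stable coordinates\<close>

lemma linear_upart: "linear (upart u)"
  by (rule linearI) (auto simp: upart_def vec_eq_iff forall_2)

lemma linear_spart: "linear (spart u)"
  unfolding spart_def by (intro linear_compose_sub linear_ident linear_upart)

lemma upart_upart [simp]: "upart u (upart u v) = upart u v"
  and upart_spart [simp]: "upart u (spart u v) = 0"
  and spart_upart [simp]: "spart u (upart u v) = 0"
  by (auto simp: upart_def spart_def vec_eq_iff forall_2)

lemma spart_spart [simp]: "spart u (spart u v) = spart u v"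
  by (auto simp: upart_def spart_def vec_eq_iff forall_2)

lemma upart_plus_spart: "upart u v + spart u v = v"
  by (simp add: spart_def)

lemma norm_upart_le: "norm (upart u v) \<le> norm v"
  and norm_spart_le: "norm (spart u v) \<le> norm v"
  unfolding norm_vec_def L2_set_def
  by (auto intro!: real_sqrt_le_mono sum_mono simp: upart_def spart_def UNIV_2 abs_le_square_iff[symmetric])

text \<open>All h-sets joined by coverings have the same \<open>udim\<close>, so their charts share
  these boxes; a radius below 1 describes the shrunken sets.\<close>

definition hbox :: "nat \<Rightarrow> real \<Rightarrow> (real^2) set" where
  "hbox u r = {v. norm (upart u v) \<le> r \<and> norm (spart u v) \<le> r}"

lemma continuous_on_upart [continuous_intros]:
  assumes "continuous_on A f"
  shows "continuous_on A (\<lambda>x. upart u (f x))"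
proof -
  have "continuous_on UNIV (upart u)"
    using linear_upart linear_conv_bounded_linear linear_continuous_on by blast
  then show ?thesis by (rule continuous_on_compose2[OF _ assms]) simp
qed

lemma continuous_on_spart [continuous_intros]:
  assumes "continuous_on A f"
  shows "continuous_on A (\<lambda>x. spart u (f x))"
proof -
  have "continuous_on UNIV (spart u)"
    using linear_spart linear_conv_bounded_linear linear_continuous_on by blast
  then show ?thesis by (rule continuous_on_compose2[OF _ assms]) simp
qed

lemma hbox_eq_vimage: "hbox u r = (upart u -` cball 0 r) \<inter> (spart u -` cball 0 r)"
  by (auto simp: hbox_def)

lemma closed_hbox: "closed (hbox u r)"
  unfolding hbox_def by (intro closed_Collect_conj closed_Collect_le continuous_intros)

lemma convex_hbox: "convex (hbox u r)"
  unfolding hbox_eq_vimage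
  by (intro convex_Int convex_linear_vimage linear_upart linear_spart convex_cball)

lemma compact_hbox: "compact (hbox u r)"
proof -
  have "norm v \<le> r + r" if "v \<in> hbox u r" for v
    using that norm_triangle_ineq[of "upart u v" "spart u v"]
    by (auto simp: hbox_def upart_plus_spart)
  then have "bounded (hbox u r)" by (auto simp: bounded_iff)
  then show ?thesis using closed_hbox compact_eq_bounded_closed by blast
qed

lemma zero_in_hbox: "0 \<le> r \<Longrightarrow> 0 \<in> hbox u r"
  using linear_0[OF linear_upart] linear_0[OF linear_spart] by (simp add: hbox_def)

text \<open>The start varies only in the \<open>u\<close> unstable coordinates. Its stable
  coordinates are added as an idle parameter, which turns the last unstable coordinate into a map
  from the plane to itself; \<open>homotopy_to_linear_has_zero\<close> then treats
  \<open>u = 0\<close>, \<open>u = 1\<close> and \<open>u = 2\<close> alike. The time component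
  follows along without any condition.\<close>

lemma covering_chain:
  fixes g :: "nat \<Rightarrow> real \<Rightarrow> real \<times> (real^2) \<Rightarrow> real \<times> (real^2)" and L :: "nat \<Rightarrow> real^2 \<Rightarrow> real^2"
  assumes r: "0 < r"
    and cont: "\<And>i. continuous_on ({0..1} \<times> (UNIV \<times> hbox u r)) (\<lambda>p. g i (fst p) (snd p))"
    and trans: "\<And>i l T v. \<lbrakk>l \<in> {0..1}; v \<in> hbox u r; snd (g i l (T, v)) \<in> hbox u r\<rbrakk> \<Longrightarrow>
      norm (upart u v) < r \<and> norm (spart u (snd (g i l (T, v)))) < r"
    and lin: "\<And>i. linear (L i)" "\<And>i T v. v \<in> hbox u r \<Longrightarrow> snd (g i 1 (T, v)) = L i (upart u v)"
    and range: "\<And>i v. upart u (L i (upart u v)) = L i (upart u v)"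
    and expand: "\<And>i v. norm (upart u v) \<le> norm (L i (upart u v))"
  obtains z where "fst (z 0) = t0" "\<And>i. i \<le> k \<Longrightarrow> snd (z i) \<in> hbox u r"
    "\<And>i. i < k \<Longrightarrow> z (Suc i) = g i 0 (z i)"
proof -
  let ?I = "{0..1 :: real} \<times> (UNIV :: (real^2) set)"
  note [simp] = linear_add[OF linear_upart] linear_add[OF linear_spart]
    linear_scale[OF linear_upart] linear_scale[OF linear_spart]
  \<comment> \<open>The maps are controlled only on the box. Retracting to the box before each step
    makes the iteration total and continuous, and chains inside the box are unaffected.\<close>
  define \<rho> where "\<rho> = closest_point (hbox u r)"
  have ne: "hbox u r \<noteq> {}" using zero_in_hbox[of r u] r by auto
  have \<rho>: "\<rho> v \<in> hbox u r" for v
    unfolding \<rho>_def by (rule closest_point_in_set[OF closed_hbox ne])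
  have \<rho>_eq: "v \<in> hbox u r \<Longrightarrow> \<rho> v = v" for v
    unfolding \<rho>_def by (rule closest_point_self)
  have c\<rho>: "continuous_on A \<rho>" for A
    unfolding \<rho>_def by (rule continuous_on_closest_point[OF convex_hbox closed_hbox ne])
  define Z where "Z = rec_nat (\<lambda>p. (t0, upart u (snd p)))
    (\<lambda>i f p. g i (fst p) (fst (f p), \<rho> (snd (f p))))"
  have Z0: "Z 0 p = (t0, upart u (snd p))" for p by (simp add: Z_def)
  have ZS: "Z (Suc i) p = g i (fst p) (fst (Z i p), \<rho> (snd (Z i p)))" for i p by (simp add: Z_def)
  have ZS': "Z (Suc i) p = g i (fst p) (Z i p)" if "snd (Z i p) \<in> hbox u r" for i p
    using that by (simp add: ZS \<rho>_eq)
  have cZ: "continuous_on ?I (Z i)" for i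
  proof (induction i)
    case 0
    show ?case unfolding Z0[abs_def] by (intro continuous_intros)
  next
    case (Suc i)
    have "continuous_on ?I (\<lambda>p. \<rho> (snd (Z i p)))"
      by (rule continuous_on_compose2[OF c\<rho>]) (auto intro!: continuous_intros Suc.IH)
    then have "continuous_on ?I (\<lambda>p. (fst p, (fst (Z i p), \<rho> (snd (Z i p)))))"
      by (intro continuous_intros Suc.IH)
    then have "continuous_on ?I (\<lambda>p. (\<lambda>p. g i (fst p) (snd p)) (fst p, (fst (Z i p), \<rho> (snd (Z i p)))))"
      by (rule continuous_on_compose2[OF cont]) (use \<rho> in auto)
    then show ?case unfolding ZS[abs_def] by simp
  qed
  \<comment> \<open>The unstable part comes from the end of the chain, the stable part is the idle
    parameter of the start; the factor 1 / r puts the relevant ball at radius 1.\<close>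
  define G where "G p = (1 / r) *\<^sub>R (upart u (snd (Z k p)) + spart u (snd p))" for p
  have cG: "continuous_on ?I G" unfolding G_def by (intro continuous_intros cZ)
  have uG: "upart u (G p) = (1 / r) *\<^sub>R upart u (snd (Z k p))"
    and sG: "spart u (G p) = (1 / r) *\<^sub>R spart u (snd p)" for p
    by (simp_all add: G_def)
  define D where "D = {p \<in> ?I. (\<forall>i\<le>k. snd (Z i p) \<in> hbox u r) \<and> norm (G p) \<le> 1}"
  have D: "D \<subseteq> ?I" by (auto simp: D_def)
  have "closed ?I" by (intro closed_Times closed_UNIV closed_atLeastAtMost)
  then have "closed (?I \<inter> Z i -` (UNIV \<times> hbox u r))" "closed (?I \<inter> G -` cball 0 1)" for i
    using closed_hbox by (auto intro!: continuous_closed_preimage cZ cG closed_Times)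
  then have "closed ((\<Inter>i\<in>{..k}. ?I \<inter> Z i -` (UNIV \<times> hbox u r)) \<inter> (?I \<inter> G -` cball 0 1))"
    by (intro closed_Int[OF closed_INT]) auto
  moreover have "D = (\<Inter>i\<in>{..k}. ?I \<inter> Z i -` (UNIV \<times> hbox u r)) \<inter> (?I \<inter> G -` cball 0 1)"
    by (auto simp: D_def mem_Times_iff)
  ultimately have "closed D" by simp
  moreover have "bounded D"
  proof -
    have "snd p \<in> cball 0 (r + r)" if "p \<in> D" for p
    proof -
      have "norm (upart u (snd p)) \<le> r" using that by (auto simp: D_def hbox_def Z0 dest!: spec[of _ 0])
      moreover have "norm (spart u (G p)) \<le> 1" using that norm_spart_le[of u "G p"] by (auto simp: D_def)
      then have "norm (spart u (snd p)) \<le> r" using r by (simp add: sG field_simps)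
      ultimately show ?thesis
        using norm_triangle_ineq[of "upart u (snd p)" "spart u (snd p)"] by (simp add: upart_plus_spart)
    qed
    then have "D \<subseteq> {0..1} \<times> cball 0 (r + r)" using D by force
    moreover have "bounded ({0..1 :: real} \<times> cball (0 :: real^2) (r + r))" by (intro bounded_Times) auto
    ultimately show ?thesis using bounded_subset by blast
  qed
  ultimately have cD: "compact D" using compact_eq_bounded_closed by blast
  let ?O = "{v. norm (upart u v) < r \<and> norm (spart u v) < r}"
  have oO: "open ?O" by (intro open_Collect_conj open_Collect_less continuous_intros)
  \<comment> \<open>This is why the set is open. By \<open>trans\<close>, a chain in the box has no
    unstable coordinate on the boundary before its last step and no stable one after a step; the
    last unstable coordinate is controlled by \<open>G\<close>, and the first stable one is
    0.\<close>
  have eq: "{p \<in> D. norm (G p) < 1} = (\<Inter>i\<in>{..k}. ?I \<inter> Z i -` (UNIV \<times> ?O)) \<inter> (?I \<inter> G -` ball 0 1)"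
  proof (intro set_eqI iffI)
    fix p assume p: "p \<in> {p \<in> D. norm (G p) < 1}"
    have box: "snd (Z i p) \<in> hbox u r" if "i \<le> k" for i using p that by (auto simp: D_def)
    have step: "norm (upart u (snd (Z i p))) < r \<and> norm (spart u (snd (Z (Suc i) p))) < r" if "i < k" for i
      using trans[of "fst p" "snd (Z i p)" i "fst (Z i p)"] box[of i] box[of "Suc i"] that p
      by (auto simp: ZS'[OF box] D_def)
    have "norm (upart u (snd (Z k p))) < r"
    proof -
      have "norm (upart u (G p)) < 1" using p norm_upart_le[of u "G p"] by auto
      then show ?thesis using r by (simp add: uG field_simps)
    qed
    then have "norm (upart u (snd (Z i p))) < r" if "i \<le> k" for i
      using step that by (cases "i = k") auto
    moreover have "norm (spart u (snd (Z i p))) < r" if "i \<le> k" for i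
      using step that r by (cases i) (auto simp: Z0)
    ultimately show "p \<in> (\<Inter>i\<in>{..k}. ?I \<inter> Z i -` (UNIV \<times> ?O)) \<inter> (?I \<inter> G -` ball 0 1)"
      using p D by (auto simp: mem_Times_iff)
  qed (auto simp: D_def hbox_def mem_Times_iff less_imp_le)
  have int: "openin (top_of_set ?I) {p \<in> D. norm (G p) < 1}"
    unfolding eq
    by (intro openin_Int openin_INT2 continuous_openin_preimage_gen cZ cG open_Times oO open_UNIV open_ball) auto
  define l where "l = rec_nat id (\<lambda>i f. L i \<circ> f)"
  have l0: "l 0 = id" and lS: "l (Suc i) = L i \<circ> l i" for i by (simp_all add: l_def)
  have linl: "linear (l i)" for i
  proof (induction i)
    case (Suc i)
    show ?case unfolding lS by (rule linear_compose[OF Suc lin(1)])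
  qed (simp only: l0 linear_id)
  have ul: "upart u (l i (upart u v)) = l i (upart u v)" for i v
  proof (induction i)
    case (Suc i)
    then show ?case using range[of i "l i (upart u v)"] by (simp add: lS)
  qed (simp add: l0)
  have sl: "spart u (l i (upart u v)) = 0" for i v
    using spart_upart[of u "l i (upart u v)"] by (simp add: ul)
  have step_le: "norm (l i (upart u v)) \<le> norm (l (Suc i) (upart u v))" for i v
    using expand[of "l i (upart u v)" i] by (simp add: lS ul)
  have mono: "norm (l i (upart u v)) \<le> norm (l j (upart u v))" if "i \<le> j" for i j v
    using that by (induction rule: dec_induct) (auto intro: order_trans step_le)
  define \<Lambda> where "\<Lambda> x = (1 / r) *\<^sub>R (l k (upart u x) + spart u x)" for x
  have lin\<Lambda>: "linear \<Lambda>" unfolding \<Lambda>_def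
    by (intro linear_compose_scale_right linear_compose_add linear_spart
      linear_compose[OF linear_upart linl, unfolded o_def])
  have u\<Lambda>: "upart u (\<Lambda> x) = (1 / r) *\<^sub>R l k (upart u x)"
    and s\<Lambda>: "spart u (\<Lambda> x) = (1 / r) *\<^sub>R spart u x" for x
    by (simp_all add: \<Lambda>_def ul sl)
  have inj: "inj \<Lambda>"
  proof (subst linear_injective_0[OF lin\<Lambda>], intro allI impI)
    fix x assume 0: "\<Lambda> x = 0"
    have "l k (upart u x) = 0" using u\<Lambda>[of x] r by (simp add: 0 linear_0[OF linear_upart])
    then have "upart u x = 0" using mono[of 0 k x] by (simp add: l0)
    moreover have "spart u x = 0" using s\<Lambda>[of x] r by (simp add: 0 linear_0[OF linear_spart])
    ultimately show "x = 0" using upart_plus_spart[of u x] by simp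
  qed
  have Z1: "snd (Z i (1, x)) = l i (upart u x)" if "\<And>j. j < i \<Longrightarrow> snd (Z j (1, x)) \<in> hbox u r" for i x
    using that
  proof (induction i)
    case 0
    then show ?case by (simp add: Z0 l0)
  next
    case (Suc i)
    have box: "snd (Z i (1, x)) \<in> hbox u r" using Suc.prems by simp
    have "snd (Z (Suc i) (1, x)) = L i (upart u (snd (Z i (1, x))))"
      using lin(2)[OF box, of i "fst (Z i (1, x))"] by (simp add: ZS'[OF box])
    then show ?case using Suc by (simp add: lS ul)
  qed
  \<comment> \<open>The linear maps do not shrink the unstable part, so a final value in the box
    bounds all earlier ones.\<close>
  have in_box: "snd (Z i (1, x)) \<in> hbox u r" if "norm (\<Lambda> x) \<le> 1" "i \<le> k" for x i
    using that(2)
  proof (induction i rule: less_induct)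
    case (less i)
    then have eq: "snd (Z i (1, x)) = l i (upart u x)" by (intro Z1) auto
    have "norm (upart u (\<Lambda> x)) \<le> 1" using that(1) norm_upart_le[of u "\<Lambda> x"] by simp
    then have "norm (l k (upart u x)) \<le> r" using r by (simp add: u\<Lambda> field_simps)
    then have "norm (l i (upart u x)) \<le> r" using mono[OF less.prems, of x] by simp
    then show ?case using r by (simp add: hbox_def eq ul sl)
  qed
  have G1: "G (1, x) = \<Lambda> x" if "\<And>j. j < k \<Longrightarrow> snd (Z j (1, x)) \<in> hbox u r" for x
    using Z1[OF that] by (simp add: G_def \<Lambda>_def ul)
  obtain x where x: "(0, x) \<in> D"
  proof (rule homotopy_to_linear_has_zero[OF cD D continuous_on_subset[OF cG D] _ int lin\<Lambda> inj])
    show "norm (G z) \<le> 1" if "z \<in> D" for z using that by (simp add: D_def)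
    show "(1, x) \<in> D \<longleftrightarrow> norm (\<Lambda> x) \<le> 1" for x
      using in_box[of x] G1[of x] by (auto simp: D_def)
    show "G (1, x) = \<Lambda> x" if "norm (\<Lambda> x) \<le> 1" for x
      using in_box[OF that] by (intro G1) auto
  qed blast
  show ?thesis
  proof (rule that[of "\<lambda>i. Z i (0, x)"])
    show box: "snd (Z i (0, x)) \<in> hbox u r" if "i \<le> k" for i using x that by (auto simp: D_def)
    show "Z (Suc i) (0, x) = g i 0 (Z i (0, x))" if "i < k" for i
      using ZS'[OF box] that by simp
  qed (simp add: Z0)
qed

section \<open>Margins of covering relations\<close>

lemma Nc_eq_hbox: "Nc N = hbox (udim N) 1"
  by (simp add: Nc_def hbox_def)

lemma attains_bound_below_1:
  fixes f :: "'a::topological_space \<Rightarrow> real"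
  assumes "compact A" "continuous_on A f" "\<And>p. p \<in> A \<Longrightarrow> f p < 1"
  obtains m where "m < 1" "\<And>p. p \<in> A \<Longrightarrow> f p \<le> m"
proof (cases "A = {}")
  case True
  then show ?thesis using that[of 0] by simp
next
  case False
  then obtain q where "q \<in> A" "\<And>p. p \<in> A \<Longrightarrow> f p \<le> f q"
    using continuous_attains_sup[OF assms(1) _ assms(2)] by metis
  then show ?thesis using that[of "f q"] assms(3) by simp
qed

text \<open>The disjointness conditions say that certain norms differ from 1 whenever the image lies
  in the target box. Such pairs form a compact set, so the norms stay below a common
  \<open>r0 < 1\<close>. This margin pays for shrinking the sets and for perturbing the map.\<close>

lemma covers_margin:
  assumes cov: "covers N f M" and u: "u = udim N"
  obtains h :: "real \<times> (real^2) \<Rightarrow> real^2" and L :: "real^2 \<Rightarrow> real^2" and r0 where "r0 < 1" and "continuous_on ({0..1} \<times> hbox u 1) h"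
    and "\<And>v. v \<in> hbox u 1 \<Longrightarrow> h (0, v) = cmap M (f (inv (cmap N) v))"
    and "\<And>l v. \<lbrakk>l \<in> {0..1}; v \<in> hbox u 1; h (l, v) \<in> hbox u 1\<rbrakk> \<Longrightarrow>
      norm (upart u v) \<le> r0 \<and> norm (spart u (h (l, v))) \<le> r0"
    and "linear L" "\<And>v. v \<in> hbox u 1 \<Longrightarrow> h (1, v) = L (upart u v)"
    and "\<And>v. upart u (L (upart u v)) = L (upart u v)"
    and "\<And>v. norm (upart u v) \<le> norm (L (upart u v))"
proof -
  have uM: "udim M = u" using cov u unfolding covers_def by simp
  have N: "Nc N = hbox u 1" "Nc M = hbox u 1" using u uM by (simp_all add: Nc_eq_hbox)
  obtain h :: "real \<times> (real^2) \<Rightarrow> real^2" where ch: "continuous_on ({0..1} \<times> Nc N) h"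
    and h0': "\<forall>v\<in>Nc N. h (0, v) = (cmap M \<circ> f \<circ> inv (cmap N)) v"
    and minus: "h ` ({0..1} \<times> Nc_minus N) \<inter> Nc M = {}"
    and plus: "h ` ({0..1} \<times> Nc N) \<inter> Nc_plus M = {}"
    and L: "udim N > 0 \<longrightarrow> (\<exists>L. linear L \<and> L ` range (upart (udim N)) \<subseteq> range (upart (udim N)) \<and>
      (\<forall>v\<in>Nc N. h (1, v) = L (upart (udim N) v)) \<and>
      (\<forall>p\<in>range (upart (udim N)). norm p = 1 \<longrightarrow> norm (L p) > 1))"
    and h1: "udim N = 0 \<longrightarrow> (\<forall>v\<in>Nc N. h (1, v) = 0)"
    using cov[unfolded covers_def] by (elim conjE exE) iprover
  note ch = ch[unfolded N] and minus = minus[unfolded N] and plus = plus[unfolded N]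
    and L = L[unfolded N u[symmetric]] and h1 = h1[unfolded N u[symmetric]]
  have h0: "h (0, v) = cmap M (f (inv (cmap N) v))" if "v \<in> hbox u 1" for v
    using h0' that unfolding N by simp
  let ?A = "({0..1} \<times> hbox u 1) \<inter> h -` hbox u 1"
  have "compact ({0..1 :: real} \<times> hbox u 1)" by (intro compact_Times compact_hbox) auto
  moreover have "closed ?A"
    by (intro continuous_closed_preimage[OF ch] closed_Times closed_hbox closed_atLeastAtMost)
  ultimately have "compact (({0..1} \<times> hbox u 1) \<inter> ?A)" by (rule compact_Int_closed)
  then have A: "compact ?A" by (simp add: Int_absorb Int_assoc[symmetric])
  obtain m1 where m1: "m1 < 1" "\<And>p. p \<in> ?A \<Longrightarrow> norm (upart u (snd p)) \<le> m1"
  proof (rule attains_bound_below_1[OF A])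
    show "continuous_on ?A (\<lambda>p. norm (upart u (snd p)))" by (intro continuous_intros)
    fix p assume p: "p \<in> ?A"
    have "norm (upart u (snd p)) \<noteq> 1"
    proof
      assume "norm (upart u (snd p)) = 1"
      then have "p \<in> {0..1} \<times> Nc_minus N"
        using p u by (auto simp: Nc_minus_def hbox_def mem_Times_iff)
      then have "h p \<in> h ` ({0..1} \<times> Nc_minus N) \<inter> hbox u 1" using p by blast
      then show False using minus by simp
    qed
    moreover have "norm (upart u (snd p)) \<le> 1" using p by (auto simp: hbox_def)
    ultimately show "norm (upart u (snd p)) < 1" by simp
  qed blast
  obtain m2 where m2: "m2 < 1" "\<And>p. p \<in> ?A \<Longrightarrow> norm (spart u (h p)) \<le> m2"
  proof (rule attains_bound_below_1[OF A])
    show "continuous_on ?A (\<lambda>p. norm (spart u (h p)))"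
      by (intro continuous_intros continuous_on_subset[OF ch]) auto
    fix p assume p: "p \<in> ?A"
    have "norm (spart u (h p)) \<noteq> 1"
    proof
      assume "norm (spart u (h p)) = 1"
      then have "h p \<in> Nc_plus M" using p uM by (auto simp: Nc_plus_def hbox_def)
      then have "h p \<in> h ` ({0..1} \<times> hbox u 1) \<inter> Nc_plus M" using p by blast
      then show False using plus by simp
    qed
    moreover have "norm (spart u (h p)) \<le> 1" using p by (auto simp: hbox_def)
    ultimately show "norm (spart u (h p)) < 1" by simp
  qed blast
  have margin: "norm (upart u v) \<le> max m1 m2 \<and> norm (spart u (h (l, v))) \<le> max m1 m2"
    if "l \<in> {0..1}" "v \<in> hbox u 1" "h (l, v) \<in> hbox u 1" for l v
    using m1(2)[of "(l, v)"] m2(2)[of "(l, v)"] that by auto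
  have r0: "max m1 m2 < 1" using m1 m2 by simp
  show ?thesis
  proof (cases "u = 0")
    case True
    \<comment> \<open>Without unstable directions the end map 0 is of the form
      \<open>L (upart u v)\<close> with the zero map, so this case needs no separate treatment
      later.\<close>
    have "upart u v = 0" for v using True by (simp add: upart_def vec_eq_iff forall_2)
    then show ?thesis
      using h1 True by (intro that[OF r0 ch, where L = "\<lambda>_. 0"] h0 margin linear_zero) auto
  next
    case False
    then have "0 < u" by simp
    then obtain L where L: "linear L" "L ` range (upart u) \<subseteq> range (upart u)"
      "\<forall>v\<in>hbox u 1. h (1, v) = L (upart u v)"
      "\<forall>p\<in>range (upart u). norm p = 1 \<longrightarrow> norm (L p) > 1"
      using L by blast
    have range: "upart u (L (upart u v)) = L (upart u v)" for v
    proof -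
      have "L (upart u v) \<in> range (upart u)" using L(2) by blast
      then show ?thesis by auto
    qed
    \<comment> \<open>Expansion is known on the unit sphere and extends to all vectors by
      scaling.\<close>
    have "norm (upart u v) \<le> norm (L (upart u v))" for v
    proof (cases "upart u v = 0")
      case False
      let ?n = "norm (upart u v)"
      have "upart u ((1 / ?n) *\<^sub>R v) = (1 / ?n) *\<^sub>R upart u v" by (rule linear_scale[OF linear_upart])
      then have "(1 / ?n) *\<^sub>R upart u v \<in> range (upart u)" by (metis rangeI)
      moreover have "norm ((1 / ?n) *\<^sub>R upart u v) = 1" using False by simp
      ultimately have "1 < norm (L ((1 / ?n) *\<^sub>R upart u v))" using L(4) by blast
      then have "1 < norm (L (upart u v)) / ?n" by (simp add: linear_scale[OF L(1)])
      then show ?thesis using False by (simp add: field_simps)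
    qed simp
    note expand = this
    show ?thesis 
    proof (rule that[OF r0 ch, where L = L])
      show "h (1, v) = L (upart u v)" if "v \<in> hbox u 1" for v using L(3) that by blast
    qed (use h0 margin L(1) range expand in simp_all)
  qed
qed

text \<open>The deviation of \<open>F\<close> from the unperturbed map is added to the homotopy
  \<open>h\<close> and faded out as \<open>l\<close> goes from 0 to 1. It never exceeds \<zeta>: an
  image in the box of radius r comes from an unperturbed image in the unit box, where the margin
  \<open>r0\<close> applies, and the inequalities for \<zeta> restore strictness at radius
  r.\<close>

lemma perturbed_covering_chain:
  fixes h :: "nat \<Rightarrow> real \<times> (real^2) \<Rightarrow> real^2" and F :: "nat \<Rightarrow> real \<times> (real^2) \<Rightarrow> real \<times> (real^2)"
    and L :: "nat \<Rightarrow> real^2 \<Rightarrow> real^2"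
  assumes r: "0 < r" "0 < \<zeta>" "r0 + \<zeta> < r" "r + \<zeta> \<le> 1"
    and ch: "\<And>i. continuous_on ({0..1} \<times> hbox u 1) (h i)"
    and margin: "\<And>i l v. \<lbrakk>l \<in> {0..1}; v \<in> hbox u 1; h i (l, v) \<in> hbox u 1\<rbrakk> \<Longrightarrow>
      norm (upart u v) \<le> r0 \<and> norm (spart u (h i (l, v))) \<le> r0"
    and L: "\<And>i. linear (L i)" "\<And>i v. v \<in> hbox u 1 \<Longrightarrow> h i (1, v) = L i (upart u v)"
      "\<And>i v. upart u (L i (upart u v)) = L i (upart u v)"
      "\<And>i v. norm (upart u v) \<le> norm (L i (upart u v))"
    and cF: "\<And>i. continuous_on (UNIV \<times> hbox u r) (F i)"
    and close: "\<And>i T v. v \<in> hbox u r \<Longrightarrow> norm (snd (F i (T, v)) - h i (0, v)) \<le> \<zeta>"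
  obtains z where "fst (z 0) = t0" "\<And>i. i \<le> k \<Longrightarrow> snd (z i) \<in> hbox u r"
    "\<And>i. i < k \<Longrightarrow> z (Suc i) = F i (z i)"
proof -
  define g where "g i l p = (fst (F i p), h i (l, snd p) + (1 - l) *\<^sub>R (snd (F i p) - h i (0, snd p)))"
    for i and l :: real and p
  have sub: "v \<in> hbox u 1" if "v \<in> hbox u r" for v using that r by (auto simp: hbox_def)
  show ?thesis
  proof (rule covering_chain[of r u g L t0 k, OF r(1) _ _ L(1) _ L(3,4)])
    fix i
    let ?A = "{0..1 :: real} \<times> (UNIV \<times> hbox u r)"
    have cF': "continuous_on ?A (\<lambda>p. F i (snd p))"
      by (rule continuous_on_compose2[OF cF]) (auto intro!: continuous_intros)
    have ch1: "continuous_on ?A (\<lambda>p. h i (fst p, snd (snd p)))"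
      by (rule continuous_on_compose2[OF ch]) (auto intro!: continuous_intros sub)
    have ch0: "continuous_on ?A (\<lambda>p. h i (0, snd (snd p)))"
      by (rule continuous_on_compose2[OF ch]) (auto intro!: continuous_intros sub)
    show "continuous_on ?A (\<lambda>p. g i (fst p) (snd p))"
      unfolding g_def by (intro continuous_intros cF' ch1 ch0)
  next
    fix i l T v
    assume l: "l \<in> {0..1 :: real}" and v: "v \<in> hbox u r" and y: "snd (g i l (T, v)) \<in> hbox u r"
    define y where "y = snd (g i l (T, v))"
    let ?d = "y - h i (l, v)"
    have "norm ?d = (1 - l) * norm (snd (F i (T, v)) - h i (0, v))"
      using l by (simp add: y_def g_def)
    also have "\<dots> \<le> 1 * \<zeta>" using l close[OF v] by (intro mult_mono) auto
    finally have d: "norm (upart u ?d) \<le> \<zeta>" "norm (spart u ?d) \<le> \<zeta>"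
      using norm_upart_le[of u ?d] norm_spart_le[of u ?d] by simp_all
    have h: "upart u (h i (l, v)) = upart u y - upart u ?d" "spart u (h i (l, v)) = spart u y - spart u ?d"
      by (simp_all add: linear_diff[OF linear_upart] linear_diff[OF linear_spart])
    have "norm (upart u (h i (l, v))) \<le> r + \<zeta>" "norm (spart u (h i (l, v))) \<le> r + \<zeta>"
      unfolding h using y d norm_triangle_ineq4[of "upart u y" "upart u ?d"]
        norm_triangle_ineq4[of "spart u y" "spart u ?d"] by (auto simp: hbox_def y_def[symmetric])
    then have "h i (l, v) \<in> hbox u 1" using r by (simp add: hbox_def)
    note m = margin[OF l sub[OF v] this]
    have "spart u y = spart u (h i (l, v)) + spart u ?d" using h(2) by simp
    then have "norm (spart u y) \<le> r0 + \<zeta>"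
      using m d norm_triangle_ineq[of "spart u (h i (l, v))" "spart u ?d"] by simp
    then show "norm (upart u v) < r \<and> norm (spart u (snd (g i l (T, v)))) < r"
      using m r by (simp add: y_def)
  next
    fix i T v assume "v \<in> hbox u r"
    then show "snd (g i 1 (T, v)) = L i (upart u v)" using L(2) sub by (simp add: g_def)
  next
    fix z assume z: "fst (z 0) = t0" "\<And>i. i \<le> k \<Longrightarrow> snd (z i) \<in> hbox u r"
      "\<And>i. i < k \<Longrightarrow> z (Suc i) = g i 0 (z i)"
    show ?thesis
    proof (rule that[of z])
      show "fst (z 0) = t0" by (rule z(1))
      show "snd (z i) \<in> hbox u r" if "i \<le> k" for i using z(2)[OF that] .
      show "z (Suc i) = F i (z i)" if "i < k" for i using z(3)[OF that] by (simp add: g_def)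
    qed
  qed
qed

text \<open>Perturbed return points lie near \<open>K\<close> but not in it, so uniform continuity
  is taken on a ball with room of width 1 around \<open>K\<close>.\<close>

lemma uniformly_close_on_compact:
  fixes f :: "'a::euclidean_space \<Rightarrow> 'b::metric_space"
  assumes f: "continuous_on UNIV f" and K: "bounded K" and \<epsilon>: "0 < \<epsilon>"
  obtains d where "0 < d" "\<And>p x. \<lbrakk>p \<in> K; norm (x - p) < d\<rbrakk> \<Longrightarrow> dist (f x) (f p) < \<epsilon>"
proof -
  obtain B where B: "\<And>p. p \<in> K \<Longrightarrow> norm p \<le> B" using K by (auto simp: bounded_iff)
  have "uniformly_continuous_on (cball 0 (B + 1)) f"
    by (rule compact_uniformly_continuous[OF continuous_on_subset[OF f]]) auto
  then obtain d where d: "0 < d" "\<And>p x. \<lbrakk>p \<in> cball 0 (B + 1); x \<in> cball 0 (B + 1); dist x p < d\<rbrakk> \<Longrightarrow>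
      dist (f x) (f p) < \<epsilon>"
    using \<epsilon> unfolding uniformly_continuous_on_def by metis
  show ?thesis
  proof (rule that[of "min d 1"])
    fix p x assume p: "p \<in> K" and x: "norm (x - p) < min d 1"
    have "norm x \<le> norm p + norm (x - p)" using norm_triangle_ineq[of p "x - p"] by simp
    then show "dist (f x) (f p) < \<epsilon>"
      using B[OF p] x by (intro d(2)) (auto simp: dist_norm)
  qed (use d in simp)
qed

lemma norm_to_plane_le: "norm (to_plane v) \<le> norm v"
proof -
  have "(norm (to_plane v))\<^sup>2 \<le> (norm v)\<^sup>2"
    by (simp add: power2_norm_eq_inner inner_vec_def sum_2 sum_3 to_plane_def)
  then show ?thesis by (rule power2_le_imp_le) simp
qed

lemma to_plane_diff: "to_plane v - to_plane w = to_plane (v - w)"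
  by (simp add: to_plane_def vec_eq_iff forall_2)

lemma continuous_on_from_plane: "continuous_on A from_plane"
proof -
  have "1-lipschitz_on A from_plane"
    by (rule lipschitz_onI) (simp_all add: dist_norm norm_from_plane_diff)
  then show ?thesis by (rule lipschitz_on_continuous_on)
qed

lemma continuous_on_to_plane: "continuous_on A to_plane"
proof -
  have "1-lipschitz_on A to_plane"
    by (rule lipschitz_onI) (simp_all add: dist_norm to_plane_diff norm_to_plane_le)
  then show ?thesis by (rule lipschitz_on_continuous_on)
qed

lemma Sigma_A_plus_edge:
  assumes "c \<in> Sigma_A_plus"
  shows "c i \<in> {0, 1, 2}" "(c i, c (Suc i)) \<in> {(0, 1), (0, 2), (1, 1), (1, 2), (2, 0)}"
proof -
  have c: "\<And>i. c i \<in> {0, 1, 2}" "\<And>i. 0 < alpha (c i) (c (i + 1))"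
    using assms unfolding Sigma_A_plus_def by blast+
  have "0 < alpha (c i) (c (Suc i))" using c(2)[of i] by simp
  with c(1)[of i] c(1)[of "Suc i"] show "c i \<in> {0, 1, 2}" "(c i, c (Suc i)) \<in> {(0, 1), (0, 2), (1, 1), (1, 2), (2, 0)}"
    by (auto simp: alpha_def)
qed

lemma norm_le_of_sup_norm:
  assumes "sup_norm e < ereal \<delta>"
  shows "norm (e p) \<le> \<delta>"
proof -
  have "ereal (norm (e p)) \<le> sup_norm e" unfolding sup_norm_def by (rule SUP_upper) simp
  then have "ereal (norm (e p)) < ereal \<delta>" using assms by (rule le_less_trans)
  then show ?thesis by simp
qed

lemma is_hset_facts:
  assumes "is_hset N"
  shows "continuous_on UNIV (cmap N)" "continuous_on UNIV (inv (cmap N))"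
    "cmap N (inv (cmap N) v) = v" "inv (cmap N) (cmap N w) = w"
    and "r \<le> 1 \<Longrightarrow> v \<in> hbox (udim N) r \<Longrightarrow> inv (cmap N) v \<in> supp N"
    and "w \<in> supp N \<longleftrightarrow> cmap N w \<in> hbox (udim N) 1"
proof -
  have h: "homeomorphism UNIV UNIV (cmap N) (inv (cmap N))" and im: "cmap N ` supp N = hbox (udim N) 1"
    using assms by (auto simp: is_hset_def Nc_eq_hbox)
  show "continuous_on UNIV (cmap N)" by (rule homeomorphism_cont1[OF h])
  show "continuous_on UNIV (inv (cmap N))" by (rule homeomorphism_cont2[OF h])
  show c: "cmap N (inv (cmap N) v) = v" for v by (rule homeomorphism_apply2[OF h]) simp
  show i: "inv (cmap N) (cmap N w) = w" for w by (rule homeomorphism_apply1[OF h]) simp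
  show *: "w \<in> supp N \<longleftrightarrow> cmap N w \<in> hbox (udim N) 1" for w
    unfolding im[symmetric] using i by (metis image_iff)
  show "inv (cmap N) v \<in> supp N" if "r \<le> 1" "v \<in> hbox (udim N) r"
    using that unfolding * c by (simp add: hbox_def)
qed

text \<open>Stated as one predicate, so that homotopy, linear map and radius can be chosen for all
  edges of the transition graph at once.\<close>

definition margin_data ::
    "nat \<Rightarrow> hset \<Rightarrow> (real^2 \<Rightarrow> real^2) \<Rightarrow> hset \<Rightarrow> (real \<times> (real^2) \<Rightarrow> real^2) \<Rightarrow> (real^2 \<Rightarrow> real^2) \<Rightarrow> real \<Rightarrow> bool" where
  "margin_data u N f M h L r0 \<longleftrightarrow> r0 < 1 \<and> continuous_on ({0..1} \<times> hbox u 1) h \<and>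
     (\<forall>v\<in>hbox u 1. h (0, v) = cmap M (f (inv (cmap N) v))) \<and>
     (\<forall>l\<in>{0..1}. \<forall>v\<in>hbox u 1. h (l, v) \<in> hbox u 1 \<longrightarrow>
       norm (upart u v) \<le> r0 \<and> norm (spart u (h (l, v))) \<le> r0) \<and>
     linear L \<and> (\<forall>v\<in>hbox u 1. h (1, v) = L (upart u v)) \<and>
     (\<forall>v. upart u (L (upart u v)) = L (upart u v)) \<and>
     (\<forall>v. norm (upart u v) \<le> norm (L (upart u v)))"

lemma covers_margin_data:
  assumes "covers N f M" "u = udim N"
  shows "\<exists>h L r0. margin_data u N f M h L r0"
  by (rule covers_margin[OF assms]) (unfold margin_data_def, blast)

theorem theorem4:
  fixes a b :: real and N :: "nat \<Rightarrow> hset"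
  assumes "a = 5.7" and "b = 0.2"
    and "\<And>i. i \<in> {0, 1, 2} \<Longrightarrow> is_hset (N i)"
    and "\<And>i. i \<in> {0, 1, 2} \<Longrightarrow> from_plane ` supp (N i) \<subseteq> Theta"
    and "\<And>i. i \<in> {0, 1, 2} \<Longrightarrow> from_plane ` supp (N i) \<subseteq> poincare_domain a b"
    and "covers (N 0) (plane_poincare a b) (N 1)"
    and "covers (N 0) (plane_poincare a b) (N 2)"
    and "covers (N 1) (plane_poincare a b) (N 1)"
    and "covers (N 1) (plane_poincare a b) (N 2)"
    and "covers (N 2) (plane_poincare a b) (N 0)"
  shows "\<exists>\<delta>>0. \<forall>e :: real \<times> (real^3) \<Rightarrow> real^3.
           continuous_on UNIV e \<and> sup_norm e < ereal \<delta> \<longrightarrow>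
           (\<forall>t0 :: real. \<forall>c \<in> Sigma_A_plus.
              \<exists>(x :: real \<Rightarrow> real^3) (\<tau> :: nat \<Rightarrow> real).
                ode_solution (\<lambda>t v. rossler a b v + e (t, v)) x {t0..} \<and>
                \<tau> 0 = t0 \<and> strict_mono \<tau> \<and>
                (\<forall>t\<ge>t0. x t \<in> Theta \<longleftrightarrow> (\<exists>i. t = \<tau> i)) \<and>
                (\<forall>i. x (\<tau> i) \<in> from_plane ` supp (N (c i))))"
proof -
  define I where "I = {0, 1, 2 :: nat}"
  define E :: "(nat \<times> nat) set" where "E = {(0, 1), (0, 2), (1, 1), (1, 2), (2, 0)}"
  define u where "u = udim (N 0)"
  let ?P = "poincare a b" and ?PP = "plane_poincare a b"
  have cov: "covers (N i) ?PP (N j)" if "(i, j) \<in> E" for i j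
    using that assms(6-10) unfolding E_def by auto
  have EI: "i \<in> I" "j \<in> I" if "(i, j) \<in> E" for i j using that by (auto simp: E_def I_def)
  have out: "\<exists>j. (i, j) \<in> E" if "i \<in> I" for i using that by (auto simp: E_def I_def)
  have hset: "is_hset (N i)" and dom: "from_plane ` supp (N i) \<subseteq> poincare_domain a b"
    if "i \<in> I" for i using assms(3,5) that by (simp_all only: I_def)
  have u: "udim (N i) = u" if "i \<in> I" for i
  proof -
    have "udim (N 1) = u" "udim (N 2) = u" using assms(6,7) by (auto simp: covers_def u_def)
    then show ?thesis using that by (auto simp: I_def u_def)
  qed
  have "\<exists>d. margin_data u (N (fst p)) ?PP (N (snd p)) (fst d) (fst (snd d)) (snd (snd d))" if "p \<in> E" for p
    using covers_margin_data[OF cov, of "fst p" "snd p" u] that u EI by (cases p) (auto simp: fst_conv)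
  then obtain D where D: "\<And>p. p \<in> E \<Longrightarrow>
      margin_data u (N (fst p)) ?PP (N (snd p)) (fst (D p)) (fst (snd (D p))) (snd (snd (D p)))"
    by metis
  define h where "h i j = fst (D (i, j))" for i j
  define L where "L i j = fst (snd (D (i, j)))" for i j
  \<comment> \<open>One radius for all five coverings; inserting 0 makes it nonnegative, so that r
    is positive.\<close>
  define r0 where "r0 = Max (insert 0 ((\<lambda>p. snd (snd (D p))) ` E))"
  have md: "margin_data u (N i) ?PP (N j) (h i j) (L i j) (snd (snd (D (i, j))))" if "(i, j) \<in> E" for i j
    using D[OF that] by (simp add: h_def L_def)
  have fE: "finite E" by (simp add: E_def)
  have r0: "0 \<le> r0" "\<And>p. p \<in> E \<Longrightarrow> snd (snd (D p)) \<le> r0"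
    unfolding r0_def using fE by auto
  have r0': "r0 < 1"
    unfolding r0_def using fE D by (subst Max_less_iff) (auto simp: margin_data_def)
  \<comment> \<open>The radius r is halfway between \<open>r0\<close> and 1, and \<zeta> is half of
    the remaining gap: an error \<zeta> neither reaches r from \<open>r0\<close> nor exceeds 1 from
    r.\<close>
  define r where "r = (1 + r0) / 2"
  define \<zeta> where "\<zeta> = (1 - r0) / 4"
  have r: "0 < r" "0 < \<zeta>" "r0 + \<zeta> < r" "r + \<zeta> \<le> 1" "r < 1"
    using r0 r0' by (auto simp: r_def \<zeta>_def field_simps)
  define emb where "emb i v = from_plane (inv (cmap (N i)) v)" for i v
  define crd where "crd i w = cmap (N i) (to_plane w)" for i w
  have cemb: "continuous_on A (emb i)" if "i \<in> I" for i A
    unfolding emb_def using is_hset_facts(2)[OF hset[OF that]]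
    by (intro continuous_on_compose2[OF continuous_on_from_plane[of UNIV]]) (auto intro: continuous_on_subset)
  have ccrd: "continuous_on A (crd i)" if "i \<in> I" for i A
    unfolding crd_def
    by (intro continuous_on_compose2[OF is_hset_facts(1)[OF hset[OF that]]] continuous_on_to_plane) auto
  have emb_crd: "emb i (crd i w) = w" if "i \<in> I" "w \<in> Theta" for i w
    using that is_hset_facts(4)[OF hset[OF that(1)]]
    by (simp add: emb_def crd_def from_plane_to_plane Theta_def)
  define K where "K i = emb i ` hbox u r" for i
  define Q where "Q = (\<Union>i\<in>I. K i)"
  have cK: "compact (K i)" if "i \<in> I" for i
    unfolding K_def by (intro compact_continuous_image cemb that compact_hbox)
  have cQ: "compact Q" unfolding Q_def by (intro compact_UN cK) (auto simp: I_def)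
  have KQ: "K i \<subseteq> Q" if "i \<in> I" for i using that by (auto simp: Q_def)
  have Ksupp: "K i \<subseteq> from_plane ` supp (N i)" if "i \<in> I" for i
    using is_hset_facts(5)[OF hset[OF that], of r] r u[OF that] by (auto simp: K_def emb_def)
  have Qdom: "Q \<subseteq> poincare_domain a b" unfolding Q_def using Ksupp dom by blast
  then have Q\<Theta>: "Q \<subseteq> Theta" by (auto simp: poincare_domain_def)
  define O1 where "O1 = {v. norm (upart u v) < 1 \<and> norm (spart u v) < 1}"
  have oO1: "open O1" unfolding O1_def by (intro open_Collect_conj open_Collect_less continuous_intros)
  \<comment> \<open>Continuity of the Poincare map on an open set is what keeps orbits off the
    closure of \<open>Theta\<close>; the unit boxes without boundary provide such a set, and it
    contains the shrunken h-sets in plane coordinates.\<close>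
  define W where "W = (\<Union>i\<in>I. cmap (N i) -` O1)"
  have oW1: "open (cmap (N i) -` O1)" if "i \<in> I" for i
    by (rule open_vimage[OF oO1 is_hset_facts(1)[OF hset[OF that]]])
  then have oW: "open W" unfolding W_def by (intro open_UN) simp
  have Wsupp: "cmap (N i) -` O1 \<subseteq> supp (N i)" if "i \<in> I" for i
    using u[OF that] by (intro subsetI, subst is_hset_facts(6)[OF hset[OF that]]) (simp add: O1_def hbox_def)
  have Wdom: "from_plane ` W \<subseteq> poincare_domain a b" unfolding W_def using Wsupp dom by blast
  have cPP: "continuous_on W ?PP"
    unfolding W_def
  proof (rule continuous_on_open_UN[OF oW1])
    fix i assume i: "i \<in> I"
    \<comment> \<open>Every symbol has a successor, and the covering relation of that edge includes
      continuity on the whole support.\<close>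
    then obtain j where "(i, j) \<in> E" using out by blast
    then have "continuous_on (supp (N i)) ?PP" using cov by (simp add: covers_def)
    then show "continuous_on (cmap (N i) -` O1) ?PP" using Wsupp[OF i] continuous_on_subset by blast
  qed
  have QW: "to_plane w \<in> W" "from_plane (to_plane w) = w" if w: "w \<in> Q" for w
  proof -
    obtain i v where i: "i \<in> I" "v \<in> hbox u r" "w = emb i v" using w unfolding Q_def K_def by blast
    then have "cmap (N i) (to_plane w) = v" using is_hset_facts(3)[OF hset[OF i(1)]] by (simp add: emb_def)
    then have "to_plane w \<in> cmap (N i) -` O1" using i(2) r by (simp add: O1_def hbox_def)
    then show "to_plane w \<in> W" unfolding W_def using i(1) by blast
    show "from_plane (to_plane w) = w" using i by (simp add: emb_def)
  qed
  have P\<Theta>: "?P w \<in> Theta" if "w \<in> poincare_domain a b" for w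
    by (rule poincare_orbit[OF that]) (simp add: first_hit_def)
  have PP: "from_plane (?PP (to_plane w)) = ?P w" if "w \<in> Q" for w
    using P\<Theta>[of w] Qdom QW(2)[OF that] that
    by (auto simp: plane_poincare_def from_plane_to_plane Theta_def)
  have cP: "continuous_on Q ?P"
  proof -
    have "continuous_on Q (\<lambda>w. from_plane (?PP (to_plane w)))"
      by (intro continuous_on_compose2[OF continuous_on_from_plane[of UNIV]]
        continuous_on_compose2[OF cPP] continuous_on_to_plane) (use QW in auto)
    then show ?thesis by (rule continuous_on_eq) (rule PP)
  qed
  have orbit: "\<exists>y \<sigma>. ode_solution (\<lambda>_. rossler a b) y {0..\<sigma>} \<and> y 0 = w \<and>
      first_hit y \<sigma> \<and> (\<forall>s. 0 < s \<and> s < \<sigma> \<longrightarrow> y s \<notin> closure Theta)" if w: "w \<in> Q" for w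
  proof -
    obtain y \<sigma> where y: "ode_solution (\<lambda>_. rossler a b) y {0..\<sigma>}" "y 0 = w" "first_hit y \<sigma>"
      using poincare_orbit[of w a b] Qdom w by blast
    then show ?thesis
      using orbit_avoids_closure_Theta[OF oW QW(1)[OF w] Wdom cPP y(1,3)] QW(2)[OF w] by auto
  qed
  have bP: "bounded ((\<lambda>w. to_plane (?P w)) ` Q)"
    by (intro compact_imp_bounded compact_continuous_image cQ
      continuous_on_compose2[OF continuous_on_to_plane[of UNIV] cP]) auto
  have "\<exists>d>0. \<forall>p x. p \<in> (\<lambda>w. to_plane (?P w)) ` Q \<longrightarrow> norm (x - p) < d \<longrightarrow> dist (cmap (N j) x) (cmap (N j) p) < \<zeta>"
    if "j \<in> I" for j
    by (rule uniformly_close_on_compact[OF is_hset_facts(1)[OF hset[OF that]] bP r(2)]) blast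
  then obtain d where d: "\<And>j. j \<in> I \<Longrightarrow> 0 < d j"
    and dclose: "\<And>j p x. \<lbrakk>j \<in> I; p \<in> (\<lambda>w. to_plane (?P w)) ` Q; norm (x - p) < d j\<rbrakk> \<Longrightarrow>
      dist (cmap (N j) x) (cmap (N j) p) < \<zeta>"
    by metis
  \<comment> \<open>The return map of polygons is off by less than 2 * \<eta>, which must be
    admissible in every chart.\<close>
  define \<eta> where "\<eta> = Min (d ` I) / 2"
  have fI: "finite I" "I \<noteq> {}" by (auto simp: I_def)
  have \<eta>: "0 < \<eta>" "\<And>j. j \<in> I \<Longrightarrow> 2 * \<eta> \<le> d j" using fI d by (auto simp: \<eta>_def)
  obtain M \<delta> S \<theta> where M: "0 \<le> M" and \<delta>: "0 < \<delta>" and S: "0 < S" and \<theta>: "0 < \<theta>"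
    and win: "\<And>w. w \<in> Q \<Longrightarrow> \<exists>\<rho>>0. \<exists>\<alpha> \<beta> p. \<theta> \<le> \<alpha> \<and> \<alpha> < \<beta> \<and> \<beta> \<le> S \<and>
    (\<forall>x. pseudo_orbit (rossler a b \<circ> trunc M) \<delta> x S \<longrightarrow> x 0 \<in> Q \<longrightarrow> norm (x 0 - w) < \<rho> \<longrightarrow>
      window a b \<eta> p x \<alpha> \<beta> \<and> (\<forall>t\<in>{0..\<beta>}. norm (x t) \<le> M) \<and> norm (p - poincare a b (x 0)) < \<eta>)"
    by (rule uniform_window[OF cQ Q\<Theta> \<eta>(1) cP orbit], assumption, rule that)
  obtain Lip where Lip: "Lip-lipschitz_on UNIV (rossler a b \<circ> trunc M)"
    using rossler.lipschitz[of M] lipschitz_on_comp_trunc M by blast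
  obtain V where V: "\<And>v. norm ((rossler a b \<circ> trunc M) v) \<le> V"
    by (rule bounded_comp_trunc[where g = "rossler a b", OF rossler.continuous M], rule that)
  show ?thesis
  proof (intro exI[of _ "\<delta> / 2"] conjI allI ballI impI)
    show "0 < \<delta> / 2" using \<delta> by simp
    fix e :: "real \<times> (real^3) \<Rightarrow> real^3" and t0 :: real and c
    assume e: "continuous_on UNIV e \<and> sup_norm e < ereal (\<delta> / 2)" and c: "c \<in> Sigma_A_plus"
    then have e\<delta>: "norm (e p) \<le> \<delta> / 2" for p using norm_le_of_sup_norm by blast
    interpret pr: perturbed_rossler a b M \<delta> S \<theta> \<eta> Lip "V + \<delta> / 2" Q e
    proof
      show "norm ((rossler a b \<circ> trunc M) v + e (t, v)) \<le> V + \<delta> / 2" for t v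
        using norm_triangle_mono[OF V e\<delta>] .
    qed (use M \<delta> S \<theta> Q\<Theta> cQ e e\<delta> Lip win compact_imp_closed in auto)
    have cI: "c i \<in> I" and cE: "(c i, c (Suc i)) \<in> E" for i
      using Sigma_A_plus_edge[OF c, of i] by (simp_all add: I_def E_def)
    have chain: "\<exists>s. fst (s 0) = t0 \<and> (\<forall>i\<le>n. snd (s i) \<in> K (c i)) \<and> (\<forall>i<n. s (Suc i) = pr.next_state J (s i))"
      if J: "pr.fine_mesh J" for J n
    proof -
      define q where "q i p = pr.next_state J (fst p, emb (c i) (snd p))" for i p
      \<comment> \<open>The polygon map from one shrunken h-set, written in its chart and in the
        chart of the next; the time component is passed on unchanged.\<close>
      define F where "F i p = (fst (q i p), crd (c (Suc i)) (snd (q i p)))" for i p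
      have embQ: "emb (c i) v \<in> Q" if "v \<in> hbox u r" for i v
        using that cI by (auto simp: Q_def K_def)
      have cq: "continuous_on (UNIV \<times> hbox u r) (q i)" for i
        unfolding q_def
        by (rule continuous_on_compose2[OF pr.continuous_on_next_state[OF J]])
          (auto intro!: continuous_intros continuous_on_compose2[OF cemb[OF cI, of UNIV]] embQ)
      have cF: "continuous_on (UNIV \<times> hbox u r) (F i)" for i
        unfolding F_def
        by (intro continuous_intros cq continuous_on_compose2[OF ccrd[OF cI, of UNIV]]) auto
      have close: "norm (snd (F i (T, v)) - h (c i) (c (Suc i)) (0, v)) \<le> \<zeta>" if v: "v \<in> hbox u r" for i T v
      proof -
        let ?w = "emb (c i) v" and ?x = "snd (q i (T, v))"
        have wQ: "?w \<in> Q" by (rule embQ[OF v])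
        have "norm (?x - ?P ?w) < 2 * \<eta>" using pr.next_state(4)[OF J, of "(T, ?w)"] wQ by (simp add: q_def)
        then have "norm (to_plane ?x - to_plane (?P ?w)) < d (c (Suc i))"
          using norm_to_plane_le[of "?x - ?P ?w"] \<eta>(2)[OF cI[of "Suc i"]] by (simp add: to_plane_diff)
        then have "dist (cmap (N (c (Suc i))) (to_plane ?x)) (cmap (N (c (Suc i))) (to_plane (?P ?w))) < \<zeta>"
          using wQ by (intro dclose cI) auto
        moreover have "v \<in> hbox u 1" using v r by (auto simp: hbox_def)
        then have "h (c i) (c (Suc i)) (0, v) = cmap (N (c (Suc i))) (to_plane (?P ?w))"
          using md[OF cE[of i]] by (simp add: margin_data_def plane_poincare_def emb_def)
        ultimately show ?thesis by (simp add: F_def crd_def dist_norm)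
      qed
      obtain z where z0: "fst (z 0) = t0" and zb: "\<And>i. i \<le> n \<Longrightarrow> snd (z i) \<in> hbox u r"
        and zS: "\<And>i. i < n \<Longrightarrow> z (Suc i) = F i (z i)"
      proof (rule perturbed_covering_chain[OF r(1-4), where u = u and h = "\<lambda>i. h (c i) (c (Suc i))"
            and L = "\<lambda>i. L (c i) (c (Suc i))" and F = F and ?t0.0 = t0 and k = n])
        fix i
        note m = md[OF cE[of i], unfolded margin_data_def]
        show "continuous_on ({0..1} \<times> hbox u 1) (h (c i) (c (Suc i)))" using m by blast
        show "linear (L (c i) (c (Suc i)))" using m by blast
        show "upart u (L (c i) (c (Suc i)) (upart u v)) = L (c i) (c (Suc i)) (upart u v)" for v
          using m by blast
        show "norm (upart u v) \<le> norm (L (c i) (c (Suc i)) (upart u v))" for v using m by blast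
        show "h (c i) (c (Suc i)) (1, v) = L (c i) (c (Suc i)) (upart u v)" if "v \<in> hbox u 1" for v
          using m that by blast
        show "norm (upart u v) \<le> r0 \<and> norm (spart u (h (c i) (c (Suc i)) (l, v))) \<le> r0"
          if "l \<in> {0..1}" "v \<in> hbox u 1" "h (c i) (c (Suc i)) (l, v) \<in> hbox u 1" for l v
        proof -
          have "norm (upart u v) \<le> snd (snd (D (c i, c (Suc i)))) \<and>
            norm (spart u (h (c i) (c (Suc i)) (l, v))) \<le> snd (snd (D (c i, c (Suc i))))"
            using m that by blast
          then show ?thesis using r0(2)[OF cE[of i]] by simp
        qed
      qed (use cF close in auto)
      show ?thesis
      proof (intro exI[of _ "\<lambda>i. (fst (z i), emb (c i) (snd (z i)))"] conjI allI impI)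
        show "snd (fst (z i), emb (c i) (snd (z i))) \<in> K (c i)" if "i \<le> n" for i
          using zb[OF that] by (simp add: K_def)
        fix i assume i: "i < n"
        \<comment> \<open>The charts know only the plane x = 0. A return point can be recovered from
          its coordinates because it lies in \<open>Theta\<close>.\<close>
        have "snd (q i (z i)) \<in> Theta"
          unfolding q_def using embQ[OF zb[of i]] i by (intro pr.next_state(3)[OF J]) simp
        then show "(fst (z (Suc i)), emb (c (Suc i)) (snd (z (Suc i)))) =
            pr.next_state J (fst (z i), emb (c i) (snd (z i)))"
          using zS[OF i] emb_crd[OF cI] by (simp add: F_def q_def)
      qed (simp add: z0)
    qed
    have "\<exists>x \<tau>. ode_solution (\<lambda>t v. rossler a b v + e (t, v)) x {t0..} \<and> \<tau> 0 = t0 \<and> strict_mono \<tau> \<and>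
      (\<forall>t\<ge>t0. x t \<in> Theta \<longleftrightarrow> (\<exists>i. t = \<tau> i)) \<and> (\<forall>i. x (\<tau> i) \<in> K (c i))"
      by (rule pr.infinite_itinerary[OF cK[OF cI] KQ[OF cI] chain])
    then show "\<exists>x \<tau>. ode_solution (\<lambda>t v. rossler a b v + e (t, v)) x {t0..} \<and> \<tau> 0 = t0 \<and> strict_mono \<tau> \<and>
      (\<forall>t\<ge>t0. x t \<in> Theta \<longleftrightarrow> (\<exists>i. t = \<tau> i)) \<and> (\<forall>i. x (\<tau> i) \<in> from_plane ` supp (N (c i)))"
      using Ksupp[OF cI] by blast
  qed
qed

end
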